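(* Let $k\geq 2$ be an integer and let $\alpha\in[\frac{k-1}{k},1]$ be rational. Let $\ell$ be the smallest positive integer such that $\frac{\ell}{2k-1}$ and $\frac{\alpha\ell}{2k-1}$ are integers. There exist integers $s_0,q_0$ such that for every integer $s\geq s_0$ and every prime power $q\geq q_0$ there exists a bipartite graph $G$ with parts $M,N$, $|M|=q^{\alpha\ell}$, $|N|=q^{\ell}$, such that $G$ is $\Theta_{s,2k-1}$-free and \[e(G)\geq \frac12 |M|^{\frac{k}{2k-1}}|N|^{\frac{k}{2k-1}}.\]
   Context: The theta graph $\Theta_{s,k}$ is the graph consisting of $s$ paths of length $k$ with the same two endpoints that are otherwise pairwise vertex-disjoint. *)

theory Defs
  imports Complex_Main "HOL-Number_Theory.Prime_Powers"
begin

type_synonym 'a ugraph = "'a set \<times> 'a set set"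

abbreviation verts :: "'a ugraph \<Rightarrow> 'a set" where
  "verts G \<equiv> fst G"

abbreviation edges :: "'a ugraph \<Rightarrow> 'a set set" where
  "edges G \<equiv> snd G"

definition finite_simple_graph :: "'a ugraph \<Rightarrow> bool" where
  "finite_simple_graph G \<longleftrightarrow>
     finite (verts G) \<and> (\<forall>e\<in>edges G. e \<subseteq> verts G \<and> card e = 2)"

definition bipartite_with_parts :: "'a ugraph \<Rightarrow> 'a set \<Rightarrow> 'a set \<Rightarrow> bool" where
  "bipartite_with_parts G M N \<longleftrightarrow>
     finite_simple_graph G \<and> verts G = M \<union> N \<and> M \<inter> N = {} \<and>
     (\<forall>e\<in>edges G. \<exists>x\<in>M. \<exists>y\<in>N. e = {x, y})"

text \<open>Containment is as a not necessarily induced subgraph.\<close>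

definition contains_copy :: "'a ugraph \<Rightarrow> 'b ugraph \<Rightarrow> bool" where
  "contains_copy G H \<longleftrightarrow>
     (\<exists>f. inj_on f (verts H) \<and> f ` verts H \<subseteq> verts G \<and> (\<forall>e\<in>edges H. f ` e \<in> edges G))"

definition free_of :: "'a ugraph \<Rightarrow> 'b ugraph \<Rightarrow> bool" where
  "free_of G H \<longleftrightarrow> \<not> contains_copy G H"

text \<open>
  The \<open>j\<close>-th vertex (\<open>0 \<le> j \<le> k\<close>) of the \<open>i\<close>-th path. The two endpoints, \<open>j = 0\<close> and \<open>j = k\<close>,
  do not depend on \<open>i\<close>.
\<close>

definition theta_vertex :: "nat \<Rightarrow> nat \<Rightarrow> nat \<Rightarrow> nat \<times> nat" where
  "theta_vertex k i j = (if j = 0 \<or> j = k then (0, j) else (i, j))"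

definition theta_graph :: "nat \<Rightarrow> nat \<Rightarrow> (nat \<times> nat) ugraph" where
  "theta_graph s k =
     ({theta_vertex k i j | i j. i < s \<and> j \<le> k},
      {{theta_vertex k i j, theta_vertex k i (Suc j)} | i j. i < s \<and> j < k})"

lemma finite_simple_graph_theta_graph: "finite_simple_graph (theta_graph s k)"
proof -
  have "{theta_vertex k i j | i j. i < s \<and> j \<le> k}
      = (\<lambda>(i, j). theta_vertex k i j) ` ({..<s} \<times> {..k})"
    by auto
  then have "finite {theta_vertex k i j | i j. i < s \<and> j \<le> k}"
    by simp
  moreover have "e \<subseteq> {theta_vertex k i j | i j. i < s \<and> j \<le> k} \<and> card e = 2"
    if "e \<in> {{theta_vertex k i j, theta_vertex k i (Suc j)} | i j. i < s \<and> j < k}" for e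
  proof -
    from that obtain i j where e: "e = {theta_vertex k i j, theta_vertex k i (Suc j)}"
      and ij: "i < s" "j < k" by blast
    have "j \<le> k" "Suc j \<le> k" using ij by simp_all
    then have "e \<subseteq> {theta_vertex k i j | i j. i < s \<and> j \<le> k}"
      using e ij(1) by blast
    moreover have "theta_vertex k i j \<noteq> theta_vertex k i (Suc j)"
      by (simp add: theta_vertex_def)
    ultimately show ?thesis using e by simp
  qed
  ultimately show ?thesis
    unfolding finite_simple_graph_def theta_graph_def fst_conv snd_conv by blast
qed

end

theory Submission
  imports Defs "HOL-Library.FuncSet" "HOL-Algebra.Algebraic_Closure" "HOL-Number_Theory.Residues"
begin

text \<open>
  Write \<open>g = l / (2k - 1)\<close>, \<open>h = \<alpha> l / (2k - 1)\<close>, \<open>t = (k - 1) (g + h)\<close>, \<open>r = k h - (k - 1) g\<close> and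
  \<open>r' = k g - (k - 1) h\<close>, and let \<open>K\<close> be the field with \<open>q\<close> elements. The vertices in \<open>M\<close> are the pairs \<open>(a, u)\<close> with
  \<open>a \<in> K\<^sup>r\<close>, \<open>u \<in> K\<^sup>t\<close>, those in \<open>N\<close> the pairs \<open>(b, v)\<close> with \<open>b \<in> K\<^bsup>r'\<^esup>\<close>, \<open>v \<in> K\<^sup>t\<close>, and they are adjacent if
  \<open>u\<^sub>j + v\<^sub>j = f\<^sub>j (a, b, u\<^sub>0, \<dots>, u\<^bsub>j-1\<^esub>, v\<^sub>0, \<dots>, v\<^bsub>j-1\<^esub>)\<close> for all \<open>j < t\<close>. Each level is an abelian cover of the previous
  one, and there are exactly \<open>q\<^bsup>r+r'+t\<^esup> = |M|\<^bsup>k/(2k-1)\<^esup> |N|\<^bsup>k/(2k-1)\<^esup>\<close> edges. A walk of length \<open>2k - 1\<close> between two given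
  vertices is described by \<open>(k - 1) (r + r') = t\<close> free label coordinates, and closing up is one polynomial equation
  per level. It remains to choose polynomials \<open>f\<^sub>j\<close> of bounded degree for which boundedly many nonbacktracking walks
  close up.

  No algebraic geometry is needed. The dimension of a finite set \<open>A\<close> of walks is read off from the growth in \<open>d\<close>
  of the number of restrictions to \<open>A\<close> of polynomials of degree at most \<open>d\<close>. Every set is a union of boundedly many
  pieces on which two nonzero polynomials of bounded degree have a nonzero product. On such a piece an equation
  that does not hold identically lowers the growth exponent by one, and a piece with exponent \<open>0\<close> has bounded size.
  The pieces that occur at level \<open>j\<close> depend only on the earlier \<open>f\<^sub>i\<close> and are polynomially many in \<open>q\<close>, so by counting
  some \<open>f\<^sub>j\<close> gives an equation that is nontrivial on all pieces where the edges of the walk do not cancel.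

  Cancellation needs vertices of the walk that coincide at lower levels. A level at which everything cancels
  separates such vertices, and each coincidence costs at least one of the \<open>t\<close> free coordinates. Hence there
  are still at least as many equations that do not cancel as remaining dimensions.
\<close>

section \<open>Polynomial functions on finite sets\<close>

text \<open>A field inside a ring of arbitrary characteristic; its unit \<open>e\<close> is in general not the \<open>1\<close> of the ring.\<close>

locale finite_subfield =
  fixes K :: "'a::comm_ring_1 set" and e :: 'a
  assumes finK: "finite K" and eK: "e \<in> K" and e0: "e \<noteq> 0"
    and addK: "x \<in> K \<Longrightarrow> y \<in> K \<Longrightarrow> x + y \<in> K"
    and multK: "x \<in> K \<Longrightarrow> y \<in> K \<Longrightarrow> x * y \<in> K"
    and uminusK: "x \<in> K \<Longrightarrow> - x \<in> K"
    and unitK: "x \<in> K \<Longrightarrow> e * x = x"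
    and invK: "x \<in> K \<Longrightarrow> x \<noteq> 0 \<Longrightarrow> \<exists>y\<in>K. x * y = e"
begin

abbreviation q :: nat where "q \<equiv> card K"

lemma zeroK: "0 \<in> K"
  using addK[OF eK uminusK[OF eK]] by simp

lemma diffK: "x \<in> K \<Longrightarrow> y \<in> K \<Longrightarrow> x - y \<in> K"
  using addK[of x "- y"] uminusK[of y] by simp

lemma sumK: "(\<And>i. i \<in> I \<Longrightarrow> f i \<in> K) \<Longrightarrow> sum f I \<in> K"
  by (induction I rule: infinite_finite_induct) (auto simp: zeroK addK)

lemma signK: "x \<in> K \<Longrightarrow> (-1) ^ m * x \<in> K"
  by (induction m) (auto simp: uminusK)

lemma integralK: "x \<in> K \<Longrightarrow> y \<in> K \<Longrightarrow> x * y = 0 \<Longrightarrow> x = 0 \<or> y = 0"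
proof (rule ccontr)
  assume xy: "x \<in> K" "y \<in> K" "x * y = 0" "\<not> (x = 0 \<or> y = 0)"
  then obtain x' where x': "x' \<in> K" "x * x' = e" using invK by blast
  have "y = e * y" using unitK xy by simp
  also have "\<dots> = x' * (x * y)" using x' by (metis mult.assoc mult.commute)
  finally show False using xy by simp
qed

lemma mult_cancelK: "c \<in> K \<Longrightarrow> x \<in> K \<Longrightarrow> y \<in> K \<Longrightarrow> c \<noteq> 0 \<Longrightarrow> x * c = y * c \<Longrightarrow> x = y"
  using integralK[of "x - y" c] diffK by (auto simp: left_diff_distrib)

lemma q_ge_2: "2 \<le> q"
proof -
  have "card {0, e} \<le> q" by (rule card_mono) (auto simp: finK zeroK eK)
  moreover have "card {0, e} = 2" using e0 by (metis card_2_iff)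
  ultimately show ?thesis by simp
qed

text \<open>The degree belongs to an expression in the generators, not to the function. Over a
  finite field one function has many expressions, and \<open>polyfun \<Gamma> d f\<close> asks for
  one of degree at most \<open>d\<close>.\<close>

inductive polyfun :: "('x \<Rightarrow> 'a) set \<Rightarrow> nat \<Rightarrow> ('x \<Rightarrow> 'a) \<Rightarrow> bool" for \<Gamma> where
  polyfun_const: "c \<in> K \<Longrightarrow> polyfun \<Gamma> d (\<lambda>_. c)"
| polyfun_gen: "g \<in> \<Gamma> \<Longrightarrow> 1 \<le> d \<Longrightarrow> polyfun \<Gamma> d g"
| polyfun_add: "polyfun \<Gamma> d f \<Longrightarrow> polyfun \<Gamma> d g \<Longrightarrow> polyfun \<Gamma> d (\<lambda>x. f x + g x)"
| polyfun_uminus: "polyfun \<Gamma> d f \<Longrightarrow> polyfun \<Gamma> d (\<lambda>x. - f x)"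
| polyfun_mult: "polyfun \<Gamma> d f \<Longrightarrow> polyfun \<Gamma> d' g \<Longrightarrow> d + d' \<le> d'' \<Longrightarrow> polyfun \<Gamma> d'' (\<lambda>x. f x * g x)"

lemma polyfun_mono: "polyfun \<Gamma> d f \<Longrightarrow> d \<le> d' \<Longrightarrow> polyfun \<Gamma> d' f"
proof (induction arbitrary: d' rule: polyfun.induct)
  case (polyfun_mult d f d1 g d2)
  then show ?case using polyfun.polyfun_mult[of \<Gamma> d f d1 g d'] by simp
qed (auto intro: polyfun.intros)

lemma polyfun_diff: "polyfun \<Gamma> d f \<Longrightarrow> polyfun \<Gamma> d g \<Longrightarrow> polyfun \<Gamma> d (\<lambda>x. f x - g x)"
  using polyfun_add[of \<Gamma> d f "\<lambda>x. - g x"] polyfun_uminus[of \<Gamma> d g] by simp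

lemma polyfun_sign: "polyfun \<Gamma> d f \<Longrightarrow> polyfun \<Gamma> d (\<lambda>x. (-1) ^ m * f x)"
  by (induction m) (auto dest: polyfun_uminus)

lemma polyfun_sum: "finite I \<Longrightarrow> (\<And>i. i \<in> I \<Longrightarrow> polyfun \<Gamma> d (f i)) \<Longrightarrow> polyfun \<Gamma> d (\<lambda>x. \<Sum>i\<in>I. f i x)"
  by (induction I rule: finite_induct) (auto intro: polyfun_const polyfun_add zeroK)

lemma polyfun_comp:
  assumes "polyfun \<Delta> d f" and "\<And>g. g \<in> \<Delta> \<Longrightarrow> polyfun \<Gamma> m (\<lambda>x. g (h x))"
  shows "polyfun \<Gamma> (d * m) (\<lambda>x. f (h x))"
  using assms
proof (induction rule: polyfun.induct)
  case (polyfun_gen g d)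
  then show ?case using polyfun_mono[of \<Gamma> m "\<lambda>x. g (h x)" "d * m"] by simp
next
  case (polyfun_mult d f d' g d'')
  have "d * m + d' * m \<le> d'' * m" using polyfun_mult.hyps(3) by (metis add_mult_distrib mult_le_mono1)
  then show ?case using polyfun_mult by (auto intro: polyfun.polyfun_mult)
qed (auto intro: polyfun.intros)

end

section \<open>Growth of the space of polynomial functions on a point set\<close>

locale poly_space = finite_subfield K e for K :: "'a::comm_ring_1 set" and e +
  fixes \<Omega> :: "'x set" and \<Gamma> :: "('x \<Rightarrow> 'a) set"
  assumes finX: "finite \<Omega>" and genK: "g \<in> \<Gamma> \<Longrightarrow> x \<in> \<Omega> \<Longrightarrow> g x \<in> K"
begin

lemma polyfun_K: "polyfun \<Gamma> d f \<Longrightarrow> x \<in> \<Omega> \<Longrightarrow> f x \<in> K"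
  by (induction rule: polyfun.induct) (auto intro: addK multK uminusK genK)

text \<open>This is a finite vector space over \<open>K\<close>, and \<open>card (restr A d)\<close>
  is \<open>q\<close> raised to the Hilbert function of \<open>A\<close> at \<open>d\<close>.
  Cardinalities stand in for dimensions throughout.\<close>

definition restr :: "'x set \<Rightarrow> nat \<Rightarrow> ('x \<Rightarrow> 'a) set" where
  "restr A d = (\<lambda>f. restrict f A) ` {f. polyfun \<Gamma> d f}"

lemma restr_sub: "A \<subseteq> \<Omega> \<Longrightarrow> restr A d \<subseteq> A \<rightarrow>\<^sub>E K"
  by (auto simp: restr_def polyfun_K subset_iff)

lemma fin_sub: "A \<subseteq> \<Omega> \<Longrightarrow> finite A"
  using finX finite_subset by blast

lemma finite_restr: "A \<subseteq> \<Omega> \<Longrightarrow> finite (restr A d)"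
  using restr_sub[of A d] fin_sub[of A] by (meson finK finite_PiE finite_subset)

lemma restr_mono_degree: "d \<le> d' \<Longrightarrow> restr A d \<subseteq> restr A d'"
  by (auto simp: restr_def intro: polyfun_mono)

lemma card_restr_mono_degree: "A \<subseteq> \<Omega> \<Longrightarrow> d \<le> d' \<Longrightarrow> card (restr A d) \<le> card (restr A d')"
  by (meson card_mono finite_restr restr_mono_degree)

lemma restr_restrict: "A \<subseteq> B \<Longrightarrow> restr A d = (\<lambda>f. restrict f A) ` restr B d"
proof -
  assume "A \<subseteq> B"
  then have *: "restrict (restrict f B) A = restrict f A" for f :: "'x \<Rightarrow> 'a"
    by (simp add: restrict_restrict inf.absorb2)
  show ?thesis unfolding restr_def image_image * ..
qed

lemma card_restr_mono: "A \<subseteq> B \<Longrightarrow> B \<subseteq> \<Omega> \<Longrightarrow> card (restr A d) \<le> card (restr B d)"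
  using restr_restrict[of A B d] finite_restr[of B d] by (simp add: card_image_le)

lemma card_restr_pos: "A \<subseteq> \<Omega> \<Longrightarrow> 0 < card (restr A d)"
  using finite_restr[of A d] polyfun_const[OF eK, of \<Gamma> d] by (auto simp: card_gt_0_iff restr_def)

text \<open>Adding elements of \<open>T\<close> to a fixed set of lifts of \<open>restr B d\<close> never produces the same function twice.\<close>

lemma card_restr_kernel:
  assumes BA: "B \<subseteq> A" "A \<subseteq> \<Omega>" and T: "T \<subseteq> restr A d" and T0: "\<And>\<tau> x. \<tau> \<in> T \<Longrightarrow> x \<in> B \<Longrightarrow> \<tau> x = 0"
  shows "card (restr B d) * card T \<le> card (restr A d)"
proof -
  define l where "l \<phi> = (SOME f. polyfun \<Gamma> d f \<and> restrict f B = \<phi>)" for \<phi>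
  have l: "polyfun \<Gamma> d (l \<phi>)" "restrict (l \<phi>) B = \<phi>" if "\<phi> \<in> restr B d" for \<phi>
  proof -
    have "\<exists>f. polyfun \<Gamma> d f \<and> restrict f B = \<phi>" using that by (auto simp: restr_def)
    from someI_ex[OF this] show "polyfun \<Gamma> d (l \<phi>)" "restrict (l \<phi>) B = \<phi>" by (auto simp: l_def)
  qed
  define h where "h = (\<lambda>(\<phi>, \<tau>). restrict (\<lambda>x. l \<phi> x + \<tau> x) A)"
  have "inj_on h (restr B d \<times> T)"
  proof (rule inj_onI, clarify)
    fix \<phi> \<tau> \<phi>' \<tau>'
    assume a: "\<phi> \<in> restr B d" "\<phi>' \<in> restr B d" "\<tau> \<in> T" "\<tau>' \<in> T" "h (\<phi>, \<tau>) = h (\<phi>', \<tau>')"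
    have eq: "l \<phi> x + \<tau> x = l \<phi>' x + \<tau>' x" if "x \<in> A" for x
      using that fun_cong[OF a(5), of x] by (simp add: h_def)
    have "restrict (l \<phi>) B = restrict (l \<phi>') B"
    proof (rule restrict_ext)
      fix x assume "x \<in> B"
      then have "x \<in> A" "\<tau> x = 0" "\<tau>' x = 0" using T0 a(3,4) BA by auto
      then show "l \<phi> x = l \<phi>' x" using eq[of x] by simp
    qed
    then have \<phi>: "\<phi> = \<phi>'" using l(2)[OF a(1)] l(2)[OF a(2)] by simp
    have "\<tau> \<in> A \<rightarrow>\<^sub>E K" "\<tau>' \<in> A \<rightarrow>\<^sub>E K" using a T restr_sub BA by blast+
    then have "\<tau> = \<tau>'"
      by (rule PiE_ext) (use eq \<phi> in auto)
    then show "\<phi> = \<phi>' \<and> \<tau> = \<tau>'" using \<phi> by simp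
  qed
  moreover have "h ` (restr B d \<times> T) \<subseteq> restr A d"
  proof clarify
    fix \<phi> \<tau> assume a: "\<phi> \<in> restr B d" "\<tau> \<in> T"
    then obtain f where f: "polyfun \<Gamma> d f" "\<tau> = restrict f A" using T by (auto simp: restr_def)
    have "h (\<phi>, \<tau>) = restrict (\<lambda>x. l \<phi> x + f x) A" by (auto simp: h_def f fun_eq_iff)
    then show "h (\<phi>, \<tau>) \<in> restr A d" using polyfun_add[OF l(1)[OF a(1)] f(1)] by (auto simp: restr_def)
  qed
  ultimately have "card (restr B d \<times> T) \<le> card (restr A d)"
    using BA(2) by (intro card_inj_on_le finite_restr)
  then show ?thesis by (simp add: card_cartesian_product)
qed

text \<open>A bounded-degree version of irreducibility: the vanishing ideal of \<open>A\<close>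
  looks prime to factors of degree at most \<open>D\<close>. Without the degree bound, a set whose
  points are separated by \<open>\<Gamma>\<close> would have to be a single point.\<close>

definition irr :: "nat \<Rightarrow> 'x set \<Rightarrow> bool" where
  "irr D A \<longleftrightarrow> A \<noteq> {} \<and> (\<forall>f g. polyfun \<Gamma> D f \<longrightarrow> polyfun \<Gamma> D g \<longrightarrow> (\<forall>x\<in>A. f x * g x = 0) \<longrightarrow>
      (\<forall>x\<in>A. f x = 0) \<or> (\<forall>x\<in>A. g x = 0))"

lemma irrD:
  assumes "irr D A" "polyfun \<Gamma> D f" "polyfun \<Gamma> D g" "\<And>x. x \<in> A \<Longrightarrow> f x * g x = 0" "\<exists>x\<in>A. f x \<noteq> 0"
  shows "x \<in> A \<Longrightarrow> g x = 0"
  using assms unfolding irr_def by blast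

text \<open>The \<open>q\<close> scalar multiples of \<open>g\<close> differ on \<open>A\<close> but
  all vanish on its zero set, so passing to the zero set loses at least one dimension.\<close>

lemma card_restr_zero_set:
  assumes "A \<subseteq> \<Omega>" "polyfun \<Gamma> D g" "x \<in> A" "g x \<noteq> 0"
  shows "card (restr {y \<in> A. g y = 0} D) * q \<le> card (restr A D)"
proof -
  let ?m = "\<lambda>c. restrict (\<lambda>y. c * g y) A"
  have "inj_on ?m K"
  proof (rule inj_onI)
    fix c c' assume c: "c \<in> K" "c' \<in> K" "?m c = ?m c'"
    have "g x \<in> K" using polyfun_K[OF assms(2)] assms by blast
    moreover have "c * g x = c' * g x" using fun_cong[OF c(3), of x] assms(3) by simp
    ultimately show "c = c'" using mult_cancelK[of "g x" c c'] c assms(4) by simp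
  qed
  then have "card (?m ` K) = q" by (rule card_image)
  moreover have "card (restr {y \<in> A. g y = 0} D) * card (?m ` K) \<le> card (restr A D)"
  proof (rule card_restr_kernel)
    show "?m ` K \<subseteq> restr A D"
    proof
      fix z assume "z \<in> ?m ` K"
      then obtain c where c: "c \<in> K" "z = ?m c" by blast
      have "polyfun \<Gamma> D (\<lambda>y. c * g y)"
        using polyfun_mult[OF polyfun_const[OF c(1), of \<Gamma> 0] assms(2)] by simp
      then show "z \<in> restr A D" using c(2) by (auto simp: restr_def)
    qed
  qed (use assms in auto)
  ultimately show ?thesis by simp
qed

text \<open>If a product vanishes on \<open>A\<close> and neither factor does, \<open>A\<close> is
  the union of two zero sets of strictly smaller dimension. Splitting ends after at most
  \<open>H\<close> rounds, so the number of pieces is bounded in terms of \<open>H\<close> and not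
  of \<open>q\<close>.\<close>

lemma irr_cover:
  assumes "A \<subseteq> \<Omega>" "card (restr A D) \<le> q ^ H"
  shows "\<exists>\<C>. finite \<C> \<and> card \<C> \<le> 2 ^ H \<and> \<Union>\<C> = A \<and> (\<forall>B\<in>\<C>. irr D B)"
  using assms
proof (induction H arbitrary: A)
  case 0
  \<comment> \<open>The constants alone give a nonempty set dimension at least one.\<close>
  have "A = {}"
  proof (rule ccontr)
    assume "A \<noteq> {}"
    then obtain x where "x \<in> A" by blast
    then have "card (restr {y \<in> A. e = 0} D) * q \<le> card (restr A D)"
      using card_restr_zero_set[OF 0(1) polyfun_const[OF eK, of _ D]] e0 by simp
    moreover have "0 < card (restr {y \<in> A. e = 0} D)" using 0(1) by (intro card_restr_pos) auto
    then have "1 * 2 \<le> card (restr {y \<in> A. e = 0} D) * q" using q_ge_2 by (intro mult_le_mono) auto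
    ultimately show False using 0(2) by simp
  qed
  then show ?case by (intro exI[of _ "{}"]) auto
next
  case (Suc H)
  show ?case
  proof (cases "A = {} \<or> irr D A")
    case True
    then show ?thesis
    proof
      assume "irr D A"
      then show ?thesis by (intro exI[of _ "{A}"]) auto
    qed (intro exI[of _ "{}"], auto)
  next
    case False
    then obtain f g where fg: "polyfun \<Gamma> D f" "polyfun \<Gamma> D g" "\<forall>x\<in>A. f x * g x = 0"
      "\<exists>x\<in>A. f x \<noteq> 0" "\<exists>x\<in>A. g x \<noteq> 0" unfolding irr_def by blast
    have *: "\<exists>\<C>. finite \<C> \<and> card \<C> \<le> 2 ^ H \<and> \<Union>\<C> = {y \<in> A. g y = 0} \<and> (\<forall>B\<in>\<C>. irr D B)"
      if g: "polyfun \<Gamma> D g" "\<exists>x\<in>A. g x \<noteq> 0" for g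
    proof (rule Suc.IH)
      obtain x where "x \<in> A" "g x \<noteq> 0" using g(2) by blast
      then have "card (restr {y \<in> A. g y = 0} D) * q \<le> card (restr A D)"
        by (rule card_restr_zero_set[OF Suc.prems(1) g(1)])
      also have "\<dots> \<le> q ^ H * q" using Suc.prems(2) by (simp add: mult.commute)
      finally have "card (restr {y \<in> A. g y = 0} D) * q \<le> q ^ H * q" .
      then show "card (restr {y \<in> A. g y = 0} D) \<le> q ^ H" using q_ge_2 by simp
    qed (use Suc.prems in auto)
    obtain \<C> where C: "finite \<C>" "card \<C> \<le> 2 ^ H" "\<Union>\<C> = {y \<in> A. f y = 0}" "\<forall>B\<in>\<C>. irr D B"
      using *[OF fg(1,4)] by blast
    obtain \<C>' where C': "finite \<C>'" "card \<C>' \<le> 2 ^ H" "\<Union>\<C>' = {y \<in> A. g y = 0}" "\<forall>B\<in>\<C>'. irr D B"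
      using *[OF fg(2,5)] by blast
    have "\<Union>(\<C> \<union> \<C>') = A"
    proof -
      have "f x = 0 \<or> g x = 0" if "x \<in> A" for x
        using integralK[OF polyfun_K[OF fg(1)] polyfun_K[OF fg(2)], of x x] that fg(3) Suc.prems(1) by blast
      then show ?thesis using C(3) C'(3) by auto
    qed
    moreover have "card (\<C> \<union> \<C>') \<le> 2 ^ Suc H"
      using card_Un_le[of \<C> \<C>'] C(2) C'(2) by simp
    ultimately show ?thesis using C C' by (intro exI[of _ "\<C> \<union> \<C>'"]) auto
  qed
qed

text \<open>If \<open>g\<close> took values only in \<open>C\<close>, the product of the factors
  \<open>g - c\<close> would vanish on \<open>A\<close> although no factor does, and all degrees
  stay within \<open>D\<close>.\<close>

lemma irr_avoid:
  assumes "irr D A" "A \<subseteq> \<Omega>" "polyfun \<Gamma> d g" "\<exists>x\<in>A. \<exists>y\<in>A. g x \<noteq> g y" "finite C" "C \<subseteq> K" "card C * d \<le> D"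
  shows "\<exists>x\<in>A. g x \<notin> C"
proof -
  have "\<exists>P. polyfun \<Gamma> (card C * d) P \<and> (\<exists>x\<in>A. P x \<noteq> 0) \<and> (\<forall>x\<in>A. g x \<in> C \<longrightarrow> P x = 0)"
    using assms(5,6,7)
  proof (induction C rule: finite_induct)
    case empty
    have "\<exists>x\<in>A. e \<noteq> 0" using assms(1) e0 by (auto simp: irr_def)
    then show ?case by (intro exI[of _ "\<lambda>_. e"]) (auto intro: polyfun_const[OF eK])
  next
    case (insert c C)
    then obtain P where P: "polyfun \<Gamma> (card C * d) P" "\<exists>x\<in>A. P x \<noteq> 0" "\<forall>x\<in>A. g x \<in> C \<longrightarrow> P x = 0"
      by auto
    have g: "polyfun \<Gamma> d (\<lambda>x. g x - c)" using polyfun_diff[OF assms(3) polyfun_const] insert.prems by simp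
    have "\<exists>x\<in>A. g x - c \<noteq> 0" using assms(4) by (metis eq_iff_diff_eq_0)
    moreover have "d \<le> D" "card C * d \<le> D" using insert by auto
    ultimately have "\<exists>x\<in>A. P x * (g x - c) \<noteq> 0"
      using irrD[OF assms(1) polyfun_mono[OF P(1)] polyfun_mono[OF g] _ P(2)] by blast
    moreover have "polyfun \<Gamma> (card (insert c C) * d) (\<lambda>x. P x * (g x - c))"
      using insert.hyps by (intro polyfun_mult[OF P(1) g]) simp
    ultimately show ?case using P(3) by (intro exI[of _ "\<lambda>x. P x * (g x - c)"]) auto
  qed
  then show ?thesis by blast
qed

text \<open>By irreducibility multiplication by \<open>g\<close> is injective on
  \<open>restr A (m - \<delta>)\<close>, and its image vanishes on the zero set \<open>B\<close>. So
  the Hilbert functions satisfy H_A(m) \<ge> H_B(m) + H_A(m - \<delta>), and iteration gives H_A(d)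
  \<ge> n H_B(d - n \<delta>). With \<open>n\<close> proportional to \<open>d\<close> this lowers
  the growth exponent by one.\<close>

lemma irr_cut:
  assumes A: "irr D A" "A \<subseteq> \<Omega>" and g: "polyfun \<Gamma> \<delta> g" "\<exists>x\<in>A. g x \<noteq> 0"
    and D: "d \<le> D" "\<delta> \<le> D" and n: "n * \<delta> \<le> d"
  shows "card (restr {x \<in> A. g x = 0} (d - n * \<delta>)) ^ n \<le> card (restr A d)"
proof -
  define B where "B = {x \<in> A. g x = 0}"
  have step: "card (restr B m) * card (restr A (m - \<delta>)) \<le> card (restr A m)" if m: "m \<le> D" "\<delta> \<le> m" for m
  proof -
    define M where "M f = restrict (\<lambda>x. g x * f x) A" for f
    have inj: "inj_on M (restr A (m - \<delta>))"
    proof (rule inj_onI)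
      fix u v assume uv: "u \<in> restr A (m - \<delta>)" "v \<in> restr A (m - \<delta>)" "M u = M v"
      then obtain f h where f: "polyfun \<Gamma> (m - \<delta>) f" "u = restrict f A" and h: "polyfun \<Gamma> (m - \<delta>) h" "v = restrict h A"
        by (auto simp: restr_def)
      have "g x * (f x - h x) = 0" if "x \<in> A" for x
        using fun_cong[OF uv(3), of x] that f h by (simp add: M_def right_diff_distrib)
      moreover have "polyfun \<Gamma> D (\<lambda>x. f x - h x)"
        by (rule polyfun_mono[OF polyfun_diff[OF f(1) h(1)]]) (use m in simp)
      ultimately have "\<forall>x\<in>A. f x - h x = 0"
        using irrD[OF A(1) polyfun_mono[OF g(1) D(2)] _ _ g(2)] by blast
      then show "u = v" using f h by (auto simp: fun_eq_iff)
    qed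
    have "card (restr B m) * card (M ` restr A (m - \<delta>)) \<le> card (restr A m)"
    proof (rule card_restr_kernel)
      show "M ` restr A (m - \<delta>) \<subseteq> restr A m"
      proof clarify
        fix u assume "u \<in> restr A (m - \<delta>)"
        then obtain f where f: "polyfun \<Gamma> (m - \<delta>) f" "u = restrict f A" by (auto simp: restr_def)
        have "polyfun \<Gamma> m (\<lambda>x. g x * f x)" using polyfun_mult[OF g(1) f(1)] m by simp
        moreover have "M u = restrict (\<lambda>x. g x * f x) A" by (auto simp: M_def f fun_eq_iff)
        ultimately show "M u \<in> restr A m" by (auto simp: restr_def)
      qed
    qed (auto simp: B_def M_def intro: subsetD[OF A(2)])
    then show ?thesis by (simp add: card_image[OF inj])
  qed
  have BX: "B \<subseteq> \<Omega>" using A(2) by (auto simp: B_def)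
  \<comment> \<open>The \<open>n\<close> factors arise in different degrees and are all lowered to
    the smallest one, \<open>d - n * \<delta>\<close>.\<close>
  have "card (restr B (d - n * \<delta>)) ^ n * card (restr A (d - n * \<delta>)) \<le> card (restr A d)"
    using n
  proof (induction n)
    case (Suc n)
    let ?d = "d - n * \<delta>" and ?d' = "d - Suc n * \<delta>"
    have d': "?d' = ?d - \<delta>" by simp
    have "card (restr B ?d') ^ Suc n * card (restr A ?d') = card (restr B ?d') ^ n * (card (restr B ?d') * card (restr A ?d'))"
      by simp
    also have "\<dots> \<le> card (restr B ?d) ^ n * (card (restr B ?d) * card (restr A (?d - \<delta>)))"
      unfolding d' by (intro mult_le_mono power_mono card_restr_mono_degree BX A(2)) auto
    also have "\<dots> \<le> card (restr B ?d) ^ n * card (restr A ?d)"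
      using Suc.prems D by (intro mult_le_mono step) auto
    also have "\<dots> \<le> card (restr A d)" using Suc by simp
    finally show ?case .
  qed simp
  moreover have "1 \<le> card (restr A (d - n * \<delta>))" using card_restr_pos[OF A(2)] by (simp add: Suc_leI)
  ultimately show ?thesis unfolding B_def
    by (metis (no_types, lifting) One_nat_def le_trans mult.right_neutral mult_le_mono2)
qed

section \<open>Bounds on the growth from points and from coordinates\<close>

lemma interpolate:
  assumes sep: "\<And>x y. x \<in> \<Omega> \<Longrightarrow> y \<in> \<Omega> \<Longrightarrow> x \<noteq> y \<Longrightarrow> \<exists>g\<in>\<Gamma>. g x \<noteq> g y"
    and "finite B" "B \<subseteq> \<Omega>" "x \<in> \<Omega>" "x \<notin> B"
  shows "\<exists>f. polyfun \<Gamma> (card B) f \<and> f x = e \<and> (\<forall>y\<in>B. f y = 0)"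
  using assms(2-)
proof (induction B rule: finite_induct)
  case empty
  then show ?case using polyfun_const[OF eK] by auto
next
  case (insert y B)
  then obtain f where f: "polyfun \<Gamma> (card B) f" "f x = e" "\<forall>y\<in>B. f y = 0" by auto
  obtain g where g: "g \<in> \<Gamma>" "g x \<noteq> g y" using sep[of x y] insert by auto
  have gK: "g x \<in> K" "g y \<in> K" using genK g insert by auto
  obtain c where c: "c \<in> K" "(g x - g y) * c = e" using invK[of "g x - g y"] g gK diffK by auto
  have 1: "polyfun \<Gamma> 1 (\<lambda>z. (g z - g y) * c)"
    using gK g c polyfun_mult[OF polyfun_diff[OF polyfun_gen[OF g(1), of 1] polyfun_const[OF gK(2)]] polyfun_const[OF c(1), of \<Gamma> 0]]
    by simp
  have "polyfun \<Gamma> (card (insert y B)) (\<lambda>z. f z * ((g z - g y) * c))"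
    using insert.hyps by (intro polyfun_mult[OF f(1) 1]) simp
  then show ?case
    by (intro exI[of _ "\<lambda>z. f z * ((g z - g y) * c)"]) (use f c unitK[OF eK] in auto)
qed

text \<open>Lagrange interpolation through \<open>n\<close> points of \<open>A\<close> realises
  every function on them. Conversely, a set with few polynomial functions has few points, which is
  how the walks are finally bounded.\<close>

lemma card_restr_ge:
  assumes sep: "\<And>x y. x \<in> \<Omega> \<Longrightarrow> y \<in> \<Omega> \<Longrightarrow> x \<noteq> y \<Longrightarrow> \<exists>g\<in>\<Gamma>. g x \<noteq> g y"
    and "A \<subseteq> \<Omega>" "n \<le> card A"
  shows "q ^ n \<le> card (restr A n)"
proof -
  obtain B where B: "B \<subseteq> A" "card B = n" "finite B"
    using obtain_subset_with_card_n[OF assms(3)] by blast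
  have BX: "B \<subseteq> \<Omega>" using B assms by auto
  have "B \<rightarrow>\<^sub>E K \<subseteq> restr B n"
  proof
    fix \<phi> assume \<phi>: "\<phi> \<in> B \<rightarrow>\<^sub>E K"
    have "\<exists>f. polyfun \<Gamma> n f \<and> f x = e \<and> (\<forall>y\<in>B - {x}. f y = 0)" if x: "x \<in> B" for x
    proof -
      have "card (B - {x}) \<le> n" using B by (metis card_Diff1_le)
      moreover obtain f where "polyfun \<Gamma> (card (B - {x})) f" "f x = e" "\<forall>y\<in>B - {x}. f y = 0"
        using interpolate[OF sep, of "B - {x}" x] BX x B(3) by auto
      ultimately show ?thesis using polyfun_mono by blast
    qed
    then obtain f where f: "\<And>x. x \<in> B \<Longrightarrow> polyfun \<Gamma> n (f x) \<and> f x x = e \<and> (\<forall>y\<in>B - {x}. f x y = 0)"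
      by metis
    have "polyfun \<Gamma> n (\<lambda>z. \<phi> x * f x z)" if "x \<in> B" for x
      by (rule polyfun_mult[OF polyfun_const[of _ _ 0]]) (use f that \<phi> in auto)
    then have "polyfun \<Gamma> n (\<lambda>z. \<Sum>x\<in>B. \<phi> x * f x z)" by (intro polyfun_sum B) auto
    moreover have "restrict (\<lambda>z. \<Sum>x\<in>B. \<phi> x * f x z) B = \<phi>"
    proof
      fix z
      show "restrict (\<lambda>z. \<Sum>x\<in>B. \<phi> x * f x z) B z = \<phi> z"
      proof (cases "z \<in> B")
        case True
        have "(\<Sum>x\<in>B. \<phi> x * f x z) = (\<Sum>x\<in>B. if x = z then \<phi> z * e else 0)"
          using f True by (intro sum.cong) auto
        also have "\<dots> = \<phi> z" using True B(3) unitK[of "\<phi> z"] PiE_mem[OF \<phi> True] by (simp add: mult.commute)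
        finally show ?thesis using True by simp
      qed (use \<phi> in auto)
    qed
    ultimately show "\<phi> \<in> restr B n" unfolding restr_def by (metis (mono_tags) image_eqI mem_Collect_eq)
  qed
  then have "card (B \<rightarrow>\<^sub>E K) \<le> card (restr B n)" using finite_restr[OF BX] by (rule card_mono[rotated])
  also have "\<dots> \<le> card (restr A n)" using B(1) assms(2) by (rule card_restr_mono)
  finally show ?thesis using B by (simp add: card_PiE)
qed

text \<open>On \<open>A\<close> every polynomial becomes a combination of monomials in the members
  of \<open>\<Delta>\<close>. So the growth exponent is governed by the number of coordinates that
  really vary on \<open>A\<close>.\<close>

lemma card_restr_le:
  assumes A: "A \<subseteq> \<Omega>" and \<Delta>: "finite \<Delta>" "\<Delta> \<subseteq> \<Gamma>"
    and gen: "\<And>g. g \<in> \<Gamma> \<Longrightarrow> (\<exists>c\<in>K. \<forall>x\<in>A. g x = c) \<or> (\<exists>h\<in>\<Delta>. \<forall>x\<in>A. g x = h x)"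
  shows "card (restr A D) \<le> q ^ ((D + 1) ^ card \<Delta>)"
proof -
  define M where "M d = \<Delta> \<rightarrow>\<^sub>E {..d::nat}" for d
  define mo where "mo m x = (\<Prod>h\<in>\<Delta>. h x ^ m h)" for m :: "('x \<Rightarrow> 'a) \<Rightarrow> nat" and x
  \<comment> \<open>Exponents are bounded in each variable separately rather than in total: such
    boxes are easy to count, and products respect them.\<close>
  define W where "W d f \<longleftrightarrow> (\<exists>c\<in>M d \<rightarrow>\<^sub>E K. \<forall>x\<in>A. f x = (\<Sum>m\<in>M d. c m * mo m x))" for d f
  have finM: "finite (M d)" for d using \<Delta> by (auto simp: M_def intro: finite_PiE)
  have W_term: "W d f" if m: "m \<in> M d" and c: "c \<in> K" and f: "\<And>x. x \<in> A \<Longrightarrow> f x = c * mo m x" for d m c f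
  proof -
    have "(\<Sum>m'\<in>M d. restrict (\<lambda>m'. if m' = m then c else 0) (M d) m' * mo m' x) = c * mo m x" for x
    proof -
      have "(\<Sum>m'\<in>M d. restrict (\<lambda>m'. if m' = m then c else 0) (M d) m' * mo m' x)
          = (\<Sum>m'\<in>M d. if m' = m then c * mo m x else 0)"
        by (intro sum.cong) auto
      also have "\<dots> = c * mo m x" using m finM by simp
      finally show ?thesis .
    qed
    then show ?thesis unfolding W_def
      by (intro bexI[of _ "restrict (\<lambda>m'. if m' = m then c else 0) (M d)"]) (use f c zeroK in auto)
  qed
  have W_add: "W d (\<lambda>x. f x + g x)" if "W d f" "W d g" for d f g
  proof -
    from that obtain c c' where c: "c \<in> M d \<rightarrow>\<^sub>E K" "\<forall>x\<in>A. f x = (\<Sum>m\<in>M d. c m * mo m x)"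
      and c': "c' \<in> M d \<rightarrow>\<^sub>E K" "\<forall>x\<in>A. g x = (\<Sum>m\<in>M d. c' m * mo m x)" unfolding W_def by blast
    then show ?thesis unfolding W_def
      by (intro bexI[of _ "restrict (\<lambda>m. c m + c' m) (M d)"])
        (auto simp: sum.distrib[symmetric] distrib_right PiE_iff intro!: sum.cong addK)
  qed
  have W_sum: "W d (\<lambda>x. \<Sum>i\<in>I. f i x)" if "finite I" "\<And>i. i \<in> I \<Longrightarrow> W d (f i)" for I :: "(('x \<Rightarrow> 'a) \<Rightarrow> nat) set" and d f
    using that
  proof (induction I rule: finite_induct)
    case empty
    show ?case using W_term[of "restrict (\<lambda>_. 0) \<Delta>" d 0] zeroK by (auto simp: M_def)
  qed (auto intro: W_add)
  have W: "W d f" if "polyfun \<Gamma> d f" for d f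
    using that
  proof (induction rule: polyfun.induct)
    case (polyfun_const c d)
    show ?case
      by (rule W_term[of "restrict (\<lambda>_. 0) \<Delta>" d c]) (auto simp: M_def mo_def polyfun_const)
  next
    case (polyfun_gen g d)
    from gen[OF polyfun_gen(1)] show ?case
    proof
      assume "\<exists>c\<in>K. \<forall>x\<in>A. g x = c"
      then obtain c where "c \<in> K" "\<forall>x\<in>A. g x = c" by blast
      then show ?thesis
        by (intro W_term[of "restrict (\<lambda>_. 0) \<Delta>" d c]) (auto simp: M_def mo_def)
    next
      assume "\<exists>h\<in>\<Delta>. \<forall>x\<in>A. g x = h x"
      then obtain h where h: "h \<in> \<Delta>" "\<forall>x\<in>A. g x = h x" by blast
      let ?m = "restrict (\<lambda>h'. if h' = h then 1 else 0) \<Delta>"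
      have "mo ?m x = h x" for x
      proof -
        have "mo ?m x = (\<Prod>h'\<in>\<Delta>. if h' = h then h x else 1)"
          unfolding mo_def by (intro prod.cong) auto
        then show ?thesis using h \<Delta> by simp
      qed
      moreover have "?m \<in> M d" using polyfun_gen by (auto simp: M_def)
      moreover have "e * h x = h x" if "x \<in> A" for x using that h A \<Delta> genK unitK by blast
      ultimately show ?thesis using h(2) by (intro W_term[of ?m d e]) (auto simp: eK)
    qed
  next
    case (polyfun_add d f g) then show ?case by (simp add: W_add)
  next
    case (polyfun_uminus d f)
    then obtain c where c: "c \<in> M d \<rightarrow>\<^sub>E K" "\<forall>x\<in>A. f x = (\<Sum>m\<in>M d. c m * mo m x)" unfolding W_def by blast
    then show ?case unfolding W_def
      by (intro bexI[of _ "restrict (\<lambda>m. - c m) (M d)"])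
        (auto simp: sum_negf[symmetric] PiE_iff intro!: sum.cong uminusK)
  next
    case (polyfun_mult d f d' g d'')
    then obtain c c' where c: "c \<in> M d \<rightarrow>\<^sub>E K" "\<forall>x\<in>A. f x = (\<Sum>m\<in>M d. c m * mo m x)"
      and c': "c' \<in> M d' \<rightarrow>\<^sub>E K" "\<forall>x\<in>A. g x = (\<Sum>m\<in>M d'. c' m * mo m x)" unfolding W_def by blast
    have "W d'' (\<lambda>x. \<Sum>m\<in>M d. \<Sum>m'\<in>M d'. (c m * c' m') * mo (restrict (\<lambda>h. m h + m' h) \<Delta>) x)"
    proof (intro W_sum finM)
      fix m m' assume m: "m \<in> M d" "m' \<in> M d'"
      have "m h + m' h \<le> d''" if "h \<in> \<Delta>" for h
      proof -
        have "m h \<le> d" "m' h \<le> d'" using m that by (auto simp: M_def PiE_iff)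
        then show ?thesis using polyfun_mult.hyps(3) by simp
      qed
      then show "W d'' (\<lambda>x. (c m * c' m') * mo (restrict (\<lambda>h. m h + m' h) \<Delta>) x)"
        using m c(1) c'(1) by (intro W_term[OF _ _ refl]) (auto simp: M_def intro!: multK)
    qed
    moreover have "(\<Sum>m\<in>M d. \<Sum>m'\<in>M d'. (c m * c' m') * mo (restrict (\<lambda>h. m h + m' h) \<Delta>) x)
        = f x * g x" if "x \<in> A" for x
    proof -
      have "mo (restrict (\<lambda>h. m h + m' h) \<Delta>) x = mo m x * mo m' x" for m m'
        unfolding mo_def prod.distrib[symmetric] by (intro prod.cong) (auto simp: power_add)
      then show ?thesis using c(2) c'(2) that by (simp add: sum_product) (intro sum.cong refl, simp add: mult_ac)
    qed
    ultimately show ?case unfolding W_def by auto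
  qed
  have "restr A D \<subseteq> (\<lambda>c. restrict (\<lambda>x. \<Sum>m\<in>M D. c m * mo m x) A) ` (M D \<rightarrow>\<^sub>E K)"
  proof (intro subsetI)
    fix \<phi> assume "\<phi> \<in> restr A D"
    then obtain f where f: "polyfun \<Gamma> D f" "\<phi> = restrict f A" by (auto simp: restr_def)
    from W[OF f(1)] obtain c where c: "c \<in> M D \<rightarrow>\<^sub>E K" "\<forall>x\<in>A. f x = (\<Sum>m\<in>M D. c m * mo m x)"
      unfolding W_def by blast
    have "\<phi> = restrict (\<lambda>x. \<Sum>m\<in>M D. c m * mo m x) A"
      unfolding f(2) by (rule restrict_ext) (use c in blast)
    then show "\<phi> \<in> (\<lambda>c. restrict (\<lambda>x. \<Sum>m\<in>M D. c m * mo m x) A) ` (M D \<rightarrow>\<^sub>E K)" using c(1) by blast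
  qed
  then have "card (restr A D) \<le> card (M D \<rightarrow>\<^sub>E K)"
    using finK finM by (meson card_image_le card_mono finite_PiE finite_imageI le_trans)
  also have "\<dots> = q ^ ((D + 1) ^ card \<Delta>)"
    using finM \<Delta> by (simp add: card_PiE M_def)
  finally show ?thesis .
qed

end

section \<open>A tower of abelian covers\<close>

context poly_space begin

text \<open>Each evaluation at a point whose node \<open>ed m0 y\<close> is new cuts the admissible functions by a factor \<open>q\<close>.\<close>

lemma card_functional_level_set:
  fixes ed :: "nat \<Rightarrow> 'y \<Rightarrow> 'x"
  assumes sep: "\<And>x y. x \<in> \<Omega> \<Longrightarrow> y \<in> \<Omega> \<Longrightarrow> x \<noteq> y \<Longrightarrow> \<exists>g\<in>\<Gamma>. g x \<noteq> g y"
    and I: "finite I" "m0 \<in> I"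
    and ed: "\<And>m y. m \<in> I \<Longrightarrow> y \<in> A \<Longrightarrow> ed m y \<in> \<Omega>"
    and coef: "\<And>y. y \<in> A \<Longrightarrow> (\<Sum>m\<in>{m \<in> I. ed m y = ed m0 y}. (-1) ^ m * e) \<noteq> 0"
    and avoid: "\<And>F. F \<subseteq> \<Omega> \<Longrightarrow> card F \<le> card I * n \<Longrightarrow> \<exists>y\<in>A. ed m0 y \<notin> F"
    and d: "card I * (n + 1) \<le> d"
  shows "card {\<phi> \<in> restr \<Omega> d. \<forall>y\<in>A. (\<Sum>m\<in>I. (-1) ^ m * \<phi> (ed m y)) = w} * q ^ n \<le> card (restr \<Omega> d)"
proof -
  define \<Psi> where "\<Psi> \<phi> y = (\<Sum>m\<in>I. (-1) ^ m * \<phi> (ed m y))" for \<phi> :: "'x \<Rightarrow> 'a" and y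
  define Bd where "Bd Y = {\<phi> \<in> restr \<Omega> d. \<forall>y\<in>Y. \<Psi> \<phi> y = w}" for Y
  have fin_restr: "finite (restr \<Omega> d)" by (rule finite_restr) simp
  have fin: "finite (Bd Y)" for Y using fin_restr by (simp add: Bd_def)
  have "\<exists>Y\<subseteq>A. finite Y \<and> card Y \<le> n' \<and> card (Bd Y) * q ^ n' \<le> card (restr \<Omega> d)" if "n' \<le> n" for n'
    using that
  proof (induction n')
    case 0
    show ?case by (intro exI[of _ "{}"]) (auto simp: Bd_def)
  next
    case (Suc n')
    then obtain Y where Y: "Y \<subseteq> A" "finite Y" "card Y \<le> n'" "card (Bd Y) * q ^ n' \<le> card (restr \<Omega> d)" by auto
    define F where "F = (\<lambda>(m, y). ed m y) ` (I \<times> Y)"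
    have FX: "F \<subseteq> \<Omega>" using ed Y by (auto simp: F_def)
    have cF: "card F \<le> card I * n'"
    proof -
      have "card F \<le> card I * card Y"
        using card_image_le[of "I \<times> Y" "\<lambda>(m, y). ed m y"] I Y(2) by (simp add: F_def card_cartesian_product)
      also have "\<dots> \<le> card I * n'" using Y(3) by (rule mult_le_mono2)
      finally show ?thesis .
    qed
    moreover have "card I * n' \<le> card I * n" using Suc.prems by simp
    ultimately obtain y where y: "y \<in> A" "ed m0 y \<notin> F" using avoid[OF FX] le_trans by blast
    \<comment> \<open>\<open>F'\<close> contains all old nodes and the other nodes of
      \<open>y\<close>. A function equal to \<open>e\<close> at \<open>ed m0 y\<close> and zero on
      \<open>F'\<close> does not affect the functional at old points, and at \<open>y\<close> it
      gives exactly the net coefficient of the new node, nonzero by \<open>coef\<close>.\<close>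
    define F' where "F' = F \<union> (\<lambda>m. ed m y) ` I - {ed m0 y}"
    have "card F' \<le> card (F \<union> (\<lambda>m. ed m y) ` I)" unfolding F'_def
      using I Y(2) by (intro card_mono) (auto simp: F_def)
    also have "\<dots> \<le> card F + card ((\<lambda>m. ed m y) ` I)" by (rule card_Un_le)
    also have "\<dots> \<le> card I * n' + card I" using cF card_image_le[OF I(1)] by (intro add_mono)
    also have "\<dots> \<le> card I * (n + 1)" using Suc.prems by simp
    finally have cF': "card F' \<le> d" using d by simp
    have "F' \<subseteq> \<Omega>" "ed m0 y \<in> \<Omega>" "finite F'" "ed m0 y \<notin> F'"
      using FX ed y(1) I Y(2) by (auto simp: F'_def F_def)
    then obtain f where f: "polyfun \<Gamma> (card F') f" "f (ed m0 y) = e" "\<forall>z\<in>F'. f z = 0"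
      using interpolate[OF sep] by metis
    have polyfun_f: "polyfun \<Gamma> d f" using polyfun_mono[OF f(1) cF'] .
    define \<phi>0 where "\<phi>0 = restrict f \<Omega>"
    have \<phi>0: "\<phi>0 (ed m0 y) = e" "\<And>z. z \<in> F' \<Longrightarrow> \<phi>0 z = 0"
      using f \<open>F' \<subseteq> \<Omega>\<close> \<open>ed m0 y \<in> \<Omega>\<close> by (auto simp: \<phi>0_def)
    have \<Psi>Y: "\<Psi> \<phi>0 y' = 0" if "y' \<in> Y" for y'
    proof -
      have "ed m y' \<in> F'" if "m \<in> I" for m
      proof -
        have "ed m y' \<in> F" using that \<open>y' \<in> Y\<close> unfolding F_def by force
        then show ?thesis using y(2) by (auto simp: F'_def)
      qed
      then show ?thesis by (simp add: \<Psi>_def \<phi>0)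
    qed
    define \<kappa> where "\<kappa> = \<Psi> \<phi>0 y"
    have "\<kappa> = (\<Sum>m\<in>I. if ed m y = ed m0 y then (-1) ^ m * e else 0)"
      unfolding \<kappa>_def \<Psi>_def
    proof (intro sum.cong refl)
      fix m assume "m \<in> I"
      then show "(-1) ^ m * \<phi>0 (ed m y) = (if ed m y = ed m0 y then (-1) ^ m * e else 0)"
        using \<phi>0 by (auto simp: F'_def)
    qed
    also have "\<dots> = (\<Sum>m\<in>{m \<in> I. ed m y = ed m0 y}. (-1) ^ m * e)"
      using I(1) by (simp add: sum.inter_filter)
    finally have \<kappa>0: "\<kappa> \<noteq> 0" using coef[OF y(1)] by simp
    have \<phi>0K: "\<phi>0 z \<in> K" if "z \<in> \<Omega>" for z using that polyfun_K[OF polyfun_f] by (simp add: \<phi>0_def)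
    have \<kappa>K: "\<kappa> \<in> K" unfolding \<kappa>_def \<Psi>_def using ed y(1) by (intro sumK signK \<phi>0K) auto
    \<comment> \<open>Adding multiples of \<open>\<phi>0\<close> moves the functional at
      \<open>y\<close> through \<open>q\<close> different values and leaves the points of
      \<open>Y\<close> alone. This is the source of the factor \<open>q\<close>.\<close>
    define h where "h = (\<lambda>(c, \<phi>). restrict (\<lambda>z. \<phi> z + c * \<phi>0 z) \<Omega>)"
    have \<Psi>h: "\<Psi> (h (c, \<phi>)) y' = \<Psi> \<phi> y' + c * \<Psi> \<phi>0 y'" if "y' \<in> A" for c \<phi> y'
    proof -
      have "\<Psi> (h (c, \<phi>)) y' = (\<Sum>m\<in>I. (-1) ^ m * \<phi> (ed m y') + c * ((-1) ^ m * \<phi>0 (ed m y')))"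
        unfolding \<Psi>_def h_def using ed that by (intro sum.cong) (auto simp: algebra_simps)
      then show ?thesis by (simp add: \<Psi>_def sum.distrib sum_distrib_left)
    qed
    have "inj_on h (K \<times> Bd (insert y Y))"
    proof (rule inj_onI, clarify)
      fix c \<phi> c' \<phi>'
      assume a: "c \<in> K" "c' \<in> K" "\<phi> \<in> Bd (insert y Y)" "\<phi>' \<in> Bd (insert y Y)" "h (c, \<phi>) = h (c', \<phi>')"
      have "\<Psi> \<phi> y + c * \<kappa> = \<Psi> \<phi>' y + c' * \<kappa>"
        using \<Psi>h[OF y(1), of c \<phi>] \<Psi>h[OF y(1), of c' \<phi>'] a(5) by (simp add: \<kappa>_def)
      then have "c * \<kappa> = c' * \<kappa>" using a(3,4) by (simp add: Bd_def)
      then have c: "c = c'" using mult_cancelK[OF \<kappa>K a(1,2) \<kappa>0] by simp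
      have "\<phi> \<in> \<Omega> \<rightarrow>\<^sub>E K" "\<phi>' \<in> \<Omega> \<rightarrow>\<^sub>E K" using a(3,4) restr_sub[of \<Omega>] by (auto simp: Bd_def)
      then have "\<phi> = \<phi>'"
      proof (rule PiE_ext)
        fix z assume "z \<in> \<Omega>"
        then show "\<phi> z = \<phi>' z" using fun_cong[OF a(5), of z] c by (simp add: h_def)
      qed
      then show "c = c' \<and> \<phi> = \<phi>'" using c by simp
    qed
    moreover have "h ` (K \<times> Bd (insert y Y)) \<subseteq> Bd Y"
    proof clarify
      fix c \<phi> assume a: "c \<in> K" "\<phi> \<in> Bd (insert y Y)"
      then obtain g where g: "polyfun \<Gamma> d g" "\<phi> = restrict g \<Omega>" by (auto simp: Bd_def restr_def)
      have "h (c, \<phi>) = restrict (\<lambda>z. g z + c * f z) \<Omega>" by (auto simp: h_def g \<phi>0_def fun_eq_iff)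
      moreover have "polyfun \<Gamma> d (\<lambda>z. g z + c * f z)"
        using polyfun_mult[OF polyfun_const[OF a(1), of _ 0] polyfun_f] by (intro polyfun_add g) simp
      ultimately have "h (c, \<phi>) \<in> restr \<Omega> d" by (auto simp: restr_def)
      moreover have "\<Psi> (h (c, \<phi>)) y' = w" if "y' \<in> Y" for y'
        using \<Psi>h[of y'] \<Psi>Y[OF that] that Y(1) a(2) by (auto simp: Bd_def)
      ultimately show "h (c, \<phi>) \<in> Bd Y" by (simp add: Bd_def)
    qed
    ultimately have "card (K \<times> Bd (insert y Y)) \<le> card (Bd Y)" using fin by (intro card_inj_on_le)
    then have "card (Bd (insert y Y)) * q \<le> card (Bd Y)" by (simp add: card_cartesian_product mult.commute)
    then have "card (Bd (insert y Y)) * q * q ^ n' \<le> card (restr \<Omega> d)"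
      using Y(4) mult_le_mono1 le_trans by blast
    moreover have "card (insert y Y) \<le> Suc n'" using Y(2,3) card_insert_le_m1[of "Suc n'" Y y] by simp
    ultimately show ?case using Y(1,2) y(1)
      by (intro exI[of _ "insert y Y"]) (auto simp: mult.assoc)
  qed
  then obtain Y where Y: "Y \<subseteq> A" "card (Bd Y) * q ^ n \<le> card (restr \<Omega> d)" by blast
  have "Bd A \<subseteq> Bd Y" using Y(1) by (auto simp: Bd_def)
  then have "card (Bd A) * q ^ n \<le> card (Bd Y) * q ^ n" using card_mono[OF fin] by simp
  then have "card (Bd A) * q ^ n \<le> card (restr \<Omega> d)" using Y(2) by (rule le_trans)
  then show ?thesis by (simp add: Bd_def \<Psi>_def)
qed

end

section \<open>Walks and their coordinates, level by level\<close>

type_synonym 'a coords = "nat \<Rightarrow> 'a"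
type_synonym 'a edge = "'a coords \<times> 'a coords \<times> 'a coords \<times> 'a coords"
type_synonym 'a walk = "(nat \<Rightarrow> 'a coords) \<times> 'a coords"

text \<open>
  A walk is given by the labels of all its vertices and the further coordinates of its first vertex. Vertices with
  even index lie in \<open>M\<close>, and the \<open>M\<close>-end of an edge is listed first. At level \<open>j\<close>, \<open>lev f x j i\<close> holds the first \<open>j\<close>
  coordinates of the \<open>i\<close>-th vertex, padded by zeros.
\<close>

definition edge :: "(nat \<Rightarrow> 'a coords) \<Rightarrow> (nat \<Rightarrow> 'a coords) \<Rightarrow> nat \<Rightarrow> 'a edge" where
  "edge P W m = (if even m then (P m, P (Suc m), W m, W (Suc m)) else (P (Suc m), P m, W (Suc m), W m))"

primrec crd :: "('e \<Rightarrow> 'a::ring_1) \<Rightarrow> (nat \<Rightarrow> 'e) \<Rightarrow> 'a \<Rightarrow> nat \<Rightarrow> 'a" where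
  "crd g ed c 0 = c"
| "crd g ed c (Suc m) = g (ed m) - crd g ed c m"

primrec lev :: "(nat \<Rightarrow> 'a::ring_1 edge \<Rightarrow> 'a) \<Rightarrow> 'a walk \<Rightarrow> nat \<Rightarrow> nat \<Rightarrow> 'a coords" where
  "lev f x 0 = (\<lambda>i c. 0)"
| "lev f x (Suc j) = (\<lambda>i. (lev f x j i)(j := crd (f j) (edge (fst x) (lev f x j)) (snd x j) i))"

definition edge_at :: "(nat \<Rightarrow> 'a::ring_1 edge \<Rightarrow> 'a) \<Rightarrow> nat \<Rightarrow> 'a walk \<Rightarrow> nat \<Rightarrow> 'a edge" where
  "edge_at f j x m = edge (fst x) (lev f x j) m"

text \<open>The signs come from eliminating the intermediate coordinates from the relations u + v =
  f along the walk. Traversals of one edge in opposite directions sit at positions of opposite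
  parity and cancel.\<close>

definition Psi :: "(nat \<Rightarrow> 'a::ring_1 edge \<Rightarrow> 'a) \<Rightarrow> nat \<Rightarrow> nat \<Rightarrow> nat \<Rightarrow> 'a walk \<Rightarrow> 'a" where
  "Psi f j a b x = (\<Sum>m\<in>{a..<b}. (-1) ^ m * f j (edge_at f j x m))"

lemma lev_ge: "j \<le> c \<Longrightarrow> lev f x j i c = 0"
  by (induction j) auto

lemma lev_trunc: "lev f x j i = (lev f x (Suc j) i)(j := 0)"
  by (auto simp: lev_ge fun_eq_iff)

lemma lev_cong: "(\<And>i. i < j \<Longrightarrow> f i = f' i) \<Longrightarrow> lev f x j = lev f' x j"
  by (induction j) auto

lemma edge_at_cong: "(\<And>i. i < j \<Longrightarrow> f i = f' i) \<Longrightarrow> edge_at f j = edge_at f' j"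
  by (intro ext) (simp add: edge_at_def lev_cong[of j f f'])

lemma crd_sum:
  assumes "a \<le> b"
  shows "(\<Sum>m\<in>{a..<b}. (-1) ^ m * g (ed m)) = (-1) ^ a * crd g ed c a - (-1) ^ b * crd g ed c b"
  using assms by (induction b rule: dec_induct) (auto simp: algebra_simps)

text \<open>The alternating sum telescopes, so it sees only the two ends of the segment at level
  \<open>Suc j\<close>. Conditions on the ends thereby become polynomial equations in the
  walk.\<close>

lemma Psi_crd:
  assumes "a \<le> b"
  shows "Psi f j a b x = (-1) ^ a * lev f x (Suc j) a j - (-1) ^ b * lev f x (Suc j) b j"
  unfolding Psi_def edge_at_def using crd_sum[OF assms] by simp

lemma card_UN_mult_le:
  assumes "finite I" "\<And>i. i \<in> I \<Longrightarrow> finite (B i)" "\<And>i. i \<in> I \<Longrightarrow> card (B i) * m \<le> n"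
  shows "card (\<Union>i\<in>I. B i) * m \<le> card I * n"
proof -
  have "card (\<Union>i\<in>I. B i) * m \<le> (\<Sum>i\<in>I. card (B i)) * m"
    using assms(1) by (intro mult_le_mono1 card_UN_le)
  also have "\<dots> = (\<Sum>i\<in>I. card (B i) * m)" by (simp add: sum_distrib_right)
  also have "\<dots> \<le> (\<Sum>i\<in>I. n)" using assms(3) by (rule sum_mono)
  finally show ?thesis by simp
qed

section \<open>The spaces of walks and of edges\<close>

locale tower = finite_subfield K e for K :: "'a::comm_ring_1 set" and e +
  fixes k r r' t :: nat
  assumes k2: "2 \<le> k" and t_def: "t = (k - 1) * (r + r')"
begin

definition L :: nat where "L = 2 * k - 1"
definition rho :: "nat \<Rightarrow> nat" where "rho i = (if even i then r else r')"
text \<open>Padding by zeros lets vectors of all dimensions share one type, with equality of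
  functions as equality of vectors.\<close>

definition lab :: "nat \<Rightarrow> 'a coords set" where
  "lab n = {l. (\<forall>i<n. l i \<in> K) \<and> (\<forall>i\<ge>n. l i = 0)}"
definition \<Omega> :: "'a walk set" where
  "\<Omega> = {x. (\<forall>i\<le>L. fst x i \<in> lab (rho i)) \<and> (\<forall>i>L. fst x i = (\<lambda>_. 0)) \<and> snd x \<in> lab t}"
definition E :: "'a edge set" where "E = lab r \<times> lab r' \<times> lab t \<times> lab t"
definition GX :: "('a walk \<Rightarrow> 'a) set" where
  "GX = (\<lambda>(i, c) x. fst x i c) ` Sigma {..L} (\<lambda>i. {..<rho i}) \<union> (\<lambda>c x. snd x c) ` {..<t}"
definition GE :: "('a edge \<Rightarrow> 'a) set" where
  "GE = (\<lambda>c z. fst z c) ` {..<r} \<union> (\<lambda>c z. fst (snd z) c) ` {..<r'} \<union>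
    (\<lambda>c z. fst (snd (snd z)) c) ` {..<t} \<union> (\<lambda>c z. snd (snd (snd z)) c) ` {..<t}"

lemma bij_lab: "bij_betw (\<lambda>l. restrict l {..<n}) (lab n) ({..<n} \<rightarrow>\<^sub>E K)"
proof (rule bij_betw_byWitness[where f' = "\<lambda>l i. if i < n then l i else 0"])
  show "\<forall>l\<in>lab n. (\<lambda>i. if i < n then restrict l {..<n} i else 0) = l"
    by (auto simp: lab_def fun_eq_iff)
  show "\<forall>l\<in>{..<n} \<rightarrow>\<^sub>E K. restrict (\<lambda>i. if i < n then l i else 0) {..<n} = l"
  proof (intro ballI ext)
    fix l i assume "l \<in> {..<n} \<rightarrow>\<^sub>E K"
    then show "restrict (\<lambda>i. if i < n then l i else 0) {..<n} i = l i"
      using PiE_arb[of l "{..<n}" "\<lambda>_. K" i] by (simp add: restrict_def)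
  qed
  show "(\<lambda>l. restrict l {..<n}) ` lab n \<subseteq> {..<n} \<rightarrow>\<^sub>E K"
    by (intro image_subsetI) (simp add: lab_def PiE_iff)
  show "(\<lambda>l i. if i < n then l i else 0) ` ({..<n} \<rightarrow>\<^sub>E K) \<subseteq> lab n"
    by (intro image_subsetI) (simp add: lab_def PiE_iff)
qed

lemma finite_lab: "finite (lab n)"
  using bij_betw_finite[OF bij_lab[of n]] by (simp add: finite_PiE finK)

lemma card_lab: "card (lab n) = q ^ n"
  using bij_betw_same_card[OF bij_lab[of n]] by (simp add: card_PiE)

definition bX :: nat where "bX = (\<Sum>i\<le>L. rho i) + t"

lemma X_embed:
  "inj_on (\<lambda>x. (restrict (fst x) {..L}, snd x)) \<Omega>"
  "(\<lambda>x. (restrict (fst x) {..L}, snd x)) ` \<Omega> \<subseteq> PiE {..L} (\<lambda>i. lab (rho i)) \<times> lab t"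
proof -
  show "inj_on (\<lambda>x. (restrict (fst x) {..L}, snd x)) \<Omega>"
  proof (rule inj_onI)
    fix x y assume a: "x \<in> \<Omega>" "y \<in> \<Omega>" "(restrict (fst x) {..L}, snd x) = (restrict (fst y) {..L}, snd y)"
    have "fst x i = fst y i" for i
    proof (cases "i \<le> L")
      case True
      moreover have "restrict (fst x) {..L} i = restrict (fst y) {..L} i" using a(3) by (metis prod.inject)
      ultimately show ?thesis by simp
    qed (use a in \<open>auto simp: \<Omega>_def\<close>)
    then show "x = y" using a(3) by (simp add: prod_eq_iff fun_eq_iff)
  qed
qed (auto simp: \<Omega>_def)

lemma finite_X: "finite \<Omega>"
  using X_embed finite_lab by (meson finite_PiE finite_SigmaI finite_atMost finite_imageD finite_subset)

lemma card_X: "card \<Omega> \<le> q ^ bX"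
proof -
  have "card \<Omega> \<le> card (PiE {..L} (\<lambda>i. lab (rho i)) \<times> lab t)"
    using X_embed finite_lab by (intro card_inj_on_le) (auto intro!: finite_PiE)
  also have "\<dots> = q ^ bX"
    by (simp add: card_cartesian_product card_PiE card_lab bX_def power_add power_sum)
  finally show ?thesis .
qed

lemma finite_E: "finite E" by (simp add: E_def finite_lab)

lemma finite_GX: "finite GX" by (simp add: GX_def)

lemma card_GX: "card GX \<le> bX"
proof -
  have "card GX \<le> card (Sigma {..L} (\<lambda>i. {..<rho i})) + card {..<t}"
    unfolding GX_def by (rule le_trans[OF card_Un_le add_mono]) (rule card_image_le, simp)+
  then show ?thesis by (simp add: bX_def)
qed

sublocale PX: poly_space K e \<Omega> GX
  by (unfold_locales, rule finite_X) (auto simp: GX_def \<Omega>_def lab_def)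

sublocale PE: poly_space K e E GE
  by (unfold_locales, rule finite_E) (auto simp: GE_def E_def lab_def)

lemma lab_sep: "l \<in> lab n \<Longrightarrow> l' \<in> lab n \<Longrightarrow> l \<noteq> l' \<Longrightarrow> \<exists>c<n. l c \<noteq> l' c"
  by (auto simp: lab_def fun_eq_iff) (metis linorder_not_le)

lemma E_sep: "z \<in> E \<Longrightarrow> z' \<in> E \<Longrightarrow> z \<noteq> z' \<Longrightarrow> \<exists>g\<in>GE. g z \<noteq> g z'"
proof -
  assume a: "z \<in> E" "z' \<in> E" "z \<noteq> z'"
  have inE: "fst z \<in> lab r" "fst (snd z) \<in> lab r'" "fst (snd (snd z)) \<in> lab t" "snd (snd (snd z)) \<in> lab t"
    if "z \<in> E" for z using that by (auto simp: E_def)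
  consider "fst z \<noteq> fst z'" | "fst (snd z) \<noteq> fst (snd z')"
    | "fst (snd (snd z)) \<noteq> fst (snd (snd z'))" | "snd (snd (snd z)) \<noteq> snd (snd (snd z'))"
    using a(3) by (metis prod.collapse)
  then show ?thesis
  proof cases
    case 1
    then obtain c where "c < r" "fst z c \<noteq> fst z' c" using lab_sep inE a by metis
    then show ?thesis by (intro bexI[of _ "\<lambda>z. fst z c"]) (auto simp: GE_def)
  next
    case 2
    then obtain c where "c < r'" "fst (snd z) c \<noteq> fst (snd z') c" using lab_sep inE a by metis
    then show ?thesis by (intro bexI[of _ "\<lambda>z. fst (snd z) c"]) (auto simp: GE_def)
  next
    case 3
    then obtain c where "c < t" "fst (snd (snd z)) c \<noteq> fst (snd (snd z')) c" using lab_sep inE a by metis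
    then show ?thesis by (intro bexI[of _ "\<lambda>z. fst (snd (snd z)) c"]) (auto simp: GE_def)
  next
    case 4
    then obtain c where "c < t" "snd (snd (snd z)) c \<noteq> snd (snd (snd z')) c" using lab_sep inE a by metis
    then show ?thesis by (intro bexI[of _ "\<lambda>z. snd (snd (snd z)) c"]) (auto simp: GE_def)
  qed
qed

lemma X_sep: "x \<in> \<Omega> \<Longrightarrow> y \<in> \<Omega> \<Longrightarrow> x \<noteq> y \<Longrightarrow> \<exists>g\<in>GX. g x \<noteq> g y"
proof -
  assume a: "x \<in> \<Omega>" "y \<in> \<Omega>" "x \<noteq> y"
  then consider i where "fst x i \<noteq> fst y i" | "snd x \<noteq> snd y" by (metis ext prod.expand)
  then show ?thesis
  proof cases
    case (1 i)
    have "i \<le> L"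
    proof (rule ccontr)
      assume "\<not> i \<le> L"
      then show False using a 1 by (auto simp: \<Omega>_def)
    qed
    moreover obtain c where "c < rho i" "fst x i c \<noteq> fst y i c"
      using lab_sep[of "fst x i" "rho i" "fst y i"] a 1 \<open>i \<le> L\<close> by (auto simp: \<Omega>_def)
    ultimately show ?thesis
      by (intro bexI[of _ "\<lambda>x. fst x i c"]) (auto simp: GX_def intro!: image_eqI[of _ _ "(i, c)"])
  next
    case 2
    then obtain c where "c < t" "snd x c \<noteq> snd y c"
      using lab_sep[of "snd x" t "snd y"] a by (auto simp: \<Omega>_def)
    then show ?thesis by (intro bexI[of _ "\<lambda>x. snd x c"]) (auto simp: GX_def)
  qed
qed

text \<open>Fewer than \<open>q ^ np\<close> events have to be avoided when a level is chosen: a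
  constant times \<open>q ^ (bX + t + 1)\<close>, and one more factor \<open>q\<close> absorbs the
  constant.\<close>

definition np :: nat where "np = bX + t + 2"
text \<open>In this degree one can interpolate on the at most \<open>L * (np + 1)\<close> nodes met
  while imposing \<open>np\<close> independent conditions, each involving at most \<open>L\<close>
  edges.\<close>

definition dE :: nat where "dE = L * (np + 1)"
text \<open>Each level substitutes the previous one into a polynomial of degree \<open>dE\<close>,
  so degrees multiply by \<open>dE\<close>. This bounds them after \<open>t\<close> levels.\<close>

definition dl :: nat where "dl = dE ^ t"

lemma L3: "3 \<le> L" using k2 by (simp add: L_def)

lemma dE1: "1 \<le> dE" using L3 by (simp add: dE_def)

section \<open>Level coordinates as polynomials in the coordinates of the walk\<close>

lemma polyfun_edge_coordinate:
  assumes W: "\<And>i c. i \<le> L \<Longrightarrow> polyfun GX d (\<lambda>x. W x i c)" and "1 \<le> d" "m < L" "g \<in> GE"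
  shows "polyfun GX d (\<lambda>x. g (edge (fst x) (W x) m))"
proof -
  have P: "polyfun GX d (\<lambda>x. fst x i c)" if "i \<le> L" "c < rho i" for i c
    using that assms(2) by (intro polyfun_gen) (auto simp: GX_def intro!: image_eqI[of _ _ "(i, c)"])
  show ?thesis
    using assms(3,4) P[of m] P[of "Suc m"] W[of m] W[of "Suc m"]
    by (cases "even m") (auto simp: GE_def edge_def rho_def)
qed

lemma polyfun_lev:
  assumes f: "\<And>j. j < t \<Longrightarrow> polyfun GE dE (f j)" and "j \<le> t" "i \<le> L"
  shows "polyfun GX (dE ^ j) (\<lambda>x. lev f x j i c)"
  using assms(2,3)
proof (induction j arbitrary: i c)
  case 0
  then show ?case using polyfun_const[OF zeroK] by simp
next
  case (Suc j)
  have d1: "1 \<le> dE ^ j" using dE1 by simp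
  have ed: "polyfun GX (dE * dE ^ j) (\<lambda>x. f j (edge (fst x) (lev f x j) m))" if "m < L" for m
    by (rule polyfun_comp[OF f]) (use Suc that d1 in \<open>auto intro!: polyfun_edge_coordinate\<close>)
  have "polyfun GX (dE * dE ^ j) (\<lambda>x. crd (f j) (edge (fst x) (lev f x j)) (snd x j) i)" if "i \<le> L" for i
    using that
  proof (induction i)
    case 0
    then show ?case using Suc.prems d1 dE1 by (auto intro!: polyfun_gen simp: GX_def)
  next
    case (Suc i)
    then show ?case using ed[of i] by (auto intro: polyfun_diff)
  qed
  moreover have "polyfun GX (dE * dE ^ j) (\<lambda>x. lev f x j i c)"
    by (rule polyfun_mono[OF Suc.IH]) (use Suc.prems dE1 in auto)
  ultimately show ?case using Suc.prems by (cases "c = j") auto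
qed

lemma polyfun_Psi:
  assumes f: "\<And>j. j < t \<Longrightarrow> polyfun GE dE (f j)" and "j < t" "b \<le> L"
  shows "polyfun GX dl (\<lambda>x. Psi f j a b x)"
proof -
  have d1: "1 \<le> dE ^ j" using dE1 by simp
  have "dE * dE ^ j = dE ^ Suc j" by simp
  also have "\<dots> \<le> dl" unfolding dl_def using assms(2) dE1 by (intro power_increasing) auto
  finally have le: "dE * dE ^ j \<le> dl" .
  have "polyfun GX (dE * dE ^ j) (\<lambda>x. f j (edge (fst x) (lev f x j) m))" if "m < L" for m
    by (rule polyfun_comp[OF f]) (use assms that d1 in \<open>auto intro!: polyfun_edge_coordinate polyfun_lev\<close>)
  then show ?thesis unfolding Psi_def edge_at_def
    using assms(3) by (intro polyfun_sum polyfun_sign) (auto intro: polyfun_mono[OF _ le])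
qed

lemma lev_lab:
  assumes "\<And>j. j < t \<Longrightarrow> polyfun GE dE (f j)" "x \<in> \<Omega>" "j \<le> t" "i \<le> L"
  shows "lev f x j i \<in> lab t"
  unfolding lab_def using PX.polyfun_K[OF polyfun_lev[OF assms(1,3,4)] assms(2)] assms(3) by (auto simp: lev_ge)

lemma edge_at_E:
  assumes "\<And>j. j < t \<Longrightarrow> polyfun GE dE (f j)" "x \<in> \<Omega>" "j \<le> t" "m < L"
  shows "edge_at f j x m \<in> E"
proof -
  have "fst x i \<in> lab (rho i)" if "i \<le> L" for i using assms(2) that by (simp add: \<Omega>_def)
  from this[of m] this[of "Suc m"] show ?thesis
    using lev_lab[of f x j, OF assms(1,2,3)] assms(4) by (auto simp: edge_at_def edge_def E_def rho_def)
qed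

text \<open>The chain of cuts starts in degree \<open>nn * cc\<close>. Every cut uses up
  \<open>nn * dl\<close>, and after at most \<open>t\<close> cuts at least \<open>nn * dl\<close> is
  left.\<close>

definition cc :: nat where "cc = (t + 1) * dl"
text \<open>Just above \<open>(cc + 1) ^ t\<close>, which makes the growth inequality at the end of
  \<open>card_clean\<close> contradictory.\<close>

definition nn :: nat where "nn = (cc + 1) ^ t + 1"
text \<open>Pieces must behave irreducibly for the cuts (\<open>nn * cc\<close>), for
  \<open>irr_avoid\<close> with \<open>L * np\<close> forbidden values (\<open>L * np * dl\<close>),
  and for the equations themselves (\<open>dl\<close>).\<close>

definition DD :: nat where "DD = nn * cc + L * np * dl + dl"
definition HH :: nat where "HH = (DD + 1) ^ bX"

section \<open>Pieces of walk sets and the sets that can occur\<close>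

definition parts :: "'a walk set \<Rightarrow> 'a walk set set" where
  "parts S = (SOME \<C>. finite \<C> \<and> card \<C> \<le> 2 ^ HH \<and> \<Union>\<C> = S \<and> (\<forall>B\<in>\<C>. PX.irr DD B))"

text \<open>The number of pieces is independent of \<open>q\<close>, because \<open>HH\<close>
  counts monomials in at most \<open>bX\<close> coordinates. A fixed choice of the cover makes
  \<open>family\<close> depend on the level polynomials alone.\<close>

lemma parts:
  assumes "S \<subseteq> \<Omega>"
  shows "finite (parts S)" "card (parts S) \<le> 2 ^ HH" "\<Union>(parts S) = S" "B \<in> parts S \<Longrightarrow> PX.irr DD B"
proof -
  have "card (PX.restr S DD) \<le> q ^ ((DD + 1) ^ card GX)"
    by (rule PX.card_restr_le[OF assms finite_GX]) auto
  also have "\<dots> \<le> q ^ HH" unfolding HH_def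
    using card_GX q_ge_2 by (intro power_increasing) auto
  finally have "\<exists>\<C>. finite \<C> \<and> card \<C> \<le> 2 ^ HH \<and> \<Union>\<C> = S \<and> (\<forall>B\<in>\<C>. PX.irr DD B)"
    by (rule PX.irr_cover[OF assms])
  from someI_ex[OF this]
  show "finite (parts S)" "card (parts S) \<le> 2 ^ HH" "\<Union>(parts S) = S" "B \<in> parts S \<Longrightarrow> PX.irr DD B"
    unfolding parts_def by blast+
qed

definition edge_pattern :: "(nat \<Rightarrow> 'a edge \<Rightarrow> 'a) \<Rightarrow> nat \<Rightarrow> 'a walk \<Rightarrow> (nat \<times> nat) set" where
  "edge_pattern f j x = {(m, m'). m < L \<and> m' < L \<and> edge_at f j x m = edge_at f j x m'}"

text \<open>Sorting by the coincidences among edges comes first, so that the net coefficient of an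
  edge in \<open>Psi\<close> is the same for all walks of an atom. Irreducibility is arranged
  afterwards.\<close>

definition atoms :: "(nat \<Rightarrow> 'a edge \<Rightarrow> 'a) \<Rightarrow> nat \<Rightarrow> 'a walk set \<Rightarrow> 'a walk set set" where
  "atoms f j S = (\<Union>\<pi>\<in>Pow ({..<L} \<times> {..<L}). parts {x \<in> S. edge_pattern f j x = \<pi>})"

text \<open>The starting sets of the chains. They record which labels are constant and which
  coincide in a uniform family, so that only label coordinates that really vary remain free.\<close>

definition base :: "nat set \<Rightarrow> (nat \<Rightarrow> nat) \<Rightarrow> 'a walk \<Rightarrow> 'a walk set" where
  "base I rp x0 = {x \<in> \<Omega>. snd x = snd x0 \<and> (\<forall>i\<in>I. fst x i = fst x0 i) \<and> (\<forall>i\<le>L. fst x i = fst x (rp i))}"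

text \<open>All sets of walks that can remain after the first \<open>j\<close> levels, whatever the final set of walks is.\<close>

primrec family :: "(nat \<Rightarrow> 'a edge \<Rightarrow> 'a) \<Rightarrow> nat \<Rightarrow> 'a walk set set" where
  "family f 0 = (\<lambda>(I, rp, x0). base I rp x0) ` (Pow {..L} \<times> ({..L} \<rightarrow>\<^sub>E {..L}) \<times> \<Omega>)"
| "family f (Suc j) = (\<Union>S\<in>family f j. \<Union>A\<in>atoms f j S.
     insert A ((\<lambda>(a, b, w). {x \<in> A. Psi f j a b x = w}) ` ({..L} \<times> {..L} \<times> K)))"

lemma atoms_sub: "S \<subseteq> \<Omega> \<Longrightarrow> A \<in> atoms f j S \<Longrightarrow> A \<subseteq> S"
proof -
  assume a: "S \<subseteq> \<Omega>" "A \<in> atoms f j S"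
  then obtain \<pi> where "A \<in> parts {x \<in> S. edge_pattern f j x = \<pi>}" by (auto simp: atoms_def)
  moreover have "{x \<in> S. edge_pattern f j x = \<pi>} \<subseteq> \<Omega>" using a(1) by auto
  ultimately have "A \<subseteq> {x \<in> S. edge_pattern f j x = \<pi>}" using parts(3) by blast
  then show ?thesis by auto
qed

lemma family_sub: "S \<in> family f j \<Longrightarrow> S \<subseteq> \<Omega>"
proof (induction j arbitrary: S)
  case (Suc j)
  then obtain S' A where "S' \<in> family f j" "A \<in> atoms f j S'" "S \<subseteq> A" by auto
  then show ?case using atoms_sub[of S' A f j] Suc.IH[of S'] by auto
qed (auto simp: base_def)

definition Bt :: nat where "Bt = 2 ^ (L * L) * 2 ^ HH"

lemma card_atoms: "S \<subseteq> \<Omega> \<Longrightarrow> finite (atoms f j S) \<and> card (atoms f j S) \<le> Bt"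
proof -
  assume a: "S \<subseteq> \<Omega>"
  then have s: "{x \<in> S. edge_pattern f j x = \<pi>} \<subseteq> \<Omega>" for \<pi> by auto
  have "card (atoms f j S) * 1 \<le> card (Pow ({..<L} \<times> {..<L})) * 2 ^ HH"
    unfolding atoms_def by (rule card_UN_mult_le) (use parts[OF s] in auto)
  then show ?thesis using parts(1)[OF s] by (auto simp: atoms_def Bt_def card_Pow card_cartesian_product)
qed

definition C0 :: nat where "C0 = 2 ^ (L + 1) * (L + 1) ^ (L + 1)"
definition C1 :: nat where "C1 = Bt * ((L + 1) * (L + 1) + 1)"

text \<open>Only \<open>x0\<close> and the values \<open>w\<close> have a range depending on
  \<open>q\<close>: at most \<open>q ^ bX\<close> choices for the first, and one more factor
  \<open>q\<close> per level. A union bound can afford such polynomial growth.\<close>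

lemma card_family: "finite (family f j) \<and> card (family f j) \<le> C0 * C1 ^ j * q ^ (bX + j)"
proof (induction j)
  case 0
  have fin: "finite (Pow {..L} \<times> ({..L} \<rightarrow>\<^sub>E {..L}) \<times> \<Omega>)" by (simp add: finite_X finite_PiE)
  have "card (family f 0) \<le> card (Pow {..L} \<times> ({..L} \<rightarrow>\<^sub>E {..L}) \<times> \<Omega>)"
    unfolding family.simps by (rule card_image_le[OF fin])
  also have "\<dots> = C0 * card \<Omega>"
    by (simp add: card_cartesian_product card_Pow card_PiE C0_def)
  also have "\<dots> \<le> C0 * q ^ bX" using card_X by simp
  finally show ?case using fin by simp
next
  case (Suc j)
  let ?T = "{..L} \<times> {..L} \<times> K"
  let ?I = "\<lambda>A. insert A ((\<lambda>(a, b, w). {x \<in> A. Psi f j a b x = w}) ` ?T)"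
  have finT: "finite ?T" by (simp add: finK)
  have cT: "card (?I A) \<le> ((L + 1) * (L + 1) + 1) * q" for A
  proof -
    have "card (?I A) \<le> Suc (card ((\<lambda>(a, b, w). {x \<in> A. Psi f j a b x = w}) ` ?T))"
      using finT by (simp add: card_insert_if)
    also have "\<dots> \<le> Suc (card ?T)" using card_image_le[OF finT] by simp
    also have "\<dots> = (L + 1) * (L + 1) * q + 1" by (simp add: card_cartesian_product algebra_simps)
    also have "\<dots> \<le> (L + 1) * (L + 1) * q + q" using q_ge_2 by simp
    finally show ?thesis by (simp add: algebra_simps)
  qed
  have at: "finite (atoms f j S)" "card (atoms f j S) \<le> Bt" if "S \<in> family f j" for S
    using card_atoms[OF family_sub[OF that]] by auto
  have 1: "card (\<Union>A\<in>atoms f j S. ?I A) * 1 \<le> C1 * q" if "S \<in> family f j" for S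
  proof -
    have "card (\<Union>A\<in>atoms f j S. ?I A) * 1 \<le> card (atoms f j S) * (((L + 1) * (L + 1) + 1) * q)"
      using at(1)[OF that] finT cT by (intro card_UN_mult_le) auto
    also have "\<dots> \<le> Bt * (((L + 1) * (L + 1) + 1) * q)" using at(2)[OF that] by (rule mult_le_mono1)
    finally show ?thesis unfolding C1_def by (simp only: mult.assoc)
  qed
  have fin: "finite (\<Union>A\<in>atoms f j S. ?I A)" if "S \<in> family f j" for S using at(1)[OF that] finT by auto
  have "card (family f (Suc j)) * 1 \<le> card (family f j) * (C1 * q)"
    unfolding family.simps by (rule card_UN_mult_le) (use Suc fin 1 in auto)
  also have "\<dots> \<le> (C0 * C1 ^ j * q ^ (bX + j)) * (C1 * q)" using Suc by (intro mult_le_mono1) simp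
  also have "\<dots> = C0 * C1 ^ Suc j * q ^ (bX + Suc j)" by (simp add: mult_ac)
  finally show ?case using Suc fin by auto
qed

lemma C1_pos: "1 \<le> C1"
  by (simp add: C1_def Bt_def Suc_le_eq)

text \<open>The coefficient with which the edge at \<open>m0\<close> survives in
  \<open>Psi f j a b\<close>. It can vanish through opposite traversals or through the
  characteristic.\<close>

definition edge_coeff :: "(nat \<Rightarrow> 'a edge \<Rightarrow> 'a) \<Rightarrow> nat \<Rightarrow> nat \<Rightarrow> nat \<Rightarrow> nat \<Rightarrow> 'a walk \<Rightarrow> 'a" where
  "edge_coeff f j a b m0 x = (\<Sum>m\<in>{m \<in> {a..<b}. edge_at f j x m = edge_at f j x m0}. (-1) ^ m * e)"

text \<open>The demand is made on every atom that could occur, before any particular set of walks is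
  known. It involves \<open>f\<close> only up to level \<open>j\<close>, so the levels can be chosen
  one after another.\<close>

definition good :: "(nat \<Rightarrow> 'a edge \<Rightarrow> 'a) \<Rightarrow> nat \<Rightarrow> bool" where
  "good f j \<longleftrightarrow> (\<forall>S\<in>family f j. \<forall>A\<in>atoms f j S. \<forall>a b m0. a \<le> m0 \<longrightarrow> m0 < b \<longrightarrow> b \<le> L \<longrightarrow>
     (\<forall>x\<in>A. edge_coeff f j a b m0 x \<noteq> 0) \<longrightarrow> (\<exists>x\<in>A. \<exists>y\<in>A. edge_at f j x m0 \<noteq> edge_at f j y m0) \<longrightarrow>
     (\<forall>w\<in>K. \<exists>x\<in>A. Psi f j a b x \<noteq> w))"

lemma atoms_cong: "(\<And>i. i < j \<Longrightarrow> f i = f' i) \<Longrightarrow> atoms f j = atoms f' j"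
  by (intro ext) (simp only: atoms_def edge_pattern_def edge_at_cong[of j f f'])

lemma family_cong: "(\<And>i. i < j \<Longrightarrow> f i = f' i) \<Longrightarrow> family f j = family f' j"
proof (induction j)
  case (Suc j)
  have "edge_at f j = edge_at f' j" "f j = f' j" using edge_at_cong[of j f f'] Suc.prems by auto
  then have "Psi f j = Psi f' j" by (intro ext) (simp only: Psi_def)
  moreover have "atoms f j = atoms f' j" "family f j = family f' j" using Suc atoms_cong[of j f f'] by auto
  ultimately show ?case by simp
qed simp

lemma good_cong: "(\<And>i. i \<le> j \<Longrightarrow> f i = f' i) \<Longrightarrow> good f j = good f' j"
proof -
  assume a: "\<And>i. i \<le> j \<Longrightarrow> f i = f' i"
  then have "family f j = family f' j" "atoms f j = atoms f' j" "edge_at f j = edge_at f' j"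
    using family_cong[of j f f'] atoms_cong[of j f f'] edge_at_cong[of j f f'] by auto
  moreover have "f j = f' j" using a by simp
  ultimately show ?thesis unfolding good_def edge_coeff_def Psi_def by simp
qed

section \<open>Choice of the level polynomials by a union bound\<close>

definition Q0 :: nat where "Q0 = C0 * C1 ^ t * Bt * ((L + 1) * (L + 1))"

text \<open>By \<open>card_functional_level_set\<close>, each combination of atom, segment and value
  rules out at most one in \<open>q ^ np\<close> of the candidate functions. There are fewer than
  \<open>q ^ np\<close> combinations, so some candidate survives them all.\<close>

lemma exists_good_step:
  assumes f: "\<And>j. j < t \<Longrightarrow> polyfun GE dE (f j)" and j: "j < t" and q: "Q0 < q"
  shows "\<exists>g. polyfun GE dE g \<and> good (f(j := g)) j"
proof -
  define AA where "AA = (\<Union>S\<in>family f j. atoms f j S)"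
  define cond where "cond A a b \<longleftrightarrow> b \<le> L \<and> (\<exists>m0. a \<le> m0 \<and> m0 < b \<and> (\<forall>x\<in>A. edge_coeff f j a b m0 x \<noteq> 0) \<and>
    (\<exists>x\<in>A. \<exists>y\<in>A. edge_at f j x m0 \<noteq> edge_at f j y m0))" for A a b
  define bad where "bad = (\<lambda>(A, a, b, w). {\<phi> \<in> PE.restr E dE. cond A a b \<and>
     (\<forall>x\<in>A. (\<Sum>m\<in>{a..<b}. (-1) ^ m * \<phi> (edge_at f j x m)) = w)})"
  define IX where "IX = AA \<times> {..L} \<times> {..L} \<times> K"
  have at: "finite (atoms f j S)" "card (atoms f j S) \<le> Bt" if "S \<in> family f j" for S
    using card_atoms[OF family_sub[OF that]] by auto
  have "card AA * 1 \<le> card (family f j) * Bt" unfolding AA_def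
    by (rule card_UN_mult_le) (use card_family at in auto)
  also have "\<dots> \<le> (C0 * C1 ^ j * q ^ (bX + j)) * Bt" using card_family by (intro mult_le_mono1) simp
  also have "\<dots> \<le> (C0 * C1 ^ t * q ^ (bX + t)) * Bt"
    using j q_ge_2 C1_pos by (intro mult_le_mono1 mult_le_mono mult_le_mono2 power_increasing) auto
  finally have cAA: "card AA \<le> C0 * C1 ^ t * q ^ (bX + t) * Bt" by simp
  have finAA: "finite AA" using at card_family[of f j] by (auto simp: AA_def)
  have finIX: "finite IX" using finAA finK by (simp add: IX_def)
  have finrs: "finite (PE.restr E dE)" by (rule PE.finite_restr) simp
  have badle: "card (bad (A, a, b, w)) * q ^ np \<le> card (PE.restr E dE)" if A: "A \<in> AA" for A a b w
  proof (cases "cond A a b")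
    case True
    then obtain m0 where m0: "b \<le> L" "a \<le> m0" "m0 < b" "\<forall>x\<in>A. edge_coeff f j a b m0 x \<noteq> 0"
      "\<exists>x\<in>A. \<exists>y\<in>A. edge_at f j x m0 \<noteq> edge_at f j y m0" by (auto simp: cond_def)
    obtain S where S: "S \<in> family f j" "A \<in> atoms f j S" using A by (auto simp: AA_def)
    have AX: "A \<subseteq> \<Omega>" using atoms_sub[OF family_sub[OF S(1)] S(2)] family_sub[OF S(1)] by auto
    have irr: "PX.irr DD A"
    proof -
      obtain \<pi> where "A \<in> parts {x \<in> S. edge_pattern f j x = \<pi>}" using S(2) by (auto simp: atoms_def)
      moreover have "{x \<in> S. edge_pattern f j x = \<pi>} \<subseteq> \<Omega>" using family_sub[OF S(1)] by auto
      ultimately show ?thesis using parts(4) by blast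
    qed
    have edE: "edge_at f j x m \<in> E" if "x \<in> A" "m < L" for x m
      using edge_at_E[of f x j m] f that AX j by auto
    \<comment> \<open>Different edges differ in some coordinate \<open>g\<close>. Being nonconstant
      on the irreducible \<open>A\<close>, it escapes every small set of values, and this supplies
      the new nodes.\<close>
    obtain x y where xy: "x \<in> A" "y \<in> A" "edge_at f j x m0 \<noteq> edge_at f j y m0" using m0(5) by blast
    have "m0 < L" using m0(1,3) by simp
    then obtain g where "g \<in> GE" "g (edge_at f j x m0) \<noteq> g (edge_at f j y m0)"
      using E_sep[OF edE[OF xy(1)] edE[OF xy(2)] xy(3)] by blast
    then have g: "g \<in> GE" "\<exists>x\<in>A. \<exists>y\<in>A. g (edge_at f j x m0) \<noteq> g (edge_at f j y m0)" using xy by blast+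
    have pfg: "polyfun GX dl (\<lambda>x. g (edge_at f j x m0))"
    proof (rule polyfun_mono)
      show "polyfun GX (dE ^ j) (\<lambda>x. g (edge_at f j x m0))" unfolding edge_at_def
        using m0 g(1) j dE1 by (intro polyfun_edge_coordinate polyfun_lev f) auto
      show "dE ^ j \<le> dl" unfolding dl_def using j dE1 by (intro power_increasing) auto
    qed
    have cI: "card {a..<b} \<le> L" using m0 by simp
    have "card {\<phi> \<in> PE.restr E dE. \<forall>x\<in>A. (\<Sum>m\<in>{a..<b}. (-1) ^ m * \<phi> (edge_at f j x m)) = w} * q ^ np
        \<le> card (PE.restr E dE)"
    proof (rule PE.card_functional_level_set[OF E_sep, where ?m0.0 = m0])
      fix F assume F: "F \<subseteq> E" "card F \<le> card {a..<b} * np"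
      have finF: "finite F" using F(1) finite_E finite_subset by blast
      have "card (g ` F) * dl \<le> L * np * dl"
        using card_image_le[OF finF, of g] F(2) cI by (meson le_trans mult_le_mono1)
      moreover have "L * np * dl \<le> DD" by (simp add: DD_def)
      ultimately have "card (g ` F) * dl \<le> DD" by (rule le_trans)
      moreover have "g ` F \<subseteq> K" using F(1) g(1) PE.genK by auto
      ultimately obtain x where "x \<in> A" "g (edge_at f j x m0) \<notin> g ` F"
        using PX.irr_avoid[OF irr AX pfg g(2), of "g ` F"] finF by auto
      then show "\<exists>y\<in>A. edge_at f j y m0 \<notin> F" by blast
    next
      show "card {a..<b} * (np + 1) \<le> dE" unfolding dE_def using cI by (rule mult_le_mono1)
    qed (use m0 edE in \<open>auto simp: edge_coeff_def\<close>)
    then show ?thesis using True by (simp add: bad_def)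
  qed (simp add: bad_def)
  have finbad: "finite (bad i)" for i using finrs by (cases i) (simp add: bad_def)
  have "card (\<Union>i\<in>IX. bad i) * q ^ np \<le> card IX * card (PE.restr E dE)"
  proof (rule card_UN_mult_le[OF finIX])
    fix i assume i: "i \<in> IX"
    show "finite (bad i)" by (rule finbad)
    show "card (bad i) * q ^ np \<le> card (PE.restr E dE)" using i badle by (auto simp: IX_def)
  qed
  also have "\<dots> < q ^ np * card (PE.restr E dE)"
  proof (rule mult_strict_right_mono)
    have "card IX = card AA * ((L + 1) * (L + 1)) * q" by (simp add: IX_def card_cartesian_product algebra_simps)
    also have "\<dots> \<le> (C0 * C1 ^ t * q ^ (bX + t) * Bt) * ((L + 1) * (L + 1)) * q"
      using cAA by (intro mult_le_mono1)
    also have "\<dots> = Q0 * q ^ (bX + t + 1)" by (simp add: Q0_def algebra_simps)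
    also have "\<dots> < q * q ^ (bX + t + 1)" using q q_ge_2 by (intro mult_strict_right_mono) auto
    also have "\<dots> = q ^ np" by (simp add: np_def)
    finally show "card IX < q ^ np" .
  qed (simp add: PE.card_restr_pos)
  finally have "card (\<Union>i\<in>IX. bad i) < card (PE.restr E dE)" by (simp add: mult.commute)
  then have "\<not> PE.restr E dE \<subseteq> (\<Union>i\<in>IX. bad i)"
    using finIX finbad card_mono[of "\<Union>i\<in>IX. bad i" "PE.restr E dE"] by (meson finite_UN_I leD)
  then obtain \<phi> where \<phi>: "\<phi> \<in> PE.restr E dE" "\<phi> \<notin> (\<Union>i\<in>IX. bad i)" by blast
  then obtain g where g: "polyfun GE dE g" "\<phi> = restrict g E" by (auto simp: PE.restr_def)
  \<comment> \<open>Atoms and edges at level \<open>j\<close> are computed from earlier levels, so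
    they survive the replacement of \<open>f j\<close>.\<close>
  define f' where "f' = f(j := g)"
  have eq: "family f' j = family f j" "atoms f' j = atoms f j" "edge_at f' j = edge_at f j"
    using family_cong[of j f' f] atoms_cong[of j f' f] edge_at_cong[of j f' f] by (auto simp: f'_def)
  have "good f' j" unfolding good_def
  proof (intro ballI allI impI)
    fix S A a b m0 w
    assume a: "S \<in> family f' j" "A \<in> atoms f' j S" "a \<le> m0" "m0 < b" "b \<le> L"
      "\<forall>x\<in>A. edge_coeff f' j a b m0 x \<noteq> 0" "\<exists>x\<in>A. \<exists>y\<in>A. edge_at f' j x m0 \<noteq> edge_at f' j y m0" "w \<in> K"
    have AX: "A \<subseteq> \<Omega>" using atoms_sub[OF family_sub[OF a(1)] a(2)] family_sub[OF a(1)] by auto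
    have "cond A a b" unfolding cond_def using a(3-7) eq by (auto simp: edge_coeff_def)
    moreover have "(A, a, b, w) \<in> IX" using a eq by (auto simp: IX_def AA_def)
    then have "\<phi> \<notin> bad (A, a, b, w)" using \<phi>(2) by blast
    ultimately obtain x where x: "x \<in> A" "(\<Sum>m\<in>{a..<b}. (-1) ^ m * \<phi> (edge_at f j x m)) \<noteq> w"
      using \<phi>(1) unfolding bad_def by blast
    have "(\<Sum>m\<in>{a..<b}. (-1) ^ m * \<phi> (edge_at f j x m)) = Psi f' j a b x"
    proof -
      have "edge_at f j x m \<in> E" if "m \<in> {a..<b}" for m
        using edge_at_E[of f x j m] f that a(5) x(1) AX j by auto
      then show ?thesis unfolding Psi_def eq by (intro sum.cong) (auto simp: f'_def g)
    qed
    then show "\<exists>x\<in>A. Psi f' j a b x \<noteq> w" using x by metis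
  qed
  then show ?thesis using g(1) by (auto simp: f'_def)
qed

lemma exists_good:
  assumes "Q0 < q"
  shows "\<exists>f. (\<forall>j<t. polyfun GE dE (f j)) \<and> (\<forall>j<t. good f j)"
proof -
  have "\<exists>f. (\<forall>j<t. polyfun GE dE (f j)) \<and> (\<forall>j<n. good f j)" if "n \<le> t" for n
    using that
  proof (induction n)
    case 0
    show ?case by (intro exI[of _ "\<lambda>_ _. 0"]) (auto intro: polyfun_const zeroK)
  next
    case (Suc n)
    then obtain f where f: "\<forall>j<t. polyfun GE dE (f j)" "\<forall>j<n. good f j" by auto
    obtain g where g: "polyfun GE dE g" "good (f(n := g)) n"
      using exists_good_step[of f n] f(1) Suc.prems assms by auto
    have "good (f(n := g)) j" if "j < n" for j
      using f(2) that good_cong[of j "f(n := g)" f] by auto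
    then have "\<forall>j<Suc n. good (f(n := g)) j" using g(2) by (simp only: less_Suc_eq) blast
    moreover have "\<forall>j<t. polyfun GE dE ((f(n := g)) j)" using f(1) g(1) by simp
    ultimately show ?case by blast
  qed
  then show ?thesis by blast
qed

end

section \<open>Constraints along a family of walks\<close>

lemma pigeonhole_cover:
  assumes "finite I" "card I \<le> B" "finite V" "V \<subseteq> (\<Union>i\<in>I. A i)" "V \<noteq> {}"
  shows "\<exists>i\<in>I. card V \<le> card (V \<inter> A i) * B"
proof (rule ccontr)
  assume "\<not> ?thesis"
  then have lt: "card (V \<inter> A i) * B < card V" if "i \<in> I" for i using that by auto
  have "I \<noteq> {}" using assms(4,5) by auto
  have "card V \<le> (\<Sum>i\<in>I. card (V \<inter> A i))"
    using card_UN_le[OF assms(1), of "\<lambda>i. V \<inter> A i"] assms(4) by (metis Int_UN_distrib inf.absorb1)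
  then have "card V * B \<le> (\<Sum>i\<in>I. card (V \<inter> A i) * B)"
    by (simp add: sum_distrib_right[symmetric])
  also have "\<dots> < (\<Sum>i\<in>I. card V)" using lt \<open>I \<noteq> {}\<close> assms(1) by (intro sum_strict_mono) auto
  also have "\<dots> \<le> card V * B" using assms(2) by (simp add: mult.commute)
  finally show False by simp
qed

text \<open>If \<open>g\<close> has at least \<open>m\<close> values, a transversal of its fibres
  works; otherwise pigeonhole gives a fibre with at least \<open>m\<close> elements.\<close>

lemma const_or_inj_subset1:
  assumes "finite V" "m ^ 2 \<le> card V" "0 < m"
  shows "\<exists>S\<subseteq>V. m \<le> card S \<and> ((\<exists>c. \<forall>x\<in>S. g x = c) \<or> inj_on g S)"
proof (cases "m \<le> card (g ` V)")
  case True
  obtain U where "U \<subseteq> V" "inj_on g U" "g ` V = g ` U" using subset_image_inj[of "g ` V" g V] by auto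
  then show ?thesis using True card_image[of g U] by (intro exI[of _ U]) auto
next
  case False
  have "V \<noteq> {}" using assms by auto
  then obtain c where c: "card V \<le> card (V \<inter> g -` {c}) * m"
    using pigeonhole_cover[of "g ` V" m V "\<lambda>c. g -` {c}"] False assms(1) by auto
  then have "m * m \<le> card (V \<inter> g -` {c}) * m" using assms(2) unfolding power2_eq_square by (rule le_trans[rotated])
  then have "m \<le> card (V \<inter> g -` {c})" using assms(3) by simp
  then show ?thesis by (intro exI[of _ "V \<inter> g -` {c}"]) auto
qed

text \<open>Each member of \<open>G\<close> costs one square root of the size, hence the exponent
  \<open>2 ^ card G\<close>.\<close>

lemma const_or_inj_subset:
  assumes "finite G" "finite V" "m ^ (2 ^ card G) \<le> card V" "0 < m"
  shows "\<exists>S\<subseteq>V. m \<le> card S \<and> (\<forall>g\<in>G. (\<exists>c. \<forall>x\<in>S. g x = c) \<or> inj_on g S)"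
  using assms
proof (induction G arbitrary: V rule: finite_induct)
  case (insert g G)
  have "(m ^ (2 ^ card G)) ^ 2 \<le> card V"
    using insert.prems insert.hyps by (simp add: power_mult[symmetric] mult.commute)
  then obtain S where S: "S \<subseteq> V" "m ^ (2 ^ card G) \<le> card S" "(\<exists>c. \<forall>x\<in>S. g x = c) \<or> inj_on g S"
    using const_or_inj_subset1[OF insert.prems(1)] insert.prems(3) by (metis zero_less_power)
  have "finite S" using S insert.prems finite_subset by blast
  then obtain S' where S': "S' \<subseteq> S" "m \<le> card S'" "\<forall>g\<in>G. (\<exists>c. \<forall>x\<in>S'. g x = c) \<or> inj_on g S'"
    using insert.IH[OF _ S(2)] insert.prems(3) by blast
  have "(\<exists>c. \<forall>x\<in>S'. g x = c) \<or> inj_on g S'" using S(3) S'(1) by (meson inj_on_subset subsetD)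
  then show ?case using S(1) S' by (intro exI[of _ S']) auto
qed auto

section \<open>Uniform families of walks\<close>

definition vertex_at :: "(nat \<Rightarrow> 'a::ring_1 edge \<Rightarrow> 'a) \<Rightarrow> nat \<Rightarrow> nat \<Rightarrow> 'a walk \<Rightarrow> 'a coords \<times> 'a coords" where
  "vertex_at f j i x = (fst x i, lev f x j i)"

lemma lev_trunc_le: "j \<le> j' \<Longrightarrow> lev f x j i = (\<lambda>c. if c < j then lev f x j' i c else 0)"
proof (induction j' rule: dec_induct)
  case base
  show ?case by (auto simp: lev_ge fun_eq_iff)
next
  case (step n)
  then show ?case by (auto simp: fun_eq_iff)
qed

lemma lev_start: "lev f x j 0 = (\<lambda>c. if c < j then snd x c else 0)"
  by (induction j) (auto simp: fun_eq_iff less_Suc_eq)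

text \<open>Positions of different parity traverse their edges in opposite directions between the
  sides, so their ends are matched crosswise.\<close>

lemma edge_at_eq_iff:
  "edge_at f j x m = edge_at f j x m' \<longleftrightarrow>
    (if even m = even m' then vertex_at f j m x = vertex_at f j m' x \<and> vertex_at f j (Suc m) x = vertex_at f j (Suc m') x
     else vertex_at f j m x = vertex_at f j (Suc m') x \<and> vertex_at f j (Suc m) x = vertex_at f j m' x)"
  by (auto simp: edge_at_def edge_def vertex_at_def)

lemma edge_at_same_iff:
  "edge_at f j x m = edge_at f j y m \<longleftrightarrow> vertex_at f j m x = vertex_at f j m y \<and> vertex_at f j (Suc m) x = vertex_at f j (Suc m) y"
  by (auto simp: edge_at_def edge_def vertex_at_def)

text \<open>\<open>card_walks\<close> reaches this situation by thinning out. Uniformity turns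
  constancy and coincidence of vertices into combinatorial data of \<open>S\<close>, the same for
  all its walks.\<close>

locale clean_walks = tower K e k r r' t for K :: "'a::comm_ring_1 set" and e k r r' t +
  fixes f :: "nat \<Rightarrow> 'a edge \<Rightarrow> 'a" and S :: "'a walk set"
  assumes pff: "j < t \<Longrightarrow> polyfun GE dE (f j)"
    and SX: "S \<subseteq> \<Omega>" and S2: "2 \<le> card S"
    and snd_eq: "x \<in> S \<Longrightarrow> y \<in> S \<Longrightarrow> snd x = snd y"
    and start_eq: "x \<in> S \<Longrightarrow> y \<in> S \<Longrightarrow> fst x 0 = fst y 0"
    and end_eq: "x \<in> S \<Longrightarrow> y \<in> S \<Longrightarrow> vertex_at f t L x = vertex_at f t L y"
    and nonback: "x \<in> S \<Longrightarrow> i + 2 \<le> L \<Longrightarrow> fst x i \<noteq> fst x (i + 2)"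
    and uni: "j \<le> t \<Longrightarrow> i \<le> L \<Longrightarrow> (\<forall>x\<in>S. \<forall>y\<in>S. vertex_at f j i x = vertex_at f j i y) \<or> inj_on (vertex_at f j i) S"
    and uni_eq: "j \<le> t \<Longrightarrow> i \<le> L \<Longrightarrow> i' \<le> L \<Longrightarrow>
        (\<forall>x\<in>S. vertex_at f j i x = vertex_at f j i' x) \<or> (\<forall>x\<in>S. vertex_at f j i x \<noteq> vertex_at f j i' x)"
begin

text \<open>A zero-dimensional label space has a single element, but labels at distance two differ;
  since \<open>L \<ge> 3\<close> this occurs on both sides.\<close>

lemma r1: "1 \<le> r" and r'1: "1 \<le> r'"
proof -
  have "S \<noteq> {}" using S2 by auto
  then obtain x where x: "x \<in> S" by blast
  have lab: "fst x i \<in> lab (rho i)" if "i \<le> L" for i using x SX that by (auto simp: \<Omega>_def)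
  have lab0: "l = l'" if "l \<in> lab n" "l' \<in> lab n" "n = 0" for l l' n
    using that by (auto simp: lab_def)
  have "rho 0 = r" "rho (0 + 2) = r" "rho 1 = r'" "rho (1 + 2) = r'" by (simp_all add: rho_def)
  then have "r \<noteq> 0" "r' \<noteq> 0"
    using lab0[of "fst x 0" r "fst x (0 + 2)"] lab0[of "fst x 1" r' "fst x (1 + 2)"]
      lab[of 0] lab[of "0 + 2"] lab[of 1] lab[of "1 + 2"] nonback[OF x, of 0] nonback[OF x, of 1] L3 by auto
  then show "1 \<le> r" "1 \<le> r'" by simp_all
qed

lemma finS: "finite S" using SX finite_X finite_subset by blast

lemma S_ne: "S \<noteq> {}" using S2 by auto

definition const_at :: "nat \<Rightarrow> nat \<Rightarrow> bool" where "const_at j i \<longleftrightarrow> (\<forall>x\<in>S. \<forall>y\<in>S. vertex_at f j i x = vertex_at f j i y)"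
definition same_vertex :: "nat \<Rightarrow> nat \<Rightarrow> nat \<Rightarrow> bool" where
  "same_vertex j i i' \<longleftrightarrow> even i = even i' \<and> (\<forall>x\<in>S. vertex_at f j i x = vertex_at f j i' x)"
definition same_edge :: "nat \<Rightarrow> nat \<Rightarrow> nat \<Rightarrow> bool" where
  "same_edge j m m' \<longleftrightarrow> (\<forall>x\<in>S. edge_at f j x m = edge_at f j x m')"

lemma vertex_at_down: "vertex_at f j i x = (fst (vertex_at f (Suc j) i x), (snd (vertex_at f (Suc j) i x))(j := 0))"
  using lev_trunc[of f x j i] by (simp add: vertex_at_def)

lemma const_at_down: "const_at (Suc j) i \<Longrightarrow> const_at j i"
  unfolding const_at_def by (metis vertex_at_down)

lemma same_vertex_down: "same_vertex (Suc j) i i' \<Longrightarrow> same_vertex j i i'"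
  unfolding same_vertex_def by (metis vertex_at_down)

lemma same_vertex_refl: "same_vertex j i i" and same_vertex_sym: "same_vertex j i i' \<Longrightarrow> same_vertex j i' i"
  and same_vertex_trans: "same_vertex j i i' \<Longrightarrow> same_vertex j i' i'' \<Longrightarrow> same_vertex j i i''"
  and same_vertex_const_at: "same_vertex j i i' \<Longrightarrow> const_at j i = const_at j i'"
  by (auto simp: same_vertex_def const_at_def)

lemma const_at_0: "const_at j 0"
  unfolding const_at_def
proof (intro ballI)
  fix x y assume "x \<in> S" "y \<in> S"
  then have "snd x = snd y" "fst x 0 = fst y 0" by (rule snd_eq, rule start_eq)
  then show "vertex_at f j 0 x = vertex_at f j 0 y" by (simp only: vertex_at_def lev_start)
qed

lemma const_at_L: "j \<le> t \<Longrightarrow> const_at j L"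
  unfolding const_at_def
proof (intro ballI)
  fix x y assume "j \<le> t" "x \<in> S" "y \<in> S"
  then show "vertex_at f j L x = vertex_at f j L y"
    using end_eq[of x y] by (simp add: vertex_at_def lev_trunc_le[of j t f _ L] cong: if_cong)
qed

lemma not_same_vertex_2: "i + 2 \<le> L \<Longrightarrow> \<not> same_vertex j i (i + 2)"
  using S_ne nonback by (auto simp: same_vertex_def vertex_at_def)

lemma same_edge_iff:
  "same_edge j m m' \<longleftrightarrow> (if even m = even m' then same_vertex j m m' \<and> same_vertex j (Suc m) (Suc m')
     else same_vertex j m (Suc m') \<and> same_vertex j (Suc m) m')"
  unfolding same_edge_def same_vertex_def edge_at_eq_iff by auto

lemma same_edge_uni:
  assumes "j \<le> t" "m < L" "m' < L" "x \<in> S"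
  shows "edge_at f j x m = edge_at f j x m' \<longleftrightarrow> same_edge j m m'"
  using uni_eq[of j m m'] uni_eq[of j "Suc m" "Suc m'"] uni_eq[of j m "Suc m'"] uni_eq[of j "Suc m" m'] assms
  unfolding same_edge_def edge_at_eq_iff by auto

lemma edge_at_nonconst:
  assumes "j \<le> t" "m < L" "\<not> const_at j m \<or> \<not> const_at j (Suc m)" "x \<in> S" "y \<in> S" "x \<noteq> y"
  shows "edge_at f j x m \<noteq> edge_at f j y m"
  using assms uni[of j m] uni[of j "Suc m"] unfolding edge_at_same_iff const_at_def inj_on_def
  by (metis Suc_leI less_imp_le)

text \<open>Level \<open>j\<close> imposes a genuine equation on \<open>S\<close>:
  \<open>Psi\<close> is constant on \<open>S\<close> although a varying edge survives in it. For
  good \<open>f\<close> the equation then fails somewhere on the surrounding atom.\<close>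

definition effective :: "nat \<Rightarrow> bool" where
  "effective j \<longleftrightarrow> (\<exists>a b m0. a \<le> m0 \<and> m0 < b \<and> b \<le> L \<and> (\<not> const_at j m0 \<or> \<not> const_at j (Suc m0)) \<and>
     (\<Sum>m\<in>{m \<in> {a..<b}. same_edge j m m0}. (-1) ^ m * e) \<noteq> 0 \<and> (\<exists>w\<in>K. \<forall>x\<in>S. Psi f j a b x = w))"

text \<open>\<open>Psi_crd\<close> leaves only the ends of the segment. Fixed ends give a constant
  value, and coinciding ends have equal parity, so their contributions cancel.\<close>

lemma effective_if_single:
  assumes "j < t" "a \<le> m0" "m0 < b" "b \<le> L" "\<not> const_at j m0 \<or> \<not> const_at j (Suc m0)"
    and "(\<Sum>m\<in>{m \<in> {a..<b}. same_edge j m m0}. (-1) ^ m * e) \<noteq> 0"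
    and "(const_at (Suc j) a \<and> const_at (Suc j) b) \<or> same_vertex (Suc j) a b"
  shows "effective j"
proof -
  obtain x where x: "x \<in> S" using S_ne by blast
  have ab: "a \<le> b" using assms by simp
  have "Psi f j a b y = Psi f j a b x" if "y \<in> S" for y
    using assms(7)
  proof
    assume "const_at (Suc j) a \<and> const_at (Suc j) b"
    then have "lev f x (Suc j) i = lev f y (Suc j) i" if "i \<in> {a, b}" for i
      using x \<open>y \<in> S\<close> that by (auto simp: const_at_def vertex_at_def simp del: lev.simps)
    then show ?thesis by (simp add: Psi_crd[OF ab] del: lev.simps)
  next
    assume eq: "same_vertex (Suc j) a b"
    then have "lev f z (Suc j) a = lev f z (Suc j) b" if "z \<in> S" for z
      using that by (auto simp: same_vertex_def vertex_at_def simp del: lev.simps)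
    moreover have "(-1::'a) ^ a = (-1) ^ b" using eq by (auto simp: same_vertex_def uminus_power_if)
    ultimately show ?thesis using x that by (simp add: Psi_crd[OF ab] del: lev.simps)
  qed
  moreover have "Psi f j a b x \<in> K"
    using PX.polyfun_K[OF polyfun_Psi[of f j b a]] pff assms(1,4) x SX by blast
  ultimately show ?thesis unfolding effective_def using assms(2-6) by blast
qed

section \<open>Levels whose equations are void\<close>

definition reps :: "nat \<Rightarrow> nat set" where
  "reps j = {i \<in> {..L}. \<not> const_at j i \<and> (\<forall>i'<i. \<not> same_vertex j i' i)}"

lemma finite_reps: "finite (reps j)" by (simp add: reps_def)

text \<open>Levels refine each other: constancy or coincidence at level \<open>Suc j\<close> is
  inherited by level \<open>j\<close>. So a first occurrence of a varying vertex remains one at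
  higher levels.\<close>

lemma reps_mono: "reps j \<subseteq> reps (Suc j)"
  unfolding reps_def using const_at_down same_vertex_down by blast

lemma reps_ex: "i \<le> L \<Longrightarrow> \<not> const_at j i \<Longrightarrow> \<exists>i0\<in>reps j. same_vertex j i0 i"
proof -
  assume a: "i \<le> L" "\<not> const_at j i"
  define i0 where "i0 = (LEAST i'. same_vertex j i' i)"
  have i0: "same_vertex j i0 i" unfolding i0_def by (rule LeastI[of _ i]) (rule same_vertex_refl)
  have le: "i0 \<le> i" unfolding i0_def by (rule Least_le) (rule same_vertex_refl)
  have "\<not> same_vertex j i' i0" if "i' < i0" for i'
    using not_less_Least[of i' "\<lambda>i'. same_vertex j i' i"] that i0 same_vertex_trans unfolding i0_def by blast
  moreover have "\<not> const_at j i0" using a i0 same_vertex_const_at by blast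
  ultimately have "i0 \<in> reps j" using le a(1) by (simp add: reps_def)
  then show ?thesis using i0 by blast
qed

lemma sign_e_nonzero: "(-1) ^ m * e \<noteq> 0"
  using e0 by (cases "even m") auto

text \<open>If the constraint of the whole walk is void, every nonconstant edge is traversed at least twice.\<close>

lemma not_effective_card_reps:
  assumes "j < t" "\<not> effective j"
  shows "2 * card (reps j) \<le> L"
proof -
  \<comment> \<open>\<open>i - 1\<close> is the edge along which the vertex at \<open>i\<close> is
    first reached; \<open>i\<close> is positive because vertex \<open>0\<close> is constant.\<close>
  define M where "M i = {m \<in> {0..<L}. same_edge j m (i - 1)}" for i
  have pos: "0 < i" "i \<le> L" if "i \<in> reps j" for i
    using that const_at_0[of j] by (auto simp: reps_def intro: gr0I)
  \<comment> \<open>An edge traversed once has coefficient \<open>e\<close> or \<open>- e\<close>,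
    and the whole walk, whose ends are fixed, would make the level effective.\<close>
  have two: "2 \<le> card (M i)" if i: "i \<in> reps j" for i
  proof (rule ccontr)
    assume "\<not> 2 \<le> card (M i)"
    moreover have mem: "i - 1 \<in> M i" using pos[OF i] by (auto simp: M_def same_edge_def)
    moreover have "finite (M i)" by (simp add: M_def)
    ultimately have "M i = {i - 1}"
      using card_le_Suc0_iff_eq[of "M i"] by auto
    then have "(\<Sum>m\<in>{m \<in> {0..<L}. same_edge j m (i - 1)}. (-1) ^ m * e) \<noteq> 0"
      unfolding M_def using sign_e_nonzero by simp
    moreover have "\<not> const_at j (Suc (i - 1))" using i pos[OF i] by (simp add: reps_def)
    ultimately have "effective j"
      using pos[OF i] const_at_0 const_at_L[of "Suc j"] assms(1) by (intro effective_if_single[of j 0 "i - 1" L]) auto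
    then show False using assms(2) by simp
  qed
  \<comment> \<open>If two first-arrival edges coincided, the later vertex would already occur at
    \<open>i\<close> or at \<open>i - 1\<close>.\<close>
  have disj: "M i \<inter> M i' = {}" if "i \<in> reps j" "i' \<in> reps j" "i < i'" for i i'
  proof (rule ccontr)
    assume "M i \<inter> M i' \<noteq> {}"
    then have "same_edge j (i - 1) (i' - 1)" by (auto simp: M_def same_edge_def)
    then have "same_vertex j i i' \<or> same_vertex j (i - 1) i'"
      using pos[OF that(1)] pos[OF that(2)] by (auto simp: same_edge_iff split: if_splits)
    then show False using that by (auto simp: reps_def)
  qed
  have "2 * card (reps j) = (\<Sum>i\<in>reps j. 2)" by simp
  also have "\<dots> \<le> (\<Sum>i\<in>reps j. card (M i))" using two by (intro sum_mono) auto
  also have "\<dots> = card (\<Union>i\<in>reps j. M i)"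
  proof (rule card_UN_disjoint[symmetric])
    show "\<forall>i\<in>reps j. \<forall>i'\<in>reps j. i \<noteq> i' \<longrightarrow> M i \<inter> M i' = {}"
      using disj by (metis Int_commute linorder_neqE_nat)
  qed (auto simp: finite_reps M_def)
  also have "\<dots> \<le> card {0..<L}" by (rule card_mono) (auto simp: M_def)
  finally show ?thesis by simp
qed

text \<open>Among the segments with nonconstant interior whose two ends are both constant or coincide, a shortest one
  traverses its first edge only once. Its constraint is therefore not void.\<close>

lemma not_effective_reps_grows:
  assumes j: "j < t" "\<not> effective j" and ne: "reps j \<noteq> {}"
  shows "reps j \<noteq> reps (Suc j)"
proof
  assume same: "reps j = reps (Suc j)"
  \<comment> \<open>Without new representatives, constancy and the coincidence of varying vertices
    pass from level \<open>j\<close> up to \<open>Suc j\<close>, where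
    \<open>effective_if_single\<close> needs them.\<close>
  have const_at_up: "const_at (Suc j) i" if i: "const_at j i" "i \<le> L" for i
  proof (rule ccontr)
    assume "\<not> const_at (Suc j) i"
    then obtain i0 where i0: "i0 \<in> reps (Suc j)" "same_vertex (Suc j) i0 i" using reps_ex i(2) by blast
    then have "i0 \<in> reps j" using same by simp
    then have "\<not> const_at j i0" by (simp add: reps_def)
    then show False using same_vertex_const_at[OF same_vertex_down[OF i0(2)]] i(1) by simp
  qed
  have same_vertex_up: "same_vertex (Suc j) a b" if ab: "same_vertex j a b" "\<not> const_at j a" "a \<le> L" "b \<le> L" for a b
  proof -
    have "\<not> const_at j b" using ab same_vertex_const_at by blast
    then have "\<not> const_at (Suc j) a" "\<not> const_at (Suc j) b" using ab const_at_down by blast+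
    then obtain ra rb where ra: "ra \<in> reps (Suc j)" "same_vertex (Suc j) ra a" and rb: "rb \<in> reps (Suc j)" "same_vertex (Suc j) rb b"
      using reps_ex[OF ab(3)] reps_ex[OF ab(4)] by blast
    have eq: "same_vertex j ra rb"
      by (rule same_vertex_trans[OF same_vertex_down[OF ra(2)] same_vertex_trans[OF ab(1) same_vertex_sym[OF same_vertex_down[OF rb(2)]]]])
    have "ra \<in> reps j" "rb \<in> reps j" using ra(1) rb(1) same by auto
    then have "\<not> ra < rb" "\<not> rb < ra" using eq same_vertex_sym[OF eq] by (auto simp: reps_def)
    then have "ra = rb" by simp
    then show ?thesis using same_vertex_trans[OF same_vertex_sym[OF ra(2)]] rb(2) by simp
  qed
  \<comment> \<open>The bound \<open>a + 2 \<le> b\<close> provides an interior vertex, so the first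
    edge really varies.\<close>
  define seg where "seg a b \<longleftrightarrow> a + 2 \<le> b \<and> b \<le> L \<and> (\<forall>m. a < m \<longrightarrow> m < b \<longrightarrow> \<not> const_at j m) \<and>
    ((const_at j a \<and> const_at j b) \<or> same_vertex j a b)" for a b
  obtain i0 where i0: "i0 \<le> L" "\<not> const_at j i0" using ne by (auto simp: reps_def)
  \<comment> \<open>Starting from a varying position, walk to the nearest constant vertex on either
    side. The constant ends of the walk guarantee that there is one.\<close>
  have ex: "\<exists>n a. seg a (a + n)"
  proof -
    define A where "A = Max {a. a < i0 \<and> const_at j a}"
    have finA: "finite {a. a < i0 \<and> const_at j a}" by simp
    have "0 \<in> {a. a < i0 \<and> const_at j a}" using const_at_0[of j] i0(2) by (auto intro: gr0I)
    then have "A \<in> {a. a < i0 \<and> const_at j a}" unfolding A_def by (intro Max_in[OF finA]) blast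
    then have A: "A < i0" "const_at j A" by simp_all
    have A2: "\<not> const_at j m" if "A < m" "m < i0" for m
    proof
      assume "const_at j m"
      then have "m \<le> A" unfolding A_def using that by (intro Max_ge[OF finA]) simp
      then show False using that by simp
    qed
    define B where "B = (LEAST b. i0 < b \<and> const_at j b)"
    have "i0 < L \<and> const_at j L" using const_at_L[of j] i0 j(1) by (metis le_neq_implies_less less_imp_le)
    then have B: "i0 < B" "const_at j B" "B \<le> L"
      using LeastI[of "\<lambda>b. i0 < b \<and> const_at j b" L] Least_le[of "\<lambda>b. i0 < b \<and> const_at j b" L] unfolding B_def by auto
    have B2: "\<not> const_at j m" if "i0 < m" "m < B" for m
      using not_less_Least[of m "\<lambda>b. i0 < b \<and> const_at j b"] that unfolding B_def by auto
    have "\<not> const_at j m" if "A < m" "m < B" for m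
      using A2[of m] B2[of m] i0(2) that by (metis linorder_neqE_nat)
    then have "seg A B" unfolding seg_def using A B by auto
    then have "seg A (A + (B - A))" using A B by simp
    then show ?thesis by blast
  qed
  define n where "n = (LEAST n. \<exists>a. seg a (a + n))"
  obtain a where a: "seg a (a + n)" using LeastI_ex[OF ex] unfolding n_def by blast
  define b where "b = a + n"
  have ab: "seg a b" using a by (simp add: b_def)
  have min: False if "seg c d" "d - c < b - a" for c d
  proof -
    have "seg c (c + (d - c))" using that(1) by (simp add: seg_def)
    then have "n \<le> d - c" unfolding n_def by (intro Least_le) blast
    then show False using that(2) by (simp add: b_def)
  qed
  have L: "a + 2 \<le> b" "b \<le> L" and nc: "\<And>m. a < m \<Longrightarrow> m < b \<Longrightarrow> \<not> const_at j m" and ends: "(const_at j a \<and> const_at j b) \<or> same_vertex j a b"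
    using ab by (auto simp: seg_def)
  have single: "\<not> same_edge j m a" if m: "a < m" "m < b" for m
  proof
    assume eq: "same_edge j m a"
    show False
    proof (cases "even m = even a")
      case True
      \<comment> \<open>Traversing the first edge again in the same direction closes up a shorter
        segment ending at \<open>m\<close>.\<close>
      then have "same_vertex j a m" using eq same_vertex_sym by (auto simp: same_edge_iff)
      moreover have "a + 2 \<le> m"
      proof (rule ccontr)
        assume "\<not> a + 2 \<le> m"
        then have "m = Suc a" using m by simp
        then show False using True by simp
      qed
      ultimately have "seg a m" using L m nc by (auto simp: seg_def)
      moreover have "m - a < b - a" using m by linarith
      ultimately show False by (rule min)
    next
      case False
      \<comment> \<open>In the opposite direction, either the walk is back at \<open>a\<close>
        before \<open>b\<close>, or \<open>b = Suc m\<close> and the part from \<open>Suc a\<close>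
        to \<open>m\<close> is a shorter segment. Here \<open>m = Suc a\<close> would be
        backtracking, and \<open>m = Suc (Suc a)\<close> has the wrong parity.\<close>
      then have eqs: "same_vertex j m (Suc a)" "same_vertex j (Suc m) a" using eq by (auto simp: same_edge_iff)
      show False
      proof (cases "Suc m < b")
        case True
        then have "seg a (Suc m)" using L m nc same_vertex_sym[OF eqs(2)] by (auto simp: seg_def)
        moreover have "Suc m - a < b - a" using True m by linarith
        ultimately show False by (rule min)
      next
        case b: False
        then have bm: "b = Suc m" using m by simp
        show False
        proof (cases "m = Suc a")
          case True
          then have "same_vertex j a (a + 2)" using eqs(2) same_vertex_sym by simp
          then show False using not_same_vertex_2[of a j] L by simp
        next
          case ne: False
          moreover have "m \<noteq> Suc (Suc a)" using eqs(1) by (auto simp: same_vertex_def)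
          ultimately have "seg (Suc a) m" using L m nc same_vertex_sym[OF eqs(1)] by (auto simp: seg_def)
          moreover have "m - Suc a < b - a" using bm m by linarith
          ultimately show False by (rule min)
        qed
      qed
    qed
  qed
  have "{m \<in> {a..<b}. same_edge j m a} = {a}"
    using single L by (auto simp: same_edge_def) (metis le_neq_implies_less)
  then have "(\<Sum>m\<in>{m \<in> {a..<b}. same_edge j m a}. (-1) ^ m * e) \<noteq> 0" using sign_e_nonzero by simp
  moreover have "\<not> const_at j (Suc a)" using nc[of "Suc a"] L by simp
  moreover have "(const_at (Suc j) a \<and> const_at (Suc j) b) \<or> same_vertex (Suc j) a b"
    using ends const_at_up[of a] const_at_up[of b] same_vertex_up[of a b] L same_vertex_const_at[of j a b] by auto
  ultimately have "effective j" using L j(1) by (intro effective_if_single[of j a a b]) auto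
  then show False using j(2) by simp
qed

lemma reps_0_nonempty: "reps 0 \<noteq> {}"
proof -
  obtain x y where xy: "x \<in> S" "y \<in> S" "x \<noteq> y"
    using S2 by (metis card_2_iff' card_le_Suc0_iff_eq finS not_less_eq_eq numeral_2_eq_2)
  have "fst x \<noteq> fst y" using snd_eq[OF xy(1,2)] xy(3) by (auto simp: prod_eq_iff)
  then obtain i where i: "fst x i \<noteq> fst y i" by blast
  have "i \<le> L"
  proof (rule ccontr)
    assume "\<not> i \<le> L"
    then have "fst x i = (\<lambda>_. 0)" "fst y i = (\<lambda>_. 0)" using xy SX by (auto simp: \<Omega>_def)
    then show False using i by simp
  qed
  moreover have "\<not> const_at 0 i" using i xy by (auto simp: const_at_def vertex_at_def)
  ultimately show ?thesis using reps_ex by blast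
qed

text \<open>The number of label coordinates that vary in \<open>S\<close>, which bounds the
  dimension at the start of the chain.\<close>

definition N :: nat where "N = (\<Sum>i\<in>reps 0. rho i)"

lemma sum_rho: "(\<Sum>i\<in>{1..<L}. rho i) = t"
proof -
  have "(\<Sum>i\<in>{1..<2 * n + 1}. rho i) = n * (r + r')" for n
    by (induction n) (auto simp: rho_def)
  moreover have "L = 2 * (k - 1) + 1" using k2 unfolding L_def by linarith
  ultimately show ?thesis by (simp only: t_def)
qed

text \<open>Every inner vertex that is not a representative takes at least one of the
  \<open>t\<close> coordinates away from \<open>N\<close>, which leaves room for
  \<open>2 * k - 2 - card (reps 0)\<close> void levels. Void levels have pairwise different numbers
  of representatives between \<open>card (reps 0)\<close> and \<open>k - 1\<close>, so there are at
  most \<open>k - card (reps 0)\<close> of them.\<close>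

lemma not_effective_count: "card {j \<in> {..<t}. \<not> effective j} + N \<le> t"
proof -
  define Z where "Z = {j \<in> {..<t}. \<not> effective j}"
  have R0: "reps 0 \<subseteq> {1..<L}"
  proof
    fix i assume i: "i \<in> reps 0"
    then have "i \<le> L" "\<not> const_at 0 i" by (auto simp: reps_def)
    moreover from this have "i \<noteq> 0" "i \<noteq> L" using const_at_0[of 0] const_at_L[OF le0] by metis+
    ultimately show "i \<in> {1..<L}" by auto
  qed
  have "N + (L - 1 - card (reps 0)) \<le> t"
  proof -
    have "L - 1 - card (reps 0) = card ({1..<L} - reps 0)" using R0 by (simp add: card_Diff_subset finite_reps)
    also have "\<dots> = (\<Sum>i\<in>{1..<L} - reps 0. 1)" by simp
    also have "\<dots> \<le> (\<Sum>i\<in>{1..<L} - reps 0. rho i)" using r1 r'1 by (intro sum_mono) (auto simp: rho_def)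
    finally have "N + (L - 1 - card (reps 0)) \<le> (\<Sum>i\<in>{1..<L} - reps 0. rho i) + (\<Sum>i\<in>reps 0. rho i)"
      by (simp add: N_def)
    also have "\<dots> = t" using R0 sum_rho by (metis finite_atLeastLessThan sum.subset_diff)
    finally show ?thesis .
  qed
  moreover have "card Z + card (reps 0) \<le> k" if "Z \<noteq> {}"
  proof -
    have mono: "reps i \<subseteq> reps j" if "i \<le> j" for i j
      using that by (induction j rule: dec_induct) (use reps_mono in auto)
    have ne: "reps j \<noteq> {}" for j using mono[of 0 j] reps_0_nonempty by auto
    have lt: "card (reps i) < card (reps j)" if "i \<in> Z" "i < j" for i j
    proof -
      have "reps i \<subset> reps (Suc i)" using not_effective_reps_grows[OF _ _ ne] reps_mono[of i] that(1) by (auto simp: Z_def)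
      then have "reps i \<subset> reps j" using mono[of "Suc i" j] that(2) by auto
      then show ?thesis using finite_reps by (rule psubset_card_mono[rotated])
    qed
    have inj: "inj_on (\<lambda>j. card (reps j)) Z"
      by (rule inj_onI) (metis lt linorder_neqE_nat less_irrefl)
    have sub: "(\<lambda>j. card (reps j)) ` Z \<subseteq> {card (reps 0)..k - 1}"
    proof clarify
      fix j assume "j \<in> Z"
      then have "2 * card (reps j) \<le> L" using not_effective_card_reps by (auto simp: Z_def)
      then have "card (reps j) \<le> k - 1" unfolding L_def by linarith
      moreover have "card (reps 0) \<le> card (reps j)" using mono[of 0 j] finite_reps by (simp add: card_mono)
      ultimately show "card (reps j) \<in> {card (reps 0)..k - 1}" by simp
    qed
    have "card Z \<le> card {card (reps 0)..k - 1}" using card_inj_on_le[OF inj sub] by simp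
    moreover have "card (reps 0) \<le> k - 1" using sub that by (auto simp: subset_iff)
    ultimately show ?thesis using k2 by simp
  qed
  ultimately show ?thesis unfolding Z_def[symmetric]
    using k2 by (cases "Z = {}") (auto simp: L_def)
qed

end

section \<open>Bounding the number of walks\<close>

context clean_walks begin

text \<open>At level 0 a vertex is only its label, so this points to the first position on the same
  side with the same label throughout \<open>S\<close>.\<close>

definition rp0 :: "nat \<Rightarrow> nat" where "rp0 = restrict (\<lambda>i. LEAST i'. same_vertex 0 i' i) {..L}"

lemma rp0: "i \<le> L \<Longrightarrow> same_vertex 0 (rp0 i) i" "i \<le> L \<Longrightarrow> rp0 i \<le> i" "i \<le> L \<Longrightarrow> \<not> const_at 0 i \<Longrightarrow> rp0 i \<in> reps 0"
proof -
  assume i: "i \<le> L"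
  show 1: "same_vertex 0 (rp0 i) i" using i LeastI[of "\<lambda>i'. same_vertex 0 i' i" i] same_vertex_refl by (simp add: rp0_def)
  show 2: "rp0 i \<le> i" using i Least_le[of "\<lambda>i'. same_vertex 0 i' i" i] same_vertex_refl by (simp add: rp0_def)
  assume "\<not> const_at 0 i"
  then have "\<not> const_at 0 (rp0 i)" using 1 same_vertex_const_at by blast
  moreover have "\<not> same_vertex 0 i' (rp0 i)" if "i' < rp0 i" for i'
  proof
    assume "same_vertex 0 i' (rp0 i)"
    then have "same_vertex 0 i' i" using 1 same_vertex_trans by blast
    then show False using not_less_Least[of i' "\<lambda>i'. same_vertex 0 i' i"] that i by (simp add: rp0_def)
  qed
  ultimately show "rp0 i \<in> reps 0" using 2 i by (simp add: reps_def)
qed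

text \<open>Constant labels contribute constants and every other label copies that of a
  representative, so \<open>card_restr_le\<close> needs at most \<open>N\<close>
  coordinates.\<close>

lemma chain_start:
  obtains S0 where "S0 \<in> family f 0" "S \<subseteq> S0" "card (PX.restr S0 D) \<le> q ^ ((D + 1) ^ N)"
proof -
  obtain x0 where x0: "x0 \<in> S" using S_ne by blast
  define I where "I = {i \<in> {..L}. const_at 0 i}"
  define S0 where "S0 = base I rp0 x0"
  have rpPi: "rp0 \<in> {..L} \<rightarrow>\<^sub>E {..L}"
  proof (rule PiE_I)
    fix i assume "i \<in> {..L}"
    then show "rp0 i \<in> {..L}" using rp0(2)[of i] by simp
  next
    fix i assume "i \<notin> {..L}"
    then show "rp0 i = undefined" by (simp add: rp0_def)
  qed
  have family: "S0 \<in> family f 0"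
    unfolding family.simps S0_def using rpPi x0 SX
    by (intro image_eqI[of _ _ "(I, rp0, x0)"]) (auto simp: I_def)
  have sub: "S \<subseteq> S0"
  proof
    fix x assume x: "x \<in> S"
    have "fst x i = fst x0 i" if "i \<in> I" for i
    proof -
      have "vertex_at f 0 i x = vertex_at f 0 i x0" using that x x0 unfolding I_def const_at_def by blast
      then show ?thesis by (simp add: vertex_at_def)
    qed
    moreover have "fst x i = fst x (rp0 i)" if "i \<le> L" for i
    proof -
      have "vertex_at f 0 (rp0 i) x = vertex_at f 0 i x" using rp0(1)[OF that] x unfolding same_vertex_def by blast
      then show ?thesis by (simp add: vertex_at_def)
    qed
    ultimately show "x \<in> S0" using subsetD[OF SX x] snd_eq[OF x x0] unfolding S0_def base_def by blast
  qed
  define \<Delta> :: "('a walk \<Rightarrow> 'a) set" where "\<Delta> = (\<lambda>(i, c) x. fst x i c) ` Sigma (reps 0) (\<lambda>i. {..<rho i})"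
  have "card (PX.restr S0 D) \<le> q ^ ((D + 1) ^ card \<Delta>)"
  proof (rule PX.card_restr_le)
    show "S0 \<subseteq> \<Omega>" by (auto simp: S0_def base_def)
    show "finite \<Delta>" by (simp add: \<Delta>_def finite_reps)
    show "\<Delta> \<subseteq> GX" by (auto simp: \<Delta>_def GX_def reps_def)
    fix g assume "g \<in> GX"
    then consider i c where "i \<le> L" "c < rho i" "g = (\<lambda>x. fst x i c)" | c where "c < t" "g = (\<lambda>x. snd x c)"
      by (auto simp: GX_def)
    then show "(\<exists>c\<in>K. \<forall>x\<in>S0. g x = c) \<or> (\<exists>h\<in>\<Delta>. \<forall>x\<in>S0. g x = h x)"
    proof cases
      case (1 i c)
      show ?thesis
      proof (cases "const_at 0 i")
        case True
        have "fst x0 i c \<in> K" using x0 SX 1 by (auto simp: \<Omega>_def lab_def)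
        moreover have "\<forall>x\<in>S0. g x = fst x0 i c" using True 1 by (auto simp: S0_def base_def I_def)
        ultimately show ?thesis by blast
      next
        case False
        have "rho (rp0 i) = rho i" using rp0(1)[OF 1(1)] by (auto simp: same_vertex_def rho_def)
        then have "(\<lambda>x. fst x (rp0 i) c) \<in> \<Delta>" unfolding \<Delta>_def
          using rp0(3)[OF 1(1) False] 1 by (intro image_eqI[of _ _ "(rp0 i, c)"]) auto
        moreover have "\<forall>x\<in>S0. g x = fst x (rp0 i) c"
        proof
          fix x assume "x \<in> S0"
          then have "fst x i = fst x (rp0 i)" using 1(1) by (simp add: S0_def base_def)
          then show "g x = fst x (rp0 i) c" using 1(3) by simp
        qed
        ultimately show ?thesis by (intro disjI2 bexI[of _ "\<lambda>x. fst x (rp0 i) c"])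
      qed
    next
      case (2 c)
      have "snd x0 c \<in> K" using x0 SX 2 by (auto simp: \<Omega>_def lab_def)
      moreover have "\<forall>x\<in>S0. g x = snd x0 c" using 2 by (auto simp: S0_def base_def)
      ultimately show ?thesis by blast
    qed
  qed
  also have "\<dots> \<le> q ^ ((D + 1) ^ N)"
  proof -
    have "card \<Delta> \<le> card (Sigma (reps 0) (\<lambda>i. {..<rho i}))"
      unfolding \<Delta>_def by (rule card_image_le) (simp add: finite_reps)
    also have "\<dots> = N" by (simp add: N_def finite_reps)
    finally show ?thesis using q_ge_2 by (intro power_increasing) auto
  qed
  finally show ?thesis using family sub that by blast
qed

lemma nn2: "2 \<le> nn" by (simp add: nn_def)

lemma Bt1: "1 \<le> Bt" by (simp add: Bt_def Suc_le_eq)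

lemma dl1: "1 \<le> dl" using dE1 by (simp add: dl_def)

text \<open>One atom contains at least the fraction \<open>1 / Bt\<close> of \<open>S'\<close>. At
  an effective level these walks also satisfy an equation which, by goodness, is not an identity on
  the atom, so \<open>irr_cut\<close> applies.\<close>

lemma chain_step:
  assumes good: "good f j" and j: "j < t" and Sj: "Sj \<in> family f j" and S': "S' \<subseteq> S" "S' \<subseteq> Sj" "2 * Bt \<le> card S'"
  obtains A S'' where "A \<in> family f (Suc j)" "S'' \<subseteq> S'" "S'' \<subseteq> A" "card S' \<le> card S'' * Bt"
    "A \<subseteq> Sj" "effective j \<longrightarrow> (\<exists>B. B \<in> family f (Suc j) \<and> S'' \<subseteq> B \<and>
       (\<forall>d n. n * dl \<le> d \<longrightarrow> d \<le> DD \<longrightarrow> card (PX.restr B (d - n * dl)) ^ n \<le> card (PX.restr Sj d)))"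
proof -
  have SjX: "Sj \<subseteq> \<Omega>" using family_sub[OF Sj] .
  have finS': "finite S'" using S'(1) finS finite_subset by blast
  have neS': "S' \<noteq> {}" using S'(3) Bt1 by auto
  have cover: "Sj \<subseteq> (\<Union>A\<in>atoms f j Sj. A)"
  proof
    fix x assume x: "x \<in> Sj"
    have "{y \<in> Sj. edge_pattern f j y = edge_pattern f j x} \<subseteq> \<Omega>" using SjX by auto
    from parts(3)[OF this] obtain A where "A \<in> parts {y \<in> Sj. edge_pattern f j y = edge_pattern f j x}" "x \<in> A" using x by blast
    moreover have "edge_pattern f j x \<in> Pow ({..<L} \<times> {..<L})" by (auto simp: edge_pattern_def)
    ultimately show "x \<in> (\<Union>A\<in>atoms f j Sj. A)" unfolding atoms_def by blast
  qed
  obtain A where A: "A \<in> atoms f j Sj" "card S' \<le> card (S' \<inter> A) * Bt"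
    using pigeonhole_cover[of "atoms f j Sj" Bt S' "\<lambda>A. A"] card_atoms[OF SjX] finS' neS' cover S'(2) by blast
  define S'' where "S'' = S' \<inter> A"
  have "2 * Bt \<le> card S'' * Bt" unfolding S''_def by (rule le_trans[OF S'(3) A(2)])
  then have S''2: "2 \<le> card S''" using Bt1 by simp
  have finS'': "finite S''" using finS' by (simp add: S''_def)
  obtain x1 y1 where xy: "x1 \<in> S''" "y1 \<in> S''" "x1 \<noteq> y1"
    using S''2 card_le_Suc0_iff_eq[OF finS''] by (metis not_less_eq_eq numeral_2_eq_2)
  have ASj: "A \<subseteq> Sj" using atoms_sub[OF SjX A(1)] .
  obtain \<pi> where \<pi>: "A \<in> parts {x \<in> Sj. edge_pattern f j x = \<pi>}" using A(1) by (auto simp: atoms_def)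
  have sX: "{x \<in> Sj. edge_pattern f j x = \<pi>} \<subseteq> \<Omega>" using SjX by auto
  have irr: "PX.irr DD A" using parts(4)[OF sX \<pi>] .
  have "A \<subseteq> {x \<in> Sj. edge_pattern f j x = \<pi>}" using parts(3)[OF sX] \<pi> by blast
  then have edge_pattern: "edge_pattern f j x = \<pi>" if "x \<in> A" for x using that by blast
  have famA: "insert A ((\<lambda>(a, b, w). {x \<in> A. Psi f j a b x = w}) ` ({..L} \<times> {..L} \<times> K)) \<subseteq> family f (Suc j)"
    unfolding family.simps using Sj A(1) by blast
  have "\<exists>B. B \<in> family f (Suc j) \<and> S'' \<subseteq> B \<and>
       (\<forall>d n. n * dl \<le> d \<longrightarrow> d \<le> DD \<longrightarrow> card (PX.restr B (d - n * dl)) ^ n \<le> card (PX.restr Sj d))" if "effective j"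
  proof -
    from that obtain a b m0 w where ab: "a \<le> m0" "m0 < b" "b \<le> L" "\<not> const_at j m0 \<or> \<not> const_at j (Suc m0)"
      "(\<Sum>m\<in>{m \<in> {a..<b}. same_edge j m m0}. (-1) ^ m * e) \<noteq> 0" "w \<in> K" "\<forall>x\<in>S. Psi f j a b x = w"
      unfolding effective_def by blast
    have x1: "x1 \<in> S" "x1 \<in> A" "y1 \<in> S" "y1 \<in> A" using xy S'(1) by (auto simp: S''_def)
    \<comment> \<open>The whole atom shares the edge pattern of \<open>x1\<close>, which lies in
      \<open>S\<close>, so the coefficient found from \<open>same_edge\<close> is valid on all of
      it.\<close>
    have "edge_coeff f j a b m0 x \<noteq> 0" if "x \<in> A" for x
    proof -
      have "edge_at f j x m = edge_at f j x m0 \<longleftrightarrow> same_edge j m m0" if m: "m \<in> {a..<b}" for m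
      proof -
        have "(m, m0) \<in> edge_pattern f j x \<longleftrightarrow> (m, m0) \<in> edge_pattern f j x1" using edge_pattern \<open>x \<in> A\<close> x1 by simp
        then have "edge_at f j x m = edge_at f j x m0 \<longleftrightarrow> edge_at f j x1 m = edge_at f j x1 m0"
          using m ab by (simp add: edge_pattern_def)
        then show ?thesis using same_edge_uni[of j m m0 x1] m ab x1 j by simp
      qed
      then have "{m \<in> {a..<b}. edge_at f j x m = edge_at f j x m0} = {m \<in> {a..<b}. same_edge j m m0}" by blast
      then show ?thesis using ab(5) by (simp add: edge_coeff_def)
    qed
    moreover have "\<exists>x\<in>A. \<exists>y\<in>A. edge_at f j x m0 \<noteq> edge_at f j y m0"
      using edge_at_nonconst[of j m0 x1 y1] ab x1 xy(3) j by auto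
    ultimately have nz: "\<exists>x\<in>A. Psi f j a b x \<noteq> w"
      using good Sj A(1) ab(1-3,6) unfolding good_def by blast
    define B where "B = {x \<in> A. Psi f j a b x = w}"
    have "B \<in> family f (Suc j)" unfolding B_def
      using ab by (intro subsetD[OF famA] insertI2 image_eqI[of _ _ "(a, b, w)"]) auto
    moreover have "S'' \<subseteq> B" using ab(7) S'(1) by (auto simp: B_def S''_def)
    moreover have "card (PX.restr B (d - n * dl)) ^ n \<le> card (PX.restr Sj d)" if "n * dl \<le> d" "d \<le> DD" for d n
    proof -
      have pfg: "polyfun GX dl (\<lambda>x. Psi f j a b x - w)"
        using polyfun_Psi[of f j b a] pff j ab by (intro polyfun_diff polyfun_const) auto
      have "\<exists>x\<in>A. Psi f j a b x - w \<noteq> 0" using nz by auto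
      then have "card (PX.restr {x \<in> A. Psi f j a b x - w = 0} (d - n * dl)) ^ n \<le> card (PX.restr A d)"
        using that irr ASj SjX by (intro PX.irr_cut[OF _ _ pfg, where D = DD]) (auto simp: DD_def)
      also have "{x \<in> A. Psi f j a b x - w = 0} = B" by (auto simp: B_def)
      also have "card (PX.restr A d) \<le> card (PX.restr Sj d)" using ASj SjX by (rule PX.card_restr_mono)
      finally show ?thesis .
    qed
    ultimately show ?thesis by blast
  qed
  then show thesis using that[of A S''] famA A(2) ASj unfolding S''_def by blast
qed

lemma N_le_card_effective: "N \<le> card {j \<in> {..<t}. effective j}"
proof -
  have "card {j \<in> {..<t}. effective j} + card {j \<in> {..<t}. \<not> effective j} = card {..<t}"
  proof (subst card_Un_disjoint[symmetric])
    have "{j \<in> {..<t}. effective j} \<union> {j \<in> {..<t}. \<not> effective j} = {..<t}" by blast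
    then show "card ({j \<in> {..<t}. effective j} \<union> {j \<in> {..<t}. \<not> effective j}) = card {..<t}" by simp
  qed auto
  then show ?thesis using not_effective_count by simp
qed

lemma N_le_t: "N \<le> t" using not_effective_count by simp

text \<open>\<open>i\<close> is the number of cuts made. Each cut costs \<open>nn * dl\<close> in
  degree and gains an \<open>nn\<close>-th power, against a right-hand side fixed by
  \<open>chain_start\<close>. Stopping at \<open>N \<le> t\<close> cuts keeps the degree
  positive.\<close>

lemma chain:
  assumes good: "\<And>j. j < t \<Longrightarrow> good f j" and big: "nn * Bt ^ t \<le> card S" and "j \<le> t"
  shows "\<exists>Sj S'. Sj \<in> family f j \<and> S' \<subseteq> S \<and> S' \<subseteq> Sj \<and> card S \<le> card S' * Bt ^ j \<and>
    (let i = min N (card {j' \<in> {..<j}. effective j'}) in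
      card (PX.restr Sj ((t + 1 - i) * dl * nn)) ^ (nn ^ i) \<le> q ^ ((nn * cc + 1) ^ N))"
  using assms(3)
proof (induction j)
  case 0
  obtain S0 where S0: "S0 \<in> family f 0" "S \<subseteq> S0" "card (PX.restr S0 (nn * cc)) \<le> q ^ ((nn * cc + 1) ^ N)"
    using chain_start by blast
  have d: "(t + 1 - 0) * dl * nn = nn * cc" by (simp add: cc_def)
  have i: "min N (card {j' \<in> {..<0}. effective j'}) = 0" by simp
  show ?case unfolding Let_def i d power_0 power_one_right
    by (rule exI[of _ S0], rule exI[of _ S]) (use S0 in simp)
next
  case (Suc j)
  define i where "i = min N (card {j' \<in> {..<j}. effective j'})"
  obtain Sj S' where IH: "Sj \<in> family f j" "S' \<subseteq> S" "S' \<subseteq> Sj" "card S \<le> card S' * Bt ^ j"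
    "card (PX.restr Sj ((t + 1 - i) * dl * nn)) ^ (nn ^ i) \<le> q ^ ((nn * cc + 1) ^ N)"
    using Suc.IH[OF Suc_leD[OF Suc.prems]] unfolding i_def Let_def by blast
  have "(nn * Bt) * Bt ^ j = nn * Bt ^ Suc j" by simp
  also have "\<dots> \<le> nn * Bt ^ t" using Suc.prems Bt1 by (intro mult_le_mono2 power_increasing) auto
  also have "\<dots> \<le> card S' * Bt ^ j" using big IH(4) by (rule le_trans)
  finally have "nn * Bt \<le> card S'" using Bt1 by simp
  then have S'2: "2 * Bt \<le> card S'" using nn2 mult_le_mono1 le_trans by blast
  have j: "j < t" using Suc.prems by simp
  from chain_step[OF good[OF j] j IH(1,2,3) S'2]
  obtain A S'' where A: "A \<in> family f (Suc j)" "S'' \<subseteq> S'" "S'' \<subseteq> A" "card S' \<le> card S'' * Bt" "A \<subseteq> Sj"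
    "effective j \<longrightarrow> (\<exists>B. B \<in> family f (Suc j) \<and> S'' \<subseteq> B \<and>
       (\<forall>d n. n * dl \<le> d \<longrightarrow> d \<le> DD \<longrightarrow> card (PX.restr B (d - n * dl)) ^ n \<le> card (PX.restr Sj d)))" .
  have cS: "card S \<le> card S'' * Bt ^ Suc j"
  proof -
    have "card S \<le> card S' * Bt ^ j" by (rule IH(4))
    also have "\<dots> \<le> (card S'' * Bt) * Bt ^ j" using A(4) by (rule mult_le_mono1)
    finally show ?thesis by (simp add: mult.assoc)
  qed
  have S''S: "S'' \<subseteq> S" using A(2) IH(2) by auto
  have effective_Suc: "{j' \<in> {..<Suc j}. effective j'} = (if effective j then insert j {j' \<in> {..<j}. effective j'} else {j' \<in> {..<j}. effective j'})"
    by (auto simp: less_Suc_eq)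
  define i' where "i' = min N (card {j' \<in> {..<Suc j}. effective j'})"
  have "\<exists>B. B \<in> family f (Suc j) \<and> S'' \<subseteq> B \<and>
      card (PX.restr B ((t + 1 - i') * dl * nn)) ^ (nn ^ i') \<le> q ^ ((nn * cc + 1) ^ N)"
  proof (cases "effective j \<and> i < N")
    case True
    then have i': "i' = Suc i" unfolding i'_def i_def effective_Suc by (simp add: min_def split: if_splits)
    obtain B where B: "B \<in> family f (Suc j)" "S'' \<subseteq> B"
      "\<forall>d n. n * dl \<le> d \<longrightarrow> d \<le> DD \<longrightarrow> card (PX.restr B (d - n * dl)) ^ n \<le> card (PX.restr Sj d)"
      using A(6) True by blast
    let ?d = "(t + 1 - i) * dl * nn"
    have it: "i < t" using True N_le_t by simp
    obtain u where u: "t + 1 - i = Suc u" "t + 1 - i' = u" using i' it that[of "t - i"] by simp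
    have "nn * dl \<le> ?d" unfolding u by simp
    moreover have "?d \<le> DD"
    proof -
      have "?d \<le> (t + 1) * dl * nn" by (intro mult_le_mono1) simp
      also have "\<dots> \<le> DD" by (simp add: DD_def cc_def)
      finally show ?thesis .
    qed
    ultimately have "card (PX.restr B (?d - nn * dl)) ^ nn \<le> card (PX.restr Sj ?d)" using B(3) by blast
    moreover have "?d - nn * dl = (t + 1 - i') * dl * nn" unfolding u by (simp add: algebra_simps)
    ultimately have "card (PX.restr B ((t + 1 - i') * dl * nn)) ^ nn \<le> card (PX.restr Sj ?d)" by simp
    then have "(card (PX.restr B ((t + 1 - i') * dl * nn)) ^ nn) ^ (nn ^ i) \<le> card (PX.restr Sj ?d) ^ (nn ^ i)"
      by (rule power_mono) simp
    also have "\<dots> \<le> q ^ ((nn * cc + 1) ^ N)" by (rule IH(5))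
    finally have "card (PX.restr B ((t + 1 - i') * dl * nn)) ^ (nn ^ i') \<le> q ^ ((nn * cc + 1) ^ N)"
      by (simp add: i' power_mult)
    then show ?thesis using B by blast
  next
    case False
    then have i': "i' = i" unfolding i'_def i_def effective_Suc by (auto simp: min_def split: if_splits)
    have "card (PX.restr A ((t + 1 - i) * dl * nn)) \<le> card (PX.restr Sj ((t + 1 - i) * dl * nn))"
      using A(5) family_sub[OF IH(1)] by (rule PX.card_restr_mono)
    then have "card (PX.restr A ((t + 1 - i) * dl * nn)) ^ (nn ^ i) \<le> card (PX.restr Sj ((t + 1 - i) * dl * nn)) ^ (nn ^ i)"
      by (rule power_mono) simp
    then show ?thesis using IH(5) A unfolding i' by (intro exI[of _ A]) simp
  qed
  then show ?case using S''S cS unfolding Let_def i'_def[symmetric] by blast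
qed

text \<open>If \<open>nn\<close> walks survived all levels, interpolation would give
  \<open>q ^ nn\<close> functions. The bound from the chain would then read
  \<open>nn * nn ^ N \<le> (nn * cc + 1) ^ N\<close>, which forces
  \<open>nn \<le> (cc + 1) ^ t\<close>.\<close>

theorem card_clean:
  assumes good: "\<And>j. j < t \<Longrightarrow> good f j"
  shows "card S < nn * Bt ^ t"
proof (rule ccontr)
  assume "\<not> card S < nn * Bt ^ t"
  then have big: "nn * Bt ^ t \<le> card S" by simp
  have mn: "min N (card {j' \<in> {..<t}. effective j'}) = N" using N_le_card_effective by simp
  obtain St S' where St: "St \<in> family f t" "S' \<subseteq> S" "S' \<subseteq> St" "card S \<le> card S' * Bt ^ t"
    "card (PX.restr St ((t + 1 - N) * dl * nn)) ^ (nn ^ N) \<le> q ^ ((nn * cc + 1) ^ N)"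
    using chain[OF good big order.refl] unfolding mn Let_def by blast
  have StX: "St \<subseteq> \<Omega>" using family_sub[OF St(1)] .
  have "nn * Bt ^ t \<le> card S' * Bt ^ t" using big St(4) by (rule le_trans)
  then have "nn \<le> card S'" using Bt1 by simp
  also have "\<dots> \<le> card St" using St(3) StX PX.fin_sub by (intro card_mono) auto
  finally have "q ^ nn \<le> card (PX.restr St nn)" using PX.card_restr_ge[OF X_sep StX] by blast
  also have "\<dots> \<le> card (PX.restr St ((t + 1 - N) * dl * nn))"
    using N_le_t dl1 by (intro PX.card_restr_mono_degree StX) (simp add: Suc_le_eq)
  finally have "(q ^ nn) ^ (nn ^ N) \<le> card (PX.restr St ((t + 1 - N) * dl * nn)) ^ (nn ^ N)"
    by (rule power_mono) simp
  also have "\<dots> \<le> q ^ ((nn * cc + 1) ^ N)" by (rule St(5))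
  finally have "q ^ (nn * nn ^ N) \<le> q ^ ((nn * cc + 1) ^ N)" by (simp add: power_mult)
  then have "nn * nn ^ N \<le> (nn * cc + 1) ^ N" using q_ge_2 by (simp add: power_increasing_iff)
  also have "\<dots> \<le> (nn * (cc + 1)) ^ N" using nn2 by (intro power_mono) auto
  also have "\<dots> = (cc + 1) ^ N * nn ^ N" by (simp only: power_mult_distrib mult.commute)
  finally have "nn \<le> (cc + 1) ^ N" using nn2 by simp
  also have "\<dots> \<le> (cc + 1) ^ t" using N_le_t by (intro power_increasing) auto
  finally show False by (simp add: nn_def)
qed

end

section \<open>Reduction to uniform families\<close>

context tower begin

text \<open>The summand 3 exceeds the number of truth values, so no Boolean function is injective on
  a set of size \<open>m0\<close>. The powers in \<open>m1\<close> and \<open>CV\<close> compensate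
  the losses in two rounds of thinning.\<close>

definition m0 :: nat where "m0 = nn * Bt ^ t + 3"
definition m1 :: nat where "m1 = m0 ^ (2 ^ ((t + 1) * ((L + 1) * (L + 1))))"
definition CV :: nat where "CV = m1 ^ (2 ^ ((t + 1) * (L + 1)))"

theorem card_walks:
  assumes pff: "\<And>j. j < t \<Longrightarrow> polyfun GE dE (f j)" and good: "\<And>j. j < t \<Longrightarrow> good f j"
    and VX: "V \<subseteq> \<Omega>"
    and snd_eq: "\<And>x y. x \<in> V \<Longrightarrow> y \<in> V \<Longrightarrow> snd x = snd y"
    and start_eq: "\<And>x y. x \<in> V \<Longrightarrow> y \<in> V \<Longrightarrow> fst x 0 = fst y 0"
    and end_eq: "\<And>x y. x \<in> V \<Longrightarrow> y \<in> V \<Longrightarrow> vertex_at f t L x = vertex_at f t L y"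
    and nonback: "\<And>x i. x \<in> V \<Longrightarrow> i + 2 \<le> L \<Longrightarrow> fst x i \<noteq> fst x (i + 2)"
  shows "card V < CV"
proof (rule ccontr)
  assume "\<not> card V < CV"
  then have big: "CV \<le> card V" by simp
  have finV: "finite V" using VX finite_X finite_subset by blast
  have m01: "1 \<le> m0" by (simp add: m0_def)
  then have m11: "1 \<le> m1" by (simp add: m1_def)
  \<comment> \<open>The first round makes every vertex at every level constant or injective; the
    second, with the Boolean functions in \<open>G2\<close>, makes coincidences uniform.\<close>
  define G1 where "G1 = (\<lambda>(j, i). vertex_at f j i) ` ({..t} \<times> {..L})"
  define G2 where "G2 = (\<lambda>(j, i, i') x. vertex_at f j i x = vertex_at f j i' x) ` ({..t} \<times> {..L} \<times> {..L})"
  have G1: "finite G1" "card G1 \<le> (t + 1) * (L + 1)"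
    using card_image_le[of "{..t} \<times> {..L}" "\<lambda>(j, i). vertex_at f j i"] by (auto simp: G1_def card_cartesian_product)
  have G2: "finite G2" "card G2 \<le> (t + 1) * ((L + 1) * (L + 1))"
    using card_image_le[of "{..t} \<times> {..L} \<times> {..L}" "\<lambda>(j, i, i') x. vertex_at f j i x = vertex_at f j i' x"]
    by (auto simp: G2_def card_cartesian_product)
  have "m1 ^ (2 ^ card G1) \<le> CV" unfolding CV_def using G1(2) m11 by (intro power_increasing) auto
  then obtain S1 where S1: "S1 \<subseteq> V" "m1 \<le> card S1" "\<forall>g\<in>G1. (\<exists>c. \<forall>x\<in>S1. g x = c) \<or> inj_on g S1"
    using const_or_inj_subset[OF G1(1) finV, of m1] big m11 by auto
  have finS1: "finite S1" using S1(1) finV finite_subset by blast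
  have "m0 ^ (2 ^ card G2) \<le> m1" unfolding m1_def using G2(2) m01 by (intro power_increasing) auto
  then obtain S where S: "S \<subseteq> S1" "m0 \<le> card S" "\<forall>g\<in>G2. (\<exists>c. \<forall>x\<in>S. g x = c) \<or> inj_on g S"
    using const_or_inj_subset[OF G2(1) finS1, of m0] S1(2) m01 by auto
  have SV: "S \<subseteq> V" using S S1 by auto
  have "clean_walks K e k r r' t f S"
  proof unfold_locales
    show "polyfun GE dE (f j)" if "j < t" for j using pff that .
    show "S \<subseteq> \<Omega>" using SV VX by auto
    show "2 \<le> card S" using S(2) by (simp add: m0_def)
    show "snd x = snd y" "fst x 0 = fst y 0" "vertex_at f t L x = vertex_at f t L y" if "x \<in> S" "y \<in> S" for x y
      using that SV by (auto intro: snd_eq start_eq end_eq)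
    show "fst x i \<noteq> fst x (i + 2)" if "x \<in> S" "i + 2 \<le> L" for x i
      using nonback[of x i] that SV by blast
    fix i j assume ij: "j \<le> t" "i \<le> L"
    then have "vertex_at f j i \<in> G1" unfolding G1_def by (intro image_eqI[of _ _ "(j, i)"]) auto
    then have "(\<exists>c. \<forall>x\<in>S1. vertex_at f j i x = c) \<or> inj_on (vertex_at f j i) S1" using S1(3) by blast
    then show "(\<forall>x\<in>S. \<forall>y\<in>S. vertex_at f j i x = vertex_at f j i y) \<or> inj_on (vertex_at f j i) S"
      using S(1) by (metis inj_on_subset subsetD)
    fix i' assume "i' \<le> L"
    then have "(\<lambda>x. vertex_at f j i x = vertex_at f j i' x) \<in> G2"
      unfolding G2_def using ij by (intro image_eqI[of _ _ "(j, i, i')"]) auto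
    from bspec[OF S(3) this]
    show "(\<forall>x\<in>S. vertex_at f j i x = vertex_at f j i' x) \<or> (\<forall>x\<in>S. vertex_at f j i x \<noteq> vertex_at f j i' x)"
    proof (elim disjE exE)
      fix c assume "\<forall>x\<in>S. (vertex_at f j i x = vertex_at f j i' x) = c"
      then show ?thesis by (cases c) auto
    next
      assume "inj_on (\<lambda>x. vertex_at f j i x = vertex_at f j i' x) S"
      then have "card S \<le> card (UNIV :: bool set)" by (intro card_inj_on_le) auto
      then show ?thesis using S(2) by (simp add: m0_def)
    qed
  qed
  then interpret clean_walks K e k r r' t f S .
  have "card S < nn * Bt ^ t" by (rule card_clean[OF good])
  then show False using S(2) by (simp add: m0_def)
qed

end

section \<open>The graph\<close>

text \<open>The graph lives on vectors over the chosen field; relabelling gives a vertex type that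
  is the same for all \<open>q\<close>.\<close>

lemma nat_copy_of_bipartite_graph:
  fixes G :: "'v ugraph"
  assumes bip: "bipartite_with_parts G M N"
  shows "\<exists>(G' :: nat ugraph) M' N'. bipartite_with_parts G' M' N' \<and> card M' = card M \<and> card N' = card N \<and>
    card (edges G') = card (edges G) \<and> (\<forall>H :: 'w ugraph. finite_simple_graph H \<longrightarrow> free_of G H \<longrightarrow> free_of G' H)"
proof -
  have fin: "finite (verts G)" and V: "verts G = M \<union> N" "M \<inter> N = {}"
    and sub: "\<And>d. d \<in> edges G \<Longrightarrow> d \<subseteq> verts G \<and> card d = 2"
    and ed: "\<And>d. d \<in> edges G \<Longrightarrow> \<exists>x\<in>M. \<exists>y\<in>N. d = {x, y}"
    using bip by (auto simp: bipartite_with_parts_def finite_simple_graph_def)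
  obtain h :: "'v \<Rightarrow> nat" where h: "inj_on h (verts G)"
    using finite_imp_inj_to_nat_seg[OF fin] by blast
  have hM: "inj_on h M" "inj_on h N" using h V(1) by (auto intro: inj_on_subset)
  define G' :: "nat ugraph" where "G' = (h ` verts G, (`) h ` edges G)"
  have inj: "inj_on ((`) h) (edges G)"
    by (rule inj_onI) (use sub h in \<open>metis inj_on_image_eq_iff\<close>)
  have "bipartite_with_parts G' (h ` M) (h ` N)"
    unfolding bipartite_with_parts_def finite_simple_graph_def
  proof (intro conjI ballI)
    show "finite (verts G')" using fin by (simp add: G'_def)
    show "verts G' = h ` M \<union> h ` N" using V by (auto simp: G'_def)
    show "h ` M \<inter> h ` N = {}" using inj_on_image_Int[OF h, of M N] V by auto
    fix d assume "d \<in> edges G'"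
    then obtain d0 where d0: "d0 \<in> edges G" "d = h ` d0" by (auto simp: G'_def)
    show "d \<subseteq> verts G'" using sub[OF d0(1)] d0(2) by (auto simp: G'_def)
    show "card d = 2" using sub[OF d0(1)] d0(2) h by (metis card_image inj_on_subset)
    show "\<exists>x\<in>h ` M. \<exists>y\<in>h ` N. d = {x, y}" using ed[OF d0(1)] d0(2) by auto
  qed
  moreover have "free_of G' H" if H: "finite_simple_graph H" "free_of G H" for H :: "'w ugraph"
    unfolding free_of_def
  proof
    assume "contains_copy G' H"
    then obtain \<phi> where \<phi>: "inj_on \<phi> (verts H)" "\<phi> ` verts H \<subseteq> verts G'" "\<forall>d\<in>edges H. \<phi> ` d \<in> edges G'"
      by (auto simp: contains_copy_def)
    let ?g = "inv_into (verts G) h"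
    have "inj_on (?g \<circ> \<phi>) (verts H)"
      using \<phi>(1,2) by (intro comp_inj_on inj_on_inv_into) (auto simp: G'_def)
    moreover have "(?g \<circ> \<phi>) ` verts H \<subseteq> verts G"
      using \<phi>(2) by (auto simp: G'_def image_subset_iff intro!: inv_into_into)
    moreover have "(?g \<circ> \<phi>) ` d \<in> edges G" if d: "d \<in> edges H" for d
    proof -
      obtain d0 where d0: "d0 \<in> edges G" "\<phi> ` d = h ` d0" using \<phi>(3) d by (auto simp: G'_def)
      have "?g ` (h ` d0) = d0" using sub[OF d0(1)] h by (intro inv_into_image_cancel) auto
      then show ?thesis using d0 by (simp only: image_comp[symmetric])
    qed
    ultimately have "contains_copy G H" unfolding contains_copy_def by blast
    then show False using H(2) by (simp add: free_of_def)
  qed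
  moreover have "card (edges G') = card (edges G)" using inj by (simp add: G'_def card_image)
  ultimately show ?thesis using card_image[OF hM(1)] card_image[OF hM(2)] by metis
qed

section \<open>The graph and its edges\<close>

definition trunc :: "nat \<Rightarrow> 'a::zero coords \<Rightarrow> 'a coords" where
  "trunc j u = (\<lambda>c. if c < j then u c else 0)"

context tower begin

definition adj :: "(nat \<Rightarrow> 'a edge \<Rightarrow> 'a) \<Rightarrow> 'a coords \<times> 'a coords \<Rightarrow> 'a coords \<times> 'a coords \<Rightarrow> bool" where
  "adj f w z \<longleftrightarrow> (\<forall>j<t. snd w j + snd z j = f j (fst w, fst z, trunc j (snd w), trunc j (snd z)))"

lemma trunc_lab: "u \<in> lab t \<Longrightarrow> trunc t u = u"
  by (auto simp: trunc_def lab_def fun_eq_iff)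

lemma trunc_Suc: "trunc (Suc j) u = (trunc j u)(j := u j)"
  by (auto simp: trunc_def fun_eq_iff less_Suc_eq)

text \<open>The relation at level \<open>j\<close> fixes the \<open>j\<close>-th coordinate from the
  lower ones, so a neighbour is determined by its label.\<close>

lemma adj_unique_right:
  assumes "adj f w z" "adj f w z'" "fst z = fst z'" "snd z \<in> lab t" "snd z' \<in> lab t"
  shows "z = z'"
proof -
  have "trunc j (snd z) = trunc j (snd z')" if "j \<le> t" for j
    using that
  proof (induction j)
    case (Suc j)
    then have IH: "trunc j (snd z) = trunc j (snd z')" and j: "j < t" by auto
    have "snd w j + snd z j = snd w j + snd z' j" using assms(1-3) IH j by (simp add: adj_def)
    then show ?case using IH by (simp add: trunc_Suc)
  qed (simp add: trunc_def)
  then show ?thesis using trunc_lab assms(3-5) by (metis order.refl prod.expand)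
qed

lemma adj_unique_left:
  assumes "adj f w z" "adj f w' z" "fst w = fst w'" "snd w \<in> lab t" "snd w' \<in> lab t"
  shows "w = w'"
proof -
  have "trunc j (snd w) = trunc j (snd w')" if "j \<le> t" for j
    using that
  proof (induction j)
    case (Suc j)
    then have IH: "trunc j (snd w) = trunc j (snd w')" and j: "j < t" by auto
    have "snd w j + snd z j = snd w' j + snd z j" using assms(1-3) IH j by (simp add: adj_def)
    then show ?case using IH by (simp add: trunc_Suc)
  qed (simp add: trunc_def)
  then show ?thesis using trunc_lab assms(3-5) by (metis order.refl prod.expand)
qed

text \<open>The neighbour is the second vertex of a walk starting at \<open>(a, u)\<close> with next
  label \<open>b\<close>. The remaining labels do not influence it and are set to zero.\<close>

lemma adj_exists:
  assumes pff: "\<And>j. j < t \<Longrightarrow> polyfun GE dE (f j)" and "a \<in> lab r" "b \<in> lab r'" "u \<in> lab t"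
  shows "\<exists>v\<in>lab t. adj f (a, u) (b, v)"
proof -
  define P :: "nat \<Rightarrow> 'a coords" where "P = (\<lambda>i. if i = 0 then a else if i = 1 then b else (\<lambda>_. 0))"
  define x where "x = (P, u)"
  have z: "(\<lambda>_. 0) \<in> lab n" for n by (simp add: lab_def zeroK)
  have "x \<in> \<Omega>" using assms L3 z by (auto simp: \<Omega>_def x_def P_def rho_def)
  then have v: "lev f x t 1 \<in> lab t" using lev_lab[of f x t 1] pff L3 by simp
  have "u j + lev f x t 1 j = f j (a, b, trunc j u, trunc j (lev f x t 1))" if "j < t" for j
  proof -
    have "lev f x j 0 = trunc j u" by (simp add: lev_start trunc_def x_def cong: if_cong)
    moreover have "lev f x j 1 = trunc j (lev f x t 1)" unfolding trunc_def by (rule lev_trunc_le) (use that in simp)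
    moreover have "lev f x t 1 j = lev f x (Suc j) 1 j"
      using fun_cong[OF lev_trunc_le[of "Suc j" t f x 1], of j] that by (simp del: lev.simps)
    moreover have "lev f x (Suc j) 1 j = f j (a, b, lev f x j 0, lev f x j 1) - u j"
      by (simp add: edge_def x_def P_def)
    ultimately show ?thesis by (metis add.commute diff_add_cancel)
  qed
  then show ?thesis using v by (intro bexI[of _ "lev f x t 1"]) (auto simp: adj_def)
qed

definition VM :: "(bool \<times> 'a coords \<times> 'a coords) set" where "VM = {False} \<times> lab r \<times> lab t"
definition VN :: "(bool \<times> 'a coords \<times> 'a coords) set" where "VN = {True} \<times> lab r' \<times> lab t"
definition Gr :: "(nat \<Rightarrow> 'a edge \<Rightarrow> 'a) \<Rightarrow> (bool \<times> 'a coords \<times> 'a coords) ugraph" where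
  "Gr f = (VM \<union> VN, {{(False, w), (True, z)} | w z. w \<in> lab r \<times> lab t \<and> z \<in> lab r' \<times> lab t \<and> adj f w z})"

lemma bipartite_Gr: "bipartite_with_parts (Gr f) VM VN"
  unfolding bipartite_with_parts_def finite_simple_graph_def
proof (intro conjI ballI)
  show "finite (verts (Gr f))" by (simp add: Gr_def VM_def VN_def finite_lab)
  show "verts (Gr f) = VM \<union> VN" by (simp add: Gr_def)
  show "VM \<inter> VN = {}" by (auto simp: VM_def VN_def)
  fix d assume "d \<in> edges (Gr f)"
  then obtain w z where d: "d = {(False, w), (True, z)}" "w \<in> lab r \<times> lab t" "z \<in> lab r' \<times> lab t"
    by (auto simp: Gr_def)
  show "d \<subseteq> verts (Gr f)" using d by (auto simp: Gr_def VM_def VN_def)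
  show "card d = 2" using d by simp
  show "\<exists>x\<in>VM. \<exists>y\<in>VN. d = {x, y}" using d by (auto simp: VM_def VN_def)
qed

lemma card_VM: "card VM = q ^ (r + t)" and card_VN: "card VN = q ^ (r' + t)"
  by (simp_all add: VM_def VN_def card_cartesian_product card_lab power_add)

lemma card_edges_Gr:
  assumes pff: "\<And>j. j < t \<Longrightarrow> polyfun GE dE (f j)"
  shows "q ^ (r + r' + t) \<le> card (edges (Gr f))"
proof -
  define nb where "nb a b u = (SOME v. v \<in> lab t \<and> adj f (a, u) (b, v))" for a b u
  have nb: "nb a b u \<in> lab t \<and> adj f (a, u) (b, nb a b u)" if "a \<in> lab r" "b \<in> lab r'" "u \<in> lab t" for a b u
  proof -
    have "\<exists>v. v \<in> lab t \<and> adj f (a, u) (b, v)" using adj_exists[of f a b u] pff that by blast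
    then show ?thesis unfolding nb_def by (rule someI_ex)
  qed
  define em where "em = (\<lambda>(a, b, u). {(False, a, u), (True, b, nb a b u)})"
  have "inj_on em (lab r \<times> lab r' \<times> lab t)"
  proof (rule inj_onI)
    fix x y assume eq: "em x = em y"
    obtain a b u where x: "x = (a, b, u)" by (cases x)
    obtain a' b' u' where y: "y = (a', b', u')" by (cases y)
    have "{(False, a, u), (True, b, nb a b u)} = {(False, a', u'), (True, b', nb a' b' u')}"
      using eq by (simp only: x y em_def case_prod_conv)
    then show "x = y" by (simp only: doubleton_eq_iff prod.inject x y) blast
  qed
  moreover have "em ` (lab r \<times> lab r' \<times> lab t) \<subseteq> edges (Gr f)"
  proof clarify
    fix a b u assume "a \<in> lab r" "b \<in> lab r'" "u \<in> lab t"
    then show "em (a, b, u) \<in> edges (Gr f)" using nb[of a b u] unfolding em_def Gr_def by auto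
  qed
  moreover have "finite (edges (Gr f))"
  proof (rule finite_subset)
    show "edges (Gr f) \<subseteq> Pow (VM \<union> VN)" by (auto simp: Gr_def VM_def VN_def)
  qed (simp add: VM_def VN_def finite_lab)
  ultimately have "card (lab r \<times> lab r' \<times> lab t) \<le> card (edges (Gr f))" by (rule card_inj_on_le)
  then show ?thesis by (simp add: card_cartesian_product card_lab power_add mult.assoc)
qed

section \<open>From paths in the graph to walks\<close>

lemma edge_Gr_cases:
  assumes "{v, v'} \<in> edges (Gr f)"
  shows "v \<in> VM \<Longrightarrow> v' \<in> VN \<and> adj f (snd v) (snd v')" "v \<in> VN \<Longrightarrow> v' \<in> VM \<and> adj f (snd v') (snd v)"
proof -
  obtain w z where wz: "{v, v'} = {(False, w), (True, z)}" "w \<in> lab r \<times> lab t" "z \<in> lab r' \<times> lab t" "adj f w z"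
    using assms by (auto simp: Gr_def)
  then show "v \<in> VM \<Longrightarrow> v' \<in> VN \<and> adj f (snd v) (snd v')" "v \<in> VN \<Longrightarrow> v' \<in> VM \<and> adj f (snd v') (snd v)"
    by (simp_all only: doubleton_eq_iff VM_def VN_def) auto
qed

text \<open>Along a path, \<open>adj\<close> is the recursion defining \<open>crd\<close>, so the
  labels and the first vertex reproduce all vertices.\<close>

lemma walk_of_path:
  assumes lab: "\<And>i. i \<le> L \<Longrightarrow> fst (w i) \<in> lab (rho i) \<and> snd (w i) \<in> lab t"
    and ad: "\<And>i. i < L \<Longrightarrow> if even i then adj f (w i) (w (Suc i)) else adj f (w (Suc i)) (w i)"
    and x: "x = ((\<lambda>i. if i \<le> L then fst (w i) else (\<lambda>_. 0)), snd (w 0))"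
  shows "x \<in> \<Omega>" "i \<le> L \<Longrightarrow> vertex_at f t i x = w i"
proof -
  show "x \<in> \<Omega>" using lab by (auto simp: \<Omega>_def x)
  have "\<forall>i\<le>L. lev f x j i = trunc j (snd (w i))" if "j \<le> t" for j
    using that
  proof (induction j)
    case 0
    show ?case by (simp add: trunc_def)
  next
    case (Suc j)
    then have IH: "\<And>i. i \<le> L \<Longrightarrow> lev f x j i = trunc j (snd (w i))" and j: "j < t" by auto
    have "crd (f j) (edge (fst x) (lev f x j)) (snd x j) i = snd (w i) j" if "i \<le> L" for i
      using that
    proof (induction i)
      case (Suc i)
      have i: "i \<le> L" "i < L" using Suc.prems by auto
      have "f j (edge (fst x) (lev f x j) i) = snd (w i) j + snd (w (Suc i)) j"
        using ad[OF i(2)] j IH[of i] IH[of "Suc i"] i Suc.prems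
        by (cases "even i") (auto simp: adj_def edge_def x add.commute)
      then show ?case using Suc.IH[OF i(1)] by simp
    qed (simp add: x)
    then show ?case using IH by (auto simp: trunc_Suc)
  qed
  then show "vertex_at f t i x = w i" if "i \<le> L" using that lab[OF that] trunc_lab by (simp add: vertex_at_def x prod_eq_iff)
qed

lemma path_family_bound:
  assumes pff: "\<And>j. j < t \<Longrightarrow> polyfun GE dE (f j)" and good: "\<And>j. j < t \<Longrightarrow> good f j"
    and start: "A \<in> VM" "\<And>i. i < s \<Longrightarrow> w i 0 = A" and fin: "\<And>i. i < s \<Longrightarrow> w i L = B"
    and ed: "\<And>i j. i < s \<Longrightarrow> j < L \<Longrightarrow> {w i j, w i (Suc j)} \<in> edges (Gr f)"
    and dist: "\<And>i j. i < s \<Longrightarrow> j + 2 \<le> L \<Longrightarrow> w i j \<noteq> w i (j + 2)"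
    and inj: "\<And>i i'. i < s \<Longrightarrow> i' < s \<Longrightarrow> w i 1 = w i' 1 \<Longrightarrow> i = i'"
  shows "s < CV"
proof -
  have side: "w i j \<in> (if even j then VM else VN)" if "i < s" "j \<le> L" for i j
    using that(2)
  proof (induction j)
    case 0
    then show ?case using start that(1) by simp
  next
    case (Suc j)
    then show ?case using edge_Gr_cases[OF ed[OF that(1), of j]] by (auto split: if_splits)
  qed
  have ad: "if even j then adj f (snd (w i j)) (snd (w i (Suc j))) else adj f (snd (w i (Suc j))) (snd (w i j))"
    if "i < s" "j < L" for i j
    using edge_Gr_cases[OF ed[OF that]] side[OF that(1), of j] that(2) by auto
  define x where "x i = ((\<lambda>j. if j \<le> L then fst (snd (w i j)) else (\<lambda>_. 0)), snd (snd (w i 0)))" for i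
  have lab: "fst (snd (w i j)) \<in> lab (rho j) \<and> snd (snd (w i j)) \<in> lab t" if "i < s" "j \<le> L" for i j
    using side[OF that] by (auto simp: VM_def VN_def rho_def split: if_splits)
  have xX: "x i \<in> \<Omega>" and vtx: "\<And>j. j \<le> L \<Longrightarrow> vertex_at f t j (x i) = snd (w i j)" if "i < s" for i
    using walk_of_path[of "\<lambda>j. snd (w i j)" f "x i"] lab[OF that] ad[OF that] by (auto simp: x_def)
  have fst_w: "fst (w i j) = odd j" if "i < s" "j \<le> L" for i j
    using side[OF that] by (auto simp: VM_def VN_def split: if_splits)
  have injx: "inj_on x {..<s}"
  proof (rule inj_onI)
    fix i i' assume a: "i \<in> {..<s}" "i' \<in> {..<s}" "x i = x i'"
    then have "snd (w i 1) = snd (w i' 1)" using vtx[of i 1] vtx[of i' 1] L3 by simp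
    then have "w i 1 = w i' 1" using fst_w[of i 1] fst_w[of i' 1] a L3 by (simp add: prod_eq_iff)
    then show "i = i'" using inj a by simp
  qed
  have "card (x ` {..<s}) < CV"
  proof (rule card_walks[of f])
    show "polyfun GE dE (f j)" "good f j" if "j < t" for j using that pff good by auto
    show "x ` {..<s} \<subseteq> \<Omega>" using xX by auto
    show "snd y = snd z" if "y \<in> x ` {..<s}" "z \<in> x ` {..<s}" for y z
      using that start by (auto simp: x_def)
    show "fst y 0 = fst z 0" if "y \<in> x ` {..<s}" "z \<in> x ` {..<s}" for y z
      using that start by (auto simp: x_def)
    show "vertex_at f t L y = vertex_at f t L z" if "y \<in> x ` {..<s}" "z \<in> x ` {..<s}" for y z
      using that vtx[of _ L] fin by auto
    \<comment> \<open>Vertices two steps apart share a neighbour; with equal labels they would be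
      equal, contrary to \<open>dist\<close>.\<close>
    show "fst y j \<noteq> fst y (j + 2)" if y: "y \<in> x ` {..<s}" and j: "j + 2 \<le> L" for y j
    proof
      assume eq: "fst y j = fst y (j + 2)"
      obtain i where i: "i < s" "y = x i" using y by auto
      have eq': "fst (snd (w i j)) = fst (snd (w i (j + 2)))" using eq i j by (simp add: x_def)
      have l: "snd (snd (w i j)) \<in> lab t" "snd (snd (w i (j + 2))) \<in> lab t" using lab[OF i(1)] j by auto
      have "snd (w i j) = snd (w i (j + 2))"
      proof (cases "even j")
        case True
        then show ?thesis using adj_unique_left[OF _ _ eq' l] ad[OF i(1), of j] ad[OF i(1), of "Suc j"] j by auto
      next
        case False
        then show ?thesis using adj_unique_right[OF _ _ eq' l] ad[OF i(1), of j] ad[OF i(1), of "Suc j"] j by auto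
      qed
      moreover have "fst (w i j) = fst (w i (j + 2))" using fst_w[OF i(1)] j by simp
      ultimately show False using dist[OF i(1) j] by (simp add: prod_eq_iff)
    qed
  qed
  then show ?thesis by (simp add: card_image[OF injx])
qed

text \<open>The length \<open>L\<close> is odd, so the two branch vertices lie on different sides,
  and the paths can be read from the one in \<open>VM\<close>, reversed if necessary. Internal
  disjointness makes their second vertices distinct.\<close>

lemma theta_free_Gr:
  assumes pff: "\<And>j. j < t \<Longrightarrow> polyfun GE dE (f j)" and good: "\<And>j. j < t \<Longrightarrow> good f j" and s: "CV + 1 \<le> s"
  shows "free_of (Gr f) (theta_graph s (2 * k - 1))"
  unfolding free_of_def L_def[symmetric]
proof
  assume "contains_copy (Gr f) (theta_graph s L)"
  then obtain \<phi> where \<phi>: "inj_on \<phi> (verts (theta_graph s L))" "\<phi> ` verts (theta_graph s L) \<subseteq> verts (Gr f)"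
    "\<forall>d\<in>edges (theta_graph s L). \<phi> ` d \<in> edges (Gr f)" by (auto simp: contains_copy_def)
  define w where "w i j = \<phi> (theta_vertex L i j)" for i j
  have vert: "theta_vertex L i j \<in> verts (theta_graph s L)" if "i < s" "j \<le> L" for i j
    using that by (auto simp: theta_graph_def)
  have w_eq: "w i j = w i' j' \<longleftrightarrow> theta_vertex L i j = theta_vertex L i' j'"
    if "i < s" "j \<le> L" "i' < s" "j' \<le> L" for i j i' j'
    using inj_on_eq_iff[OF \<phi>(1) vert vert] that by (simp add: w_def)
  have ed: "{w i j, w i (Suc j)} \<in> edges (Gr f)" if "i < s" "j < L" for i j
  proof -
    have "{theta_vertex L i j, theta_vertex L i (Suc j)} \<in> edges (theta_graph s L)"
      using that by (auto simp: theta_graph_def)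
    then show ?thesis using \<phi>(3) by (auto simp: w_def)
  qed
  have s0: "0 < s" using s by simp
  have w0: "w i 0 = w 0 0" and wL: "w i L = w 0 L" for i by (simp_all add: w_def theta_vertex_def)
  have ne: "w i j \<noteq> w i j'" if "i < s" "j \<le> L" "j' \<le> L" "j \<noteq> j'" for i j j'
    using w_eq[of i j i j'] that by (auto simp: theta_vertex_def)
  have inner: "i = i'" if "i < s" "i' < s" "w i j = w i' j" "0 < j" "j < L" for i i' j
    using w_eq[of i j i' j] that by (auto simp: theta_vertex_def)
  have "w 0 0 \<in> VM \<union> VN" using \<phi>(2) vert[of 0 0] s0 by (auto simp: w_def Gr_def)
  then show False
  proof
    assume "w 0 0 \<in> VM"
    then have "s < CV"
      using L3 by (intro path_family_bound[of f "w 0 0" s w "w 0 L"] pff good w0 wL ed ne) (auto intro: inner[of _ _ 1])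
    then show False using s by simp
  next
    assume VN0: "w 0 0 \<in> VN"
    have side: "w 0 j \<in> (if even j then VN else VM)" if "j \<le> L" for j
      using that
    proof (induction j)
      case (Suc j)
      then show ?case using edge_Gr_cases[OF ed[OF s0, of j]] by (auto split: if_splits)
    qed (simp add: VN0)
    have "odd L" using k2 by (simp add: L_def)
    then have "w 0 L \<in> VM" using side[of L] by simp
    moreover have "{w i (L - j), w i (L - Suc j)} \<in> edges (Gr f)" if "i < s" "j < L" for i j
    proof -
      have "Suc (L - Suc j) = L - j" using that by simp
      then show ?thesis using ed[of i "L - Suc j"] that by (simp add: insert_commute)
    qed
    ultimately have "s < CV"
      using L3 wL w0
      by (intro path_family_bound[of f "w 0 L" s "\<lambda>i j. w i (L - j)" "w 0 0"] pff good ne)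
        (auto intro: inner[of _ _ "L - 1"])
    then show False using s by simp
  qed
qed

theorem exists_theta_free_graph:
  assumes "Q0 < q" "CV + 1 \<le> s"
  shows "\<exists>(G :: nat ugraph) M N. bipartite_with_parts G M N \<and> card M = q ^ (r + t) \<and> card N = q ^ (r' + t) \<and>
    q ^ (r + r' + t) \<le> card (edges G) \<and> free_of G (theta_graph s (2 * k - 1))"
proof -
  obtain f where f: "\<And>j. j < t \<Longrightarrow> polyfun GE dE (f j)" "\<And>j. j < t \<Longrightarrow> good f j"
    using exists_good[OF assms(1)] by blast
  show ?thesis
    using nat_copy_of_bipartite_graph[OF bipartite_Gr[of f], where 'w = "nat \<times> nat"]
      theta_free_Gr[of f s] f assms(2) card_edges_Gr[of f] card_VM card_VN finite_simple_graph_theta_graph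
    by metis
qed

end

section \<open>Finite fields\<close>

lemma (in ring_hom_ring) hom_add_pow_one:
  "h ([(n::nat)] \<cdot>\<^bsub>R\<^esub> \<one>\<^bsub>R\<^esub>) = [n] \<cdot>\<^bsub>S\<^esub> \<one>\<^bsub>S\<^esub>"
  by (induction n) auto

text \<open>Dividing \<open>X\<^sup>n - 1\<close> by \<open>X - a\<close> leaves a cofactor with value \<open>n a\<^sup>n\<^sup>-\<^sup>1\<close> at \<open>a\<close>, so all roots are simple.\<close>

lemma (in algebraically_closed) card_roots_of_unity:
  assumes n: "0 < n" and char: "[(n::nat)] \<cdot> \<one> \<noteq> \<zero>"
  shows "card {x \<in> carrier L. x [^] n = \<one>} = n"
proof -
  let ?P = "poly_ring L"
  note sub = carrier_is_subring
  interpret UP: domain ?P using univ_poly_is_domain[OF sub] .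
  have Xc: "X \<in> carrier ?P" using var_closed(1)[OF sub] .
  define p where "p = X [^]\<^bsub>?P\<^esub> n \<ominus>\<^bsub>?P\<^esub> \<one>\<^bsub>?P\<^esub>"
  have pc: "p \<in> carrier ?P" using Xc by (simp add: p_def)
  have ev: "ring_hom_ring ?P L (\<lambda>p. eval p x)" if "x \<in> carrier L" for x
    using eval_cring_hom[OF sub that] by (intro ring_hom_ring.intro UP.ring_axioms ring_axioms ring_hom_ring_axioms.intro) (simp add: ring_hom_cring_def ring_hom_cring_axioms_def)
  have evp: "eval p x = x [^] n \<ominus> \<one>" if "x \<in> carrier L" for x
  proof -
    interpret h: ring_hom_ring ?P L "\<lambda>p. eval p x" using ev[OF that] .
    show ?thesis using Xc that by (simp add: p_def a_minus_def h.hom_nat_pow eval_var)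
  qed
  have deg: "degree p = n"
  proof -
    have "\<ominus>\<^bsub>?P\<^esub> \<one>\<^bsub>?P\<^esub> = [\<ominus> \<one>]"
    proof -
      have "[\<ominus> \<one>] \<in> carrier ?P" unfolding sym[OF univ_poly_carrier] polynomial_def by (simp add: l_neg) 
      moreover have "[\<ominus> \<one>] \<oplus>\<^bsub>?P\<^esub> \<one>\<^bsub>?P\<^esub> = \<zero>\<^bsub>?P\<^esub>"
        by (simp add: univ_poly_add univ_poly_one univ_poly_zero l_neg)
      ultimately show ?thesis using UP.minus_equality by auto
    qed
    then have "p = poly_add (monom \<one> n) [\<ominus> \<one>]"
      using unitary_monom_eq_var_pow[OF sub, of n] by (simp add: p_def a_minus_def univ_poly_add)
    moreover have "polynomial (carrier L) (monom \<one> n)"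
      using monom_is_polynomial[OF sub, of \<one> n] by simp
    moreover have "polynomial (carrier L) [\<ominus> \<one>]" unfolding polynomial_def by simp
    ultimately show ?thesis
      using poly_add_degree_eq[OF sub, of "monom \<one> n" "[\<ominus> \<one>]"] n by (simp add: monom_def)
  qed
  have pne: "p \<noteq> []" using deg n by auto
  have mult1: "alg_mult p a \<le> 1" for a
  proof (rule ccontr)
    assume "\<not> alg_mult p a \<le> 1"
    then have am: "2 \<le> alg_mult p a" by simp
    then have ac: "a \<in> carrier L" by (auto simp: alg_mult_def split: if_splits)
    define lin where "lin = [\<one>, \<ominus> a]"
    have linc: "lin \<in> carrier ?P"
      using ac unfolding lin_def sym[OF univ_poly_carrier] polynomial_def by auto
    have "is_root p a" using am alg_mult_gt_zero_iff_is_root[OF pc, of a] by simp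
    then have an: "a [^] n = \<one>" using evp[OF ac] ac by (simp add: is_root_def)
    have a0: "a \<noteq> \<zero>" using an n by (auto simp: nat_pow_zero)
    \<comment> \<open>The constant polynomial \<open>a\<close>; as a list it is normalised only
      because \<open>a\<close> is nonzero.\<close>
    define y where "y = [a]"
    have yc: "y \<in> carrier ?P" using ac a0 unfolding y_def sym[OF univ_poly_carrier] polynomial_def by auto
    interpret h: ring_hom_ring ?P L "\<lambda>p. eval p a" using ev[OF ac] .
    have hy: "eval y a = a" and hl: "eval lin a = \<zero>"
      using ac by (auto simp: y_def lin_def r_neg)
    have Xly: "X = lin \<oplus>\<^bsub>?P\<^esub> y"
      using ac a0 by (simp add: univ_poly_add lin_def y_def var_def l_neg)
    \<comment> \<open>\<open>Q\<close> is the quotient of X^m - a^m by X - a, with value m a^(m-1)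
      at \<open>a\<close>. The extra factor \<open>a\<close> avoids a negative exponent for
      \<open>m = 0\<close>.\<close>
    have Q: "\<exists>Q\<in>carrier ?P. X [^]\<^bsub>?P\<^esub> m = lin \<otimes>\<^bsub>?P\<^esub> Q \<oplus>\<^bsub>?P\<^esub> y [^]\<^bsub>?P\<^esub> m \<and>
      eval Q a \<otimes> a = [m] \<cdot> (a [^] m)" for m :: nat
    proof (induction m)
      case 0
      show ?case using linc by (intro bexI[of _ "\<zero>\<^bsub>?P\<^esub>"]) (auto simp: ac)
    next
      case (Suc m)
      then obtain Q where Q: "Q \<in> carrier ?P" "X [^]\<^bsub>?P\<^esub> m = lin \<otimes>\<^bsub>?P\<^esub> Q \<oplus>\<^bsub>?P\<^esub> y [^]\<^bsub>?P\<^esub> m"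
        "eval Q a \<otimes> a = [m] \<cdot> (a [^] m)" by blast
      have ym: "y [^]\<^bsub>?P\<^esub> m \<in> carrier ?P" using yc by simp
      let ?Q = "Q \<otimes>\<^bsub>?P\<^esub> X \<oplus>\<^bsub>?P\<^esub> y [^]\<^bsub>?P\<^esub> m"
      have "X [^]\<^bsub>?P\<^esub> Suc m = (lin \<otimes>\<^bsub>?P\<^esub> Q \<oplus>\<^bsub>?P\<^esub> y [^]\<^bsub>?P\<^esub> m) \<otimes>\<^bsub>?P\<^esub> X" using Q(2) by simp
      also have "\<dots> = lin \<otimes>\<^bsub>?P\<^esub> (Q \<otimes>\<^bsub>?P\<^esub> X) \<oplus>\<^bsub>?P\<^esub> y [^]\<^bsub>?P\<^esub> m \<otimes>\<^bsub>?P\<^esub> (lin \<oplus>\<^bsub>?P\<^esub> y)"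
        using Q(1) ym linc Xc yc by (simp add: UP.l_distr UP.m_assoc Xly[symmetric])
      also have "\<dots> = lin \<otimes>\<^bsub>?P\<^esub> ?Q \<oplus>\<^bsub>?P\<^esub> y [^]\<^bsub>?P\<^esub> Suc m"
        using Q(1) ym linc Xc yc by (simp add: UP.r_distr UP.a_assoc UP.m_comm)
      finally have 1: "X [^]\<^bsub>?P\<^esub> Suc m = lin \<otimes>\<^bsub>?P\<^esub> ?Q \<oplus>\<^bsub>?P\<^esub> y [^]\<^bsub>?P\<^esub> Suc m" .
      have Qa: "eval Q a \<in> carrier L" using Q(1) by simp
      have "eval ?Q a = eval Q a \<otimes> a \<oplus> a [^] m"
        using Q(1) Xc ym yc ac by (simp add: h.hom_nat_pow hy eval_var)
      then have "eval ?Q a \<otimes> a = [m] \<cdot> (a [^] m) \<otimes> a \<oplus> a [^] m \<otimes> a"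
        using Q(3) Qa ac by (simp add: l_distr)
      also have "\<dots> = [Suc m] \<cdot> (a [^] Suc m)" using ac by (simp add: add_pow_ldistr)
      finally show ?case using 1 Q(1) Xc ym by (intro bexI[of _ ?Q]) auto
    qed
    obtain Q where Qc: "Q \<in> carrier ?P" and Q1: "X [^]\<^bsub>?P\<^esub> n = lin \<otimes>\<^bsub>?P\<^esub> Q \<oplus>\<^bsub>?P\<^esub> y [^]\<^bsub>?P\<^esub> n"
      and Q2: "eval Q a \<otimes> a = [n] \<cdot> (a [^] n)" using Q[of n] by blast
    have yn: "y [^]\<^bsub>?P\<^esub> n = \<one>\<^bsub>?P\<^esub>"
    proof -
      have "y [^]\<^bsub>?P\<^esub> m = [a [^] m]" for m :: nat
      proof (induction m)
        case (Suc m)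
        have "a [^] i \<noteq> \<zero>" for i :: nat using a0 ac by (induction i) (auto simp: integral_iff)
        from this[of m] this[of "Suc m"] have "a [^] m \<noteq> \<zero>" "a [^] m \<otimes> a \<noteq> \<zero>" by simp_all
        then show ?case using Suc ac by (simp add: univ_poly_mult y_def)
      qed (simp add: univ_poly_one)
      then show ?thesis using an by (simp add: univ_poly_one)
    qed
    have p_eq: "p = lin \<otimes>\<^bsub>?P\<^esub> Q"
      unfolding p_def Q1 yn using linc Qc by (simp add: a_minus_def UP.a_assoc UP.r_neg)
    have "(lin [^]\<^bsub>?P\<^esub> (2::nat)) pdivides p"
      using le_alg_mult_imp_pdivides[OF ac pc am] by (simp add: lin_def)
    then obtain G where G: "G \<in> carrier ?P" "p = lin [^]\<^bsub>?P\<^esub> (2::nat) \<otimes>\<^bsub>?P\<^esub> G"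
      unfolding pdivides_def factor_def by blast
    \<comment> \<open>A double root would make the quotient divisible by \<open>lin\<close> as well,
      so its value at \<open>a\<close> would be zero and \<open>n\<close> would vanish in the
      field.\<close>
    have "lin \<otimes>\<^bsub>?P\<^esub> Q = lin \<otimes>\<^bsub>?P\<^esub> (lin \<otimes>\<^bsub>?P\<^esub> G)"
      using p_eq G linc by (simp add: numeral_2_eq_2 UP.m_assoc)
    moreover have "lin \<noteq> \<zero>\<^bsub>?P\<^esub>" by (simp add: lin_def univ_poly_zero)
    ultimately have "Q = lin \<otimes>\<^bsub>?P\<^esub> G" using UP.m_lcancel[of lin Q "lin \<otimes>\<^bsub>?P\<^esub> G"] linc Qc G by simp
    then have "eval Q a = \<zero>" using linc G(1) hl by simp
    then have "[n] \<cdot> \<one> = \<zero>" using Q2 an ac by simp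
    then show False using char by simp
  qed
  have "size (roots p) = n" using roots_over_carrier[OF pc] deg by (simp add: splitted_def)
  moreover have "roots p = mset_set (set_mset (roots p))"
  proof (rule multiset_eqI)
    fix a
    have "count (roots p) a \<le> 1" using mult1 alg_mult_eq_count_roots[OF pc] by metis
    then show "count (roots p) a = count (mset_set (set_mset (roots p))) a"
      by (cases "a \<in># roots p") (auto simp: count_mset_set' le_Suc_eq count_eq_zero_iff)
  qed
  ultimately have "card (set_mset (roots p)) = n" by (metis size_mset_set)
  moreover have "set_mset (roots p) = {x \<in> carrier L. x [^] n = \<one>}"
    using roots_mem_iff_is_root[OF pc] evp pne by (auto simp: is_root_def)
  ultimately show ?thesis by simp
qed

section \<open>A ring containing every finite field\<close>

definition AC :: "nat \<Rightarrow> ((int list \<times> nat) multiset \<Rightarrow> int) ring" where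
  "AC p = field.alg_closure (residue_ring (int (if Factorial_Ring.prime p then p else 2)))"

text \<open>Replacing a composite index by 2 makes \<open>AC p\<close> a field for every
  \<open>p\<close>, as the product over all \<open>p\<close> requires.\<close>

lemma AC_closed: "algebraically_closed (AC p)" and AC_char: "Factorial_Ring.prime p \<Longrightarrow> [p] \<cdot>\<^bsub>AC p\<^esub> \<one>\<^bsub>AC p\<^esub> = \<zero>\<^bsub>AC p\<^esub>"
proof -
  define p' where "p' = (if Factorial_Ring.prime p then p else 2)"
  have pp: "Factorial_Ring.prime p'" by (simp add: p'_def)
  define R where "R = residue_ring (int p')"
  interpret R: residues_prime p' R using pp by unfold_locales (simp_all add: R_def)
  have cl: "algebraic_closure (AC p) (R.indexed_const ` carrier R)"
    and hom: "R.indexed_const \<in> ring_hom R (AC p)"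
    using R.alg_closureE by (simp_all add: AC_def p'_def R_def)
  interpret A: algebraic_closure "AC p" "R.indexed_const ` carrier R" by (rule cl)
  show "algebraically_closed (AC p)" by unfold_locales
  assume "Factorial_Ring.prime p"
  then have p': "p' = p" by (simp add: p'_def)
  have "[m] \<cdot>\<^bsub>R\<^esub> \<one>\<^bsub>R\<^esub> = int m mod int p'" for m :: nat
  proof (induction m)
    case 0
    then show ?case by (simp add: R.res_zero_eq)
  next
    case (Suc m)
    then show ?case by (simp add: R.res_add_eq R.res_one_eq mod_simps add.commute)
  qed
  then have 0: "[p] \<cdot>\<^bsub>R\<^esub> \<one>\<^bsub>R\<^esub> = \<zero>\<^bsub>R\<^esub>" by (simp add: p' R.res_zero_eq)
  interpret h: ring_hom_ring R "AC p" R.indexed_const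
    using hom by (intro ring_hom_ring.intro R.ring_axioms A.ring_axioms ring_hom_ring_axioms.intro)
  show "[p] \<cdot>\<^bsub>AC p\<^esub> \<one>\<^bsub>AC p\<^esub> = \<zero>\<^bsub>AC p\<^esub>" using h.hom_add_pow_one[of p] 0 by simp
qed

interpretation AC: domain "AC p" for p
  using AC_closed by (simp add: algebraically_closed_def field_def)

text \<open>The product over all primes of the algebraic closures of the prime fields: one type that contains all finite fields.\<close>

typedef uring = "{f :: nat \<Rightarrow> (int list \<times> nat) multiset \<Rightarrow> int. \<forall>p. f p \<in> carrier (AC p)}"
  by (rule exI[of _ "\<lambda>p. \<zero>\<^bsub>AC p\<^esub>"]) simp

setup_lifting type_definition_uring

instantiation uring :: comm_ring_1
begin

lift_definition zero_uring :: uring is "\<lambda>p. \<zero>\<^bsub>AC p\<^esub>" by simp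
lift_definition one_uring :: uring is "\<lambda>p. \<one>\<^bsub>AC p\<^esub>" by simp
lift_definition plus_uring :: "uring \<Rightarrow> uring \<Rightarrow> uring" is "\<lambda>f g p. f p \<oplus>\<^bsub>AC p\<^esub> g p" by simp
lift_definition times_uring :: "uring \<Rightarrow> uring \<Rightarrow> uring" is "\<lambda>f g p. f p \<otimes>\<^bsub>AC p\<^esub> g p" by simp
lift_definition uminus_uring :: "uring \<Rightarrow> uring" is "\<lambda>f p. \<ominus>\<^bsub>AC p\<^esub> f p" by simp
lift_definition minus_uring :: "uring \<Rightarrow> uring \<Rightarrow> uring" is "\<lambda>f g p. f p \<ominus>\<^bsub>AC p\<^esub> g p" by simp

instance
proof
  fix a b c :: uring
  show "a * b * c = a * (b * c)" by transfer (simp add: AC.m_assoc)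
  show "a * b = b * a" by transfer (simp add: AC.m_comm)
  show "1 * a = a" by transfer simp
  show "a + b + c = a + (b + c)" by transfer (simp add: AC.a_assoc)
  show "a + b = b + a" by transfer (simp add: AC.a_comm)
  show "0 + a = a" by transfer simp
  show "- a + a = 0" by transfer (simp add: AC.l_neg)
  show "a - b = a + - b" by transfer (simp add: a_minus_def)
  show "(a + b) * c = a * c + b * c" by transfer (simp add: AC.l_distr)
  show "(0::uring) \<noteq> 1" by transfer (metis AC.one_not_zero)
qed

end

lemma Rep_uring_power: "Rep_uring (u ^ n) p = Rep_uring u p [^]\<^bsub>AC p\<^esub> n"
proof (induction n)
  case 0
  show ?case by (simp add: one_uring.rep_eq)
next
  case (Suc n)
  have "Rep_uring u p \<in> carrier (AC p)" using Rep_uring[of u] by simp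
  then show ?case using Suc by (simp add: times_uring.rep_eq AC.m_comm)
qed

lemma Rep_uring_of_nat: "Rep_uring (of_nat n) p = [n] \<cdot>\<^bsub>AC p\<^esub> \<one>\<^bsub>AC p\<^esub>"
  by (induction n) (simp_all add: zero_uring.rep_eq one_uring.rep_eq plus_uring.rep_eq AC.a_comm)

text \<open>Every mixed binomial term contains the factor \<open>of_nat p * u\<close>. The argument
  works inside one component of the product, although the ring itself does not have characteristic
  \<open>p\<close>.\<close>

lemma frobenius_add:
  fixes u v :: "'a::comm_ring_1"
  assumes p: "Factorial_Ring.prime p" and u: "of_nat p * u = 0"
  shows "(u + v) ^ (p ^ n) = u ^ (p ^ n) + v ^ (p ^ n)"
proof -
  have 1: "(u + v) ^ p = u ^ p + v ^ p" if u: "of_nat p * u = 0" for u v :: 'a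
  proof -
    have p0: "0 < p" using p prime_gt_0_nat by blast
    have "(u + v) ^ p = (\<Sum>k\<le>p. of_nat (p choose k) * u ^ k * v ^ (p - k))" by (rule binomial_ring)
    also have "\<dots> = (\<Sum>k\<in>{0, p}. of_nat (p choose k) * u ^ k * v ^ (p - k))"
    proof (rule sum.mono_neutral_right)
      show "\<forall>k\<in>{..p} - {0, p}. of_nat (p choose k) * u ^ k * v ^ (p - k) = 0"
      proof
        fix k assume k: "k \<in> {..p} - {0, p}"
        then have "p dvd (p choose k)" using p by (intro dvd_choose_prime) auto
        then obtain c where c: "p choose k = p * c" by blast
        obtain k' where k': "k = Suc k'" using k by (cases k) auto
        have "of_nat (p choose k) * u ^ k = of_nat c * u ^ k' * (of_nat p * u)"
          unfolding c by (simp add: k' algebra_simps)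
        then show "of_nat (p choose k) * u ^ k * v ^ (p - k) = 0" using u by simp
      qed
    qed auto
    also have "\<dots> = u ^ p + v ^ p" using p0 by simp
    finally show ?thesis .
  qed
  show ?thesis
  proof (induction n)
    case (Suc n)
    have "of_nat p * u ^ (p ^ n) = 0"
    proof -
      obtain m where "p ^ n = Suc m" using p prime_gt_0_nat by (metis gr0_implies_Suc zero_less_power)
      then show ?thesis using u by (simp add: mult.assoc[symmetric])
    qed
    then have "(u ^ p ^ n + v ^ p ^ n) ^ p = (u ^ p ^ n) ^ p + (v ^ p ^ n) ^ p" by (rule 1)
    then show ?case using Suc by (simp only: power_Suc2 power_mult)
  qed simp
qed

text \<open>The roots of X^Q - X in the algebraic closure of the prime field are moved into the
  component \<open>p\<close> of the product; the idempotent \<open>e\<close> of that component is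
  the unit.\<close>

lemma exists_finite_subfield:
  assumes "primepow Q"
  shows "\<exists>(K::uring set) e. finite_subfield K e \<and> card K = Q"
proof -
  obtain p n where p: "Factorial_Ring.prime p" "0 < n" "Q = p ^ n" using assms by (auto simp: primepow_def)
  have Q2: "2 \<le> Q" using primepow_gt_Suc_0[OF assms] by simp
  then obtain m where m: "Q = Suc (Suc m)" by (metis add_2_eq_Suc le_Suc_ex)
  let ?L = "AC p"
  define emb where "emb x = Abs_uring (\<lambda>p'. if p' = p then x else \<zero>\<^bsub>AC p'\<^esub>)" for x
  have Rep_emb: "Rep_uring (emb x) = (\<lambda>p'. if p' = p then x else \<zero>\<^bsub>AC p'\<^esub>)" if "x \<in> carrier ?L" for x
    unfolding emb_def by (rule Abs_uring_inverse) (use that in auto)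
  define e where "e = emb \<one>\<^bsub>?L\<^esub>"
  have Rep_e: "Rep_uring e = (\<lambda>p'. if p' = p then \<one>\<^bsub>?L\<^esub> else \<zero>\<^bsub>AC p'\<^esub>)" by (simp add: e_def Rep_emb)
  have Rc: "Rep_uring u p' \<in> carrier (AC p')" for u p' using Rep_uring[of u] by simp
  define K where "K = {u. e * u = u \<and> u ^ Q = u}"
  have pe: "of_nat p * e = 0"
  proof -
    have "Rep_uring (of_nat p * e) p' = Rep_uring 0 p'" for p'
      using AC_char[OF p(1)] Rc[of "of_nat p"] by (auto simp: times_uring.rep_eq zero_uring.rep_eq Rep_e Rep_uring_of_nat)
    then show ?thesis using Rep_uring_inject by blast
  qed
  have pK: "of_nat p * u = 0" if "u \<in> K" for u
  proof -
    have "of_nat p * u = (of_nat p * e) * u" using that by (simp add: K_def mult.assoc)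
    then show ?thesis using pe by simp
  qed
  have eu: "e * u = u \<longleftrightarrow> (\<forall>p'. p' \<noteq> p \<longrightarrow> Rep_uring u p' = \<zero>\<^bsub>AC p'\<^esub>)" for u
    unfolding Rep_uring_inject[symmetric] fun_eq_iff using Rc[of u]
    by (auto simp: times_uring.rep_eq Rep_e)
  have ee: "e * e = e" by (simp add: eu Rep_e)
  define S where "S = {x \<in> carrier ?L. x [^]\<^bsub>?L\<^esub> Q = x}"
  have Sem: "x [^]\<^bsub>?L\<^esub> Q = x \<longleftrightarrow> x = \<zero>\<^bsub>?L\<^esub> \<or> x [^]\<^bsub>?L\<^esub> (Q - 1) = \<one>\<^bsub>?L\<^esub>" if x: "x \<in> carrier ?L" for x
  proof (cases "x = \<zero>\<^bsub>?L\<^esub>")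
    case True
    then show ?thesis using Q2 by (simp add: AC.nat_pow_zero)
  next
    case False
    have "x [^]\<^bsub>?L\<^esub> Q = x \<longleftrightarrow> x [^]\<^bsub>?L\<^esub> Suc m \<otimes>\<^bsub>?L\<^esub> x = \<one>\<^bsub>?L\<^esub> \<otimes>\<^bsub>?L\<^esub> x" using x by (simp add: m)
    also have "\<dots> \<longleftrightarrow> x [^]\<^bsub>?L\<^esub> Suc m = \<one>\<^bsub>?L\<^esub>"
      by (rule AC.m_rcancel) (use x False in \<open>simp_all del: AC.nat_pow_Suc\<close>)
    finally show ?thesis using False by (simp add: m del: AC.nat_pow_Suc)
  qed
  \<comment> \<open>As \<open>p\<close> divides \<open>Q\<close>, the number \<open>Q - 1\<close> is
    minus one in the field. So there are exactly \<open>Q - 1\<close> nonzero roots.\<close>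
  have nz: "[(Q - 1)] \<cdot>\<^bsub>?L\<^esub> \<one>\<^bsub>?L\<^esub> \<noteq> \<zero>\<^bsub>?L\<^esub>"
  proof
    assume a: "[(Q - 1)] \<cdot>\<^bsub>?L\<^esub> \<one>\<^bsub>?L\<^esub> = \<zero>\<^bsub>?L\<^esub>"
    have "[(p * c)] \<cdot>\<^bsub>?L\<^esub> \<one>\<^bsub>?L\<^esub> = \<zero>\<^bsub>?L\<^esub>" for c :: nat
    proof (induction c)
      case (Suc c)
      then show ?case using AC_char[OF p(1)] AC.add.nat_pow_mult[of "\<one>\<^bsub>?L\<^esub>" p p "p * c", symmetric] by simp
    qed simp
    moreover have "Q = p * p ^ (n - 1)" using p by (cases n) auto
    ultimately have "[Q] \<cdot>\<^bsub>?L\<^esub> \<one>\<^bsub>?L\<^esub> = \<zero>\<^bsub>?L\<^esub>" by metis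
    then have "\<one>\<^bsub>?L\<^esub> = \<zero>\<^bsub>?L\<^esub>" using a by (simp add: m)
    then show False by simp
  qed
  have finU: "finite {x \<in> carrier ?L. x [^]\<^bsub>?L\<^esub> (Q - 1) = \<one>\<^bsub>?L\<^esub>}"
    and cardU: "card {x \<in> carrier ?L. x [^]\<^bsub>?L\<^esub> (Q - 1) = \<one>\<^bsub>?L\<^esub>} = Q - 1"
    using algebraically_closed.card_roots_of_unity[OF AC_closed _ nz] Q2 by (auto intro: card_ge_0_finite)
  have S_eq: "S = insert \<zero>\<^bsub>?L\<^esub> {x \<in> carrier ?L. x [^]\<^bsub>?L\<^esub> (Q - 1) = \<one>\<^bsub>?L\<^esub>}"
    using Sem by (auto simp: S_def)
  have cardS: "card S = Q" "finite S"
  proof -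
    have "\<zero>\<^bsub>?L\<^esub> \<notin> {x \<in> carrier ?L. x [^]\<^bsub>?L\<^esub> (Q - 1) = \<one>\<^bsub>?L\<^esub>}" using Q2 by (simp add: AC.nat_pow_zero)
    then show "card S = Q" "finite S" unfolding S_eq using finU cardU Q2 by simp_all
  qed
  have "K = emb ` S"
  proof (rule equalityI; rule subsetI)
    fix u assume u: "u \<in> K"
    have "Rep_uring u p [^]\<^bsub>?L\<^esub> Q = Rep_uring u p" using u Rep_uring_power[of u Q p] by (simp add: K_def)
    then have "Rep_uring u p \<in> S" using Rc by (simp add: S_def)
    moreover have "u = emb (Rep_uring u p)"
      unfolding Rep_uring_inject[symmetric] Rep_emb[OF Rc] using u by (auto simp: K_def eu fun_eq_iff)
    ultimately show "u \<in> emb ` S" by blast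
  next
    fix u assume "u \<in> emb ` S"
    then obtain x where x: "x \<in> carrier ?L" "x [^]\<^bsub>?L\<^esub> Q = x" "u = emb x" by (auto simp: S_def)
    have "u ^ Q = u" unfolding Rep_uring_inject[symmetric] fun_eq_iff Rep_uring_power x(3) Rep_emb[OF x(1)]
      using x Q2 by (auto simp: AC.nat_pow_zero)
    moreover have "e * u = u" using x by (simp add: eu Rep_emb)
    ultimately show "u \<in> K" by (simp add: K_def)
  qed
  moreover have "inj_on emb S"
    by (rule inj_onI) (metis (mono_tags, lifting) Rep_emb S_def mem_Collect_eq)
  ultimately have cK: "card K = Q" "finite K" using cardS by (auto simp: card_image)
  have add: "u + v \<in> K" if "u \<in> K" "v \<in> K" for u v
    using that frobenius_add[OF p(1) pK[OF that(1)], of v n] p(3) by (simp add: K_def distrib_left)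
  have "finite_subfield K e"
  proof
    have eQ: "e ^ i = e" if "0 < i" for i using that
    proof (induction i)
      case (Suc i)
      then show ?case using ee by (cases i) auto
    qed simp
    show eK: "e \<in> K" using ee eQ Q2 by (simp add: K_def)
    show "e \<noteq> 0"
    proof
      assume "e = 0"
      then have "\<one>\<^bsub>?L\<^esub> = \<zero>\<^bsub>?L\<^esub>" using fun_cong[OF Rep_e, of p] by (simp add: zero_uring.rep_eq)
      then show False by simp
    qed
    fix x assume x: "x \<in> K"
    show "e * x = x" using x by (simp add: K_def)
    show "x * y \<in> K" if "y \<in> K" for y using x that by (simp add: K_def power_mult_distrib mult.assoc[symmetric])
    \<comment> \<open>The negative is the \<open>(p - 1)\<close>-fold sum, so closure under addition
      is enough.\<close>
    show "- x \<in> K"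
    proof -
      have 0: "0 \<in> K" by (simp add: K_def m)
      have "of_nat i * x \<in> K" for i using 0 x by (induction i) (auto simp: distrib_right intro: add)
      moreover have "of_nat (p - 1) * x = - x"
      proof -
        have "of_nat (Suc (p - 1)) * x = 0" using pK[OF x] p(1) prime_gt_0_nat by simp
        then show ?thesis by (simp add: distrib_right eq_neg_iff_add_eq_0 add.commute)
      qed
      ultimately show ?thesis by metis
    qed
    \<comment> \<open>Here \<open>m = Q - 2\<close>. For \<open>Q = 2\<close> the power
      \<open>x ^ m\<close> is the unit of the whole ring, and the factor \<open>e\<close> brings it
      into \<open>K\<close>.\<close>
    show "\<exists>y\<in>K. x * y = e" if "x \<noteq> 0"
    proof (rule bexI[of _ "x ^ m * e"])
      have xQ: "e * x = x" "x ^ Q = x" using x by (auto simp: K_def)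
      show "x ^ m * e \<in> K"
      proof -
        have "(x ^ m * e) ^ Q = (x ^ Q) ^ m * e ^ Q" by (simp add: power_mult_distrib power_mult[symmetric] mult.commute)
        moreover have "e * (x ^ m * e) = x ^ m * e" using ee by (metis mult.commute mult.left_commute)
        ultimately show ?thesis using xQ eQ Q2 by (simp add: K_def)
      qed
      have "Rep_uring x p \<noteq> \<zero>\<^bsub>?L\<^esub>"
      proof
        assume 0: "Rep_uring x p = \<zero>\<^bsub>?L\<^esub>"
        have "Rep_uring x p' = Rep_uring 0 p'" for p'
          using 0 xQ(1) by (cases "p' = p") (auto simp: eu zero_uring.rep_eq)
        then show False using that Rep_uring_inject by blast
      qed
      moreover have "Rep_uring x p [^]\<^bsub>?L\<^esub> Q = Rep_uring x p" using xQ Rep_uring_power[of x Q p] by simp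
      ultimately have "Rep_uring x p [^]\<^bsub>?L\<^esub> (Q - 1) = \<one>\<^bsub>?L\<^esub>" using Sem[OF Rc] by blast
      then have 1: "Rep_uring (x ^ Suc m) p = \<one>\<^bsub>?L\<^esub>" by (simp add: Rep_uring_power m del: AC.nat_pow_Suc power_Suc)
      have "Rep_uring (x ^ Suc m * e) p' = Rep_uring e p'" for p'
        using 1 Rc[of "x ^ Suc m" p'] by (auto simp: times_uring.rep_eq Rep_e simp del: power_Suc)
      then have "x ^ Suc m * e = e" using Rep_uring_inject by blast
      then show "x * (x ^ m * e) = e" by (simp add: mult.assoc)
    qed
  qed (use cK add in auto)
  then show ?thesis using cK by blast
qed

section \<open>From the rational exponent to the parameters of the tower\<close>

theorem theorem5p6:
  fixes k l :: nat and \<alpha> :: real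
  assumes "k \<ge> 2"
    and "\<alpha> \<in> \<rat>"
    and "\<alpha> \<in> {(real k - 1) / real k .. 1}"
    and "l = (LEAST m. m > 0 \<and> real m / (2 * real k - 1) \<in> \<int>
                       \<and> \<alpha> * real m / (2 * real k - 1) \<in> \<int>)"
  shows "\<exists>s0 q0 :: nat. \<forall>s\<ge>s0. \<forall>q\<ge>q0. primepow q \<longrightarrow>
    (\<exists>(G :: nat ugraph) M N.
       bipartite_with_parts G M N \<and>
       real (card M) = real q powr (\<alpha> * real l) \<and>
       card N = q ^ l \<and>
       free_of G (theta_graph s (2 * k - 1)) \<and>
       real (card (edges G)) \<ge> 1 / 2 * real (card M) powr (real k / (2 * real k - 1))
                                    * real (card N) powr (real k / (2 * real k - 1)))"
proof -
  define c :: nat where "c = 2 * k - 1"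
  have c: "real c = 2 * real k - 1" "0 < c" using assms(1) by (auto simp: c_def of_nat_diff)
  define good_len where "good_len m \<longleftrightarrow> m > 0 \<and> real m / (2 * real k - 1) \<in> \<int> \<and> \<alpha> * real m / (2 * real k - 1) \<in> \<int>" for m :: nat
  \<comment> \<open>The product of \<open>c\<close> and the denominator of \<open>\<alpha>\<close>
    is admissible, so the least element exists and is admissible too.\<close>
  have "\<exists>m. good_len m"
  proof -
    obtain a b :: int where ab: "b > 0" "\<alpha> = of_int a / of_int b" using assms(2) by (auto elim: Rats_cases')
    have "good_len (c * nat b)" unfolding good_len_def c(1)[symmetric] using ab c(2) by auto
    then show ?thesis by blast
  qed
  moreover have "l = (LEAST m. good_len m)" unfolding good_len_def by (rule assms(4))
  ultimately have "good_len l" using LeastI_ex by blast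
  then have li: "real l / real c \<in> \<int>" "\<alpha> * real l / real c \<in> \<int>"
    by (auto simp: good_len_def c(1))
  have \<alpha>0: "0 \<le> \<alpha>"
  proof -
    have "0 \<le> (real k - 1) / real k" using assms(1) by simp
    then show ?thesis using assms(3) by (meson atLeastAtMost_iff order_trans)
  qed
  obtain g h :: nat where g: "real l / real c = real g" and h: "\<alpha> * real l / real c = real h"
  proof -
    have nat: "\<exists>n::nat. x = real n" if "x \<in> \<int>" "0 \<le> x" for x :: real
      using that by (metis Ints_cases of_int_0_le_iff of_nat_nat)
    show thesis using nat[OF li(1)] nat[OF li(2)] \<alpha>0 that by auto
  qed
  have lg: "l = c * g" using g c(2) by (simp add: field_simps flip: of_nat_mult)
  have lh: "\<alpha> * real l = real (c * h)" using h c(2) by (simp add: field_simps)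
  have \<alpha>g: "\<alpha> * real g = real h" using lh lg c(2) by simp
  have hg: "h \<le> g"
  proof -
    have "\<alpha> * real g \<le> 1 * real g" using assms(3) by (intro mult_right_mono) auto
    then show ?thesis using \<alpha>g by simp
  qed
  \<comment> \<open>The lower bound on \<open>\<alpha>\<close> makes the subtraction defining
    \<open>r\<close> exact; \<open>\<alpha> \<le> 1\<close> does the same for \<open>r'\<close>
    through \<open>hg'\<close>.\<close>
  have gh: "(k - 1) * g \<le> k * h"
  proof -
    have "real k - 1 \<le> \<alpha> * real k" using assms(1,3) by (simp add: field_simps)
    then have "(real k - 1) * real g \<le> real k * (\<alpha> * real g)"
      using mult_right_mono[of "real k - 1" "\<alpha> * real k" "real g"] by (simp add: mult_ac)
    then have "real ((k - 1) * g) \<le> real (k * h)" using \<alpha>g assms(1) by (simp add: of_nat_diff)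
    then show ?thesis by linarith
  qed
  define t r r' where "t = (k - 1) * (g + h)" and "r = k * h - (k - 1) * g" and "r' = k * g - (k - 1) * h"
  have hg': "(k - 1) * h \<le> k * g" using hg by (intro mult_le_mono) auto
  obtain k' where k': "k = Suc k'" using assms(1) by (cases k) auto
  \<comment> \<open>These are the exponents of \<open>q\<close> for the two parts and for the
    edges.\<close>
  have rt: "r + t = c * h" "r' + t = l" "r + r' + t = k * (g + h)"
    using gh hg' by (auto simp: r_def r'_def t_def c_def lg k' algebra_simps)
  have tt: "t = (k - 1) * (r + r')" using rt by (simp add: t_def k')
  show ?thesis
  \<comment> \<open>Both thresholds depend only on \<open>k\<close>, \<open>r\<close>,
    \<open>r'\<close> and \<open>t\<close>, so they can be fixed before the field is chosen.\<close>
  proof (rule exI[of _ "tower.CV k r r' t + 1"], rule exI[of _ "tower.Q0 k r r' t + 1"], intro allI impI)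
    fix s Q :: nat
    assume s: "tower.CV k r r' t + 1 \<le> s" and Q: "tower.Q0 k r r' t + 1 \<le> Q" and pp: "primepow Q"
    obtain K :: "uring set" and e where K: "finite_subfield K e" "card K = Q"
      using exists_finite_subfield[OF pp] by blast
    interpret finite_subfield K e by (rule K(1))
    interpret tower K e k r r' t by unfold_locales (use assms(1) tt in auto)
    obtain G :: "nat ugraph" and M N where G: "bipartite_with_parts G M N" "card M = Q ^ (r + t)" "card N = Q ^ (r' + t)"
      "Q ^ (r + r' + t) \<le> card (edges G)" "free_of G (theta_graph s (2 * k - 1))"
      using exists_theta_free_graph[of s] s Q unfolding K(2) by auto
    have Q0: "0 < real Q" using primepow_gt_Suc_0[OF pp] by simp
    have pw: "(real Q ^ (c * n)) powr (real k / (2 * real k - 1)) = real Q ^ (k * n)" for n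
    proof -
      have "(real Q ^ (c * n)) powr (real k / (2 * real k - 1)) = real Q powr (real (c * n) * (real k / real c))"
        using Q0 by (simp add: c(1) powr_powr flip: powr_realpow)
      also have "real (c * n) * (real k / real c) = real (k * n)" using c(2) by simp
      finally show ?thesis unfolding powr_realpow[OF Q0] .
    qed
    have "real (card M) = real Q powr (\<alpha> * real l)"
      by (simp only: G(2) rt(1) lh powr_realpow[OF Q0] of_nat_power)
    moreover have "card N = Q ^ l" using G(3) rt by simp
    moreover have "1 / 2 * real (card M) powr (real k / (2 * real k - 1)) * real (card N) powr (real k / (2 * real k - 1))
        \<le> real (card (edges G))"
    proof -
      have "real (card M) powr (real k / (2 * real k - 1)) * real (card N) powr (real k / (2 * real k - 1))
          = real Q ^ (k * h) * real Q ^ (k * g)"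
        using pw[of h] pw[of g] G(2,3) by (simp add: rt lg)
      also have "\<dots> = real (Q ^ (r + r' + t))"
        unfolding rt(3) by (simp add: distrib_left power_add mult.commute)
      also have "\<dots> \<le> real (card (edges G))" using G(4) by (rule of_nat_mono)
      finally have "real (card M) powr (real k / (2 * real k - 1)) * real (card N) powr (real k / (2 * real k - 1))
          \<le> real (card (edges G))" .
      moreover have "0 \<le> real (card M) powr (real k / (2 * real k - 1)) * real (card N) powr (real k / (2 * real k - 1))"
        by simp
      ultimately show ?thesis by linarith
    qed
    ultimately show "\<exists>(G :: nat ugraph) M N. bipartite_with_parts G M N \<and>
       real (card M) = real Q powr (\<alpha> * real l) \<and> card N = Q ^ l \<and>
       free_of G (theta_graph s (2 * k - 1)) \<and>
       real (card (edges G)) \<ge> 1 / 2 * real (card M) powr (real k / (2 * real k - 1))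
                                    * real (card N) powr (real k / (2 * real k - 1))"
      using G(1,5) by blast
  qed
qed

end
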